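(* Let $B$ be a paracompact space and let $\mathcal{U}=\{U_j\}$ be a countable locally finite open cover of $B$ such that each set $U_j$ and each nonempty binary intersection $U_j\cap U_k$ is locally path connected and simply connected. For $\varepsilon\le1$ there is a well-defined function $$\mathrm{Cl}:\check H^1_\varepsilon(\mathcal{U};\mathcal{C}_{O(2)})\to\coprod_{[\omega]\in\check H^1(\mathcal{U};\underline{\mathbb{Z}_2})}\check H^2(\mathcal{U};\mathbb{Z}_\omega)$$ given by $\Omega\mapsto\big([\det_*\Omega],\Delta_\omega(\mathrm{abs}(\Omega))\big)$, where $\omega=\det_*\Omega$. This map is $1$-stable in the sense that $\mathrm{Cl}(\Omega)=\mathrm{Cl}(\Omega')$ whenever $d_H(\Omega,\Omega')<1$. Moreover, if $\varepsilon<\frac19$, then $\mathrm{Cl}(\Omega)$ returns the first Stiefel–Whitney class and twisted Euler class of the true circle bundle represented by the cocycle $\Pi_Z(\Omega)$.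
   Context: **Approximate cohomology.** $U_{jk}=U_j\cap U_k$, $U_{jkl}=U_j\cap U_k\cap U_l$; indices of tuples need not be distinct. $\check C^1(\mathcal{U};\mathcal{C}_{O(2)})$ is the set of families of continuous maps $\Omega_{jk}:U_{jk}\to O(2)$, with $d_Z(\Omega,\Omega')=\sup_{j,k}\sup_{b\in U_{jk}}\|\Omega_{jk}(b)-\Omega'_{jk}(b)\|_F$ (Frobenius norm). $\check Z^1_\varepsilon(\mathcal{U};\mathcal{C}_{O(2)})$ consists of those with $\sup_{j,k,l}\sup_{b\in U_{jkl}}\|\Omega_{jk}(b)\Omega_{kl}(b)-\Omega_{jl}(b)\|_F<\varepsilon$; $\check Z^1(\mathcal{U};\mathcal{C}_{O(2)})$ of those with $\Omega_{jk}\Omega_{kl}=\Omega_{jl}$ exactly. $\check H^1_\varepsilon(\mathcal{U};\mathcal{C}_{O(2)})$ is the set of orbits of $\check Z^1_\varepsilon$ under $(\phi\cdot\Omega)_{jk}=\phi_j\Omega_{jk}\phi_k^{-1}$ with $\phi_j:U_j\to O(2)$ continuous. The distance $d_H$ between two orbits is the infimum of $d_Z$ over pairs of representatives. **Twisted coefficients.** $\mathbb{Z}_2=\{\pm1\}$. For a cocycle $\omega=\{\omega_{jk}\}$ ($\omega_{jk}\in\{\pm1\}$ on $U_{jk}$, $\omega_{jk}\omega_{kl}=\omega_{jl}$), $\mathbb{Z}_\omega$ is the locally constant sheaf with stalk $\mathbb{Z}$ glued by $\omega$; $\check C^p(\mathcal{U};\mathbb{Z}_\omega)$ consists of families of locally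 constant functions $U_{j_0\cdots j_p}\to\mathbb{Z}$ (sections written in the $j_0$-component), with $(\delta_\omega\beta)_{jkl}=\omega_{jk}\beta_{kl}-\beta_{jl}+\beta_{jk}$, $(\delta_\omega e)_{jklm}=\omega_{jk}e_{klm}-e_{jlm}+e_{jkm}-e_{jkl}$. Elements of the coproduct are pairs $(\omega,e)$ with $e\in\check H^2(\mathcal{U};\mathbb{Z}_\omega)$, where for $\phi=\{\phi_j\in\{\pm1\}\}$ and $\omega'_{jk}=\phi_j\omega_{jk}\phi_k$ the pair $(\omega,[e_{jkl}])$ is identified with $(\omega',[\phi_je_{jkl}])$ (isomorphic local systems are identified). **The map.** Let $r(\pm1)=\mathrm{diag}(1,\pm1)$ and $\mathrm{abs}(A)=A\,r(\det A)\in SO(2)$ for $A\in O(2)$, applied entrywise: $\Lambda=\mathrm{abs}(\Omega)$. Let $\exp:\mathbb{R}\to SO(2)$ send $\theta$ to rotation by $2\pi\theta$. Choose continuous lifts $\Theta_{jk}:U_{jk}\to\mathbb{R}$ with $\exp(\Theta_{jk})=\Lambda_{jk}$. Then $\Delta_\omega(\mathrm{abs}(\Omega))\in\check H^2(\mathcal{U};\mathbb{Z}_\omega)$ is the class of the cochain $e_{jkl}=\langle\omega_{jk}\Theta_{kl}-\Theta_{jl}+\Theta_{jk}\rangle$, $\langle\cdot\rangle$ denoting the nearest integer. For an exact cocycle $\widetilde\Omega\in\check Z^1(\mathcal{U};\mathcal{C}_{O(2)})$, the first Stiefel–Whitney class and twisted Euler class of the circle bundle with transition maps $\widetilde\Omega$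 are $[\det_*\widetilde\Omega]$ and the class of $\omega_{jk}\Theta_{kl}-\Theta_{jl}+\Theta_{jk}$ (which is integer-valued in this case), with $\Theta$ a lift of $\mathrm{abs}(\widetilde\Omega)$. **The map $\Pi_Z$.** Index $\mathcal{U}$ by a subset of $\mathbb{N}$ and fix a partition of unity $\{\rho_j\}$ subordinate to $\mathcal{U}$. $\mathrm{Gr}(2)$ is the space of 2-planes in $\mathbb{R}^\infty$, identified with orthogonal projection matrices; $V(2)=\{A\in\mathbb{R}^{\infty\times2}:A^TA=I_2\}$. For $\Omega\in\check Z^1_\varepsilon(\mathcal{U};\mathcal{C}_{O(2)})$, $\varepsilon<\frac12$, let $\Psi_j:U_j\to V(2)$ have $i$-th $2\times2$ block $\sqrt{\rho_i(b)}\,\Omega_{ij}(b)$ (zero if $\rho_i(b)=0$), $\mathrm{cl}(\Omega)(b)=\sum_j\rho_j(b)\Psi_j(b)\Psi_j(b)^T$, and $f_\Omega(b)=\Pi(\mathrm{cl}(\Omega)(b))$, where $\Pi(A)$ is the orthogonal projection onto the span of the eigenvectors of $\frac{A+A^T}{2}$ for its two largest eigenvalues. Let $\widetilde\Psi_j(b)\in V(2)$ be the factor $U$ in the polar decomposition $f_\Omega(b)\Psi_j(b)=UH$. Then $\Pi_Z(\Omega)_{jk}(b)=\widetilde\Psi_j(b)^T\widetilde\Psi_k(b)$. (Known results of Scoccola–Perea: for $\varepsilon<\frac12$ this is a well-defined element of $\check Z^1(\mathcal{U};\mathcal{C}_{O(2)})$, and if $\varepsilon<\frac{\sqrt2}{4}$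 then $d_Z(\Omega,\Pi_Z(\Omega))<9\varepsilon$.) *)

theory Defs
  imports "HOL-Analysis.Analysis" "HOL-Library.Groups_Big_Fun"
begin

text \<open>
  A cover is a family \<open>U j\<close>, \<open>j \<in> J\<close>, with \<open>J :: nat set\<close>.  Families of functions on the
  intersections \<open>U j \<inter> U k\<close>, \<open>U j \<inter> U k \<inter> U l\<close> are represented by total functions, of which only the
  values at indices in \<open>J\<close> and at points of the intersection are ever used; the equivalence
  relations below identify families that agree there (take the trivial gauge transformation, resp.
  the zero coboundary), so the quotients are the intended ones.
\<close>

definition paracompact_space :: "'a topology \<Rightarrow> bool" where
  "paracompact_space X \<longleftrightarrow>
    (\<forall>\<C>. (\<forall>C\<in>\<C>. openin X C) \<and> \<Union>\<C> = topspace X \<longrightarrow>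
      (\<exists>\<V>. (\<forall>V\<in>\<V>. openin X V) \<and> \<Union>\<V> = topspace X \<and>
           (\<forall>V\<in>\<V>. \<exists>C\<in>\<C>. V \<subseteq> C) \<and> locally_finite_in X \<V>))"

section \<open>Approximate O(2)-cocycles\<close>

text \<open>The norm of \<^typ>\<open>real^2^2\<close> is the Euclidean norm of the entries, i.e. the Frobenius norm.\<close>

type_synonym mat2 = "real^2^2"

type_synonym 'a O2_cochain = "nat \<Rightarrow> nat \<Rightarrow> 'a \<Rightarrow> mat2"

definition C1_O2 :: "nat set \<Rightarrow> (nat \<Rightarrow> 'a::topological_space set) \<Rightarrow> 'a O2_cochain set" where
  "C1_O2 J U = {\<Omega>. \<forall>j\<in>J. \<forall>k\<in>J. continuous_on (U j \<inter> U k) (\<Omega> j k) \<and>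
                      (\<forall>b\<in>U j \<inter> U k. orthogonal_matrix (\<Omega> j k b))}"

text \<open>The sets in the next two definitions are bounded for elements of \<^const>\<open>C1_O2\<close>, and nonempty
  as soon as some \<open>U j\<close>, \<open>j \<in> J\<close>, is nonempty.\<close>

definition dZ :: "nat set \<Rightarrow> (nat \<Rightarrow> 'a::topological_space set) \<Rightarrow> 'a O2_cochain \<Rightarrow> 'a O2_cochain \<Rightarrow> real" where
  "dZ J U \<Omega> \<Omega>' = Sup {norm (\<Omega> j k b - \<Omega>' j k b) | j k b. j \<in> J \<and> k \<in> J \<and> b \<in> U j \<inter> U k}"

definition cocycle_defect :: "nat set \<Rightarrow> (nat \<Rightarrow> 'a::topological_space set) \<Rightarrow> 'a O2_cochain \<Rightarrow> real" where
  "cocycle_defect J U \<Omega> =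
     Sup {norm (\<Omega> j k b ** \<Omega> k l b - \<Omega> j l b) | j k l b.
            j \<in> J \<and> k \<in> J \<and> l \<in> J \<and> b \<in> U j \<inter> U k \<inter> U l}"

definition Z1_approx :: "nat set \<Rightarrow> (nat \<Rightarrow> 'a::topological_space set) \<Rightarrow> real \<Rightarrow> 'a O2_cochain set" where
  "Z1_approx J U \<epsilon> = {\<Omega> \<in> C1_O2 J U. cocycle_defect J U \<Omega> < \<epsilon>}"

definition Z1_exact :: "nat set \<Rightarrow> (nat \<Rightarrow> 'a::topological_space set) \<Rightarrow> 'a O2_cochain set" where
  "Z1_exact J U = {\<Omega> \<in> C1_O2 J U. \<forall>j\<in>J. \<forall>k\<in>J. \<forall>l\<in>J. \<forall>b\<in>U j \<inter> U k \<inter> U l.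
                     \<Omega> j k b ** \<Omega> k l b = \<Omega> j l b}"

definition gauge_rel :: "nat set \<Rightarrow> (nat \<Rightarrow> 'a::topological_space set) \<Rightarrow> real
    \<Rightarrow> ('a O2_cochain \<times> 'a O2_cochain) set" where
  "gauge_rel J U \<epsilon> = {(\<Omega>, \<Omega>'). \<Omega> \<in> Z1_approx J U \<epsilon> \<and> \<Omega>' \<in> Z1_approx J U \<epsilon> \<and>
     (\<exists>\<phi> :: nat \<Rightarrow> 'a \<Rightarrow> mat2.
        (\<forall>j\<in>J. continuous_on (U j) (\<phi> j) \<and> (\<forall>b\<in>U j. orthogonal_matrix (\<phi> j b))) \<and>
        (\<forall>j\<in>J. \<forall>k\<in>J. \<forall>b\<in>U j \<inter> U k. \<Omega>' j k b = \<phi> j b ** \<Omega> j k b ** matrix_inv (\<phi> k b)))}"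

definition H1_approx :: "nat set \<Rightarrow> (nat \<Rightarrow> 'a::topological_space set) \<Rightarrow> real \<Rightarrow> 'a O2_cochain set set" where
  "H1_approx J U \<epsilon> = Z1_approx J U \<epsilon> // gauge_rel J U \<epsilon>"

definition orbit :: "nat set \<Rightarrow> (nat \<Rightarrow> 'a::topological_space set) \<Rightarrow> real \<Rightarrow> 'a O2_cochain \<Rightarrow> 'a O2_cochain set" where
  "orbit J U \<epsilon> \<Omega> = gauge_rel J U \<epsilon> `` {\<Omega>}"

definition dH :: "nat set \<Rightarrow> (nat \<Rightarrow> 'a::topological_space set) \<Rightarrow> 'a O2_cochain set \<Rightarrow> 'a O2_cochain set \<Rightarrow> real" where
  "dH J U x y = Inf {dZ J U \<Omega> \<Omega>' | \<Omega> \<Omega>'. \<Omega> \<in> x \<and> \<Omega>' \<in> y}"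

section \<open>Cohomology with twisted integer coefficients\<close>

definition locally_constant_on :: "'a::topological_space set \<Rightarrow> ('a \<Rightarrow> 'b) \<Rightarrow> bool" where
  "locally_constant_on S f \<longleftrightarrow> locally (\<lambda>T. f constant_on T) S"

type_synonym 'a sign_cochain = "nat \<Rightarrow> nat \<Rightarrow> 'a \<Rightarrow> int"

type_synonym 'a int_cochain2 = "nat \<Rightarrow> nat \<Rightarrow> nat \<Rightarrow> 'a \<Rightarrow> int"

definition Z1_sign :: "nat set \<Rightarrow> (nat \<Rightarrow> 'a::topological_space set) \<Rightarrow> 'a sign_cochain set" where
  "Z1_sign J U = {\<omega>.
     (\<forall>j\<in>J. \<forall>k\<in>J. locally_constant_on (U j \<inter> U k) (\<omega> j k) \<and> (\<forall>b\<in>U j \<inter> U k. \<omega> j k b \<in> {1, -1})) \<and>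
     (\<forall>j\<in>J. \<forall>k\<in>J. \<forall>l\<in>J. \<forall>b\<in>U j \<inter> U k \<inter> U l. \<omega> j k b * \<omega> k l b = \<omega> j l b)}"

definition C0_sign :: "nat set \<Rightarrow> (nat \<Rightarrow> 'a::topological_space set) \<Rightarrow> (nat \<Rightarrow> 'a \<Rightarrow> int) set" where
  "C0_sign J U = {\<phi>. \<forall>j\<in>J. locally_constant_on (U j) (\<phi> j) \<and> (\<forall>b\<in>U j. \<phi> j b \<in> {1, -1})}"

definition sign_gauge :: "nat set \<Rightarrow> (nat \<Rightarrow> 'a::topological_space set) \<Rightarrow> (nat \<Rightarrow> 'a \<Rightarrow> int)
    \<Rightarrow> 'a sign_cochain \<Rightarrow> 'a sign_cochain \<Rightarrow> bool" where
  "sign_gauge J U \<phi> \<omega> \<omega>' \<longleftrightarrow> \<phi> \<in> C0_sign J U \<and>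
     (\<forall>j\<in>J. \<forall>k\<in>J. \<forall>b\<in>U j \<inter> U k. \<omega>' j k b = \<phi> j b * \<omega> j k b * \<phi> k b)"

definition H1_sign_class :: "nat set \<Rightarrow> (nat \<Rightarrow> 'a::topological_space set) \<Rightarrow> 'a sign_cochain \<Rightarrow> 'a sign_cochain set" where
  "H1_sign_class J U \<omega> = {\<omega>' \<in> Z1_sign J U. \<omega> \<in> Z1_sign J U \<and> (\<exists>\<phi>. sign_gauge J U \<phi> \<omega> \<omega>')}"

text \<open>The 1-dimensional twisted coboundary is polymorphic: it is applied to integer cochains and to
  real-valued lifts.\<close>

definition twisted_cobd1 :: "'a sign_cochain \<Rightarrow> (nat \<Rightarrow> nat \<Rightarrow> 'a \<Rightarrow> 'r::ring_1)
    \<Rightarrow> nat \<Rightarrow> nat \<Rightarrow> nat \<Rightarrow> 'a \<Rightarrow> 'r" where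
  "twisted_cobd1 \<omega> \<beta> j k l b = of_int (\<omega> j k b) * \<beta> k l b - \<beta> j l b + \<beta> j k b"

definition twisted_cobd2 :: "'a sign_cochain \<Rightarrow> 'a int_cochain2
    \<Rightarrow> nat \<Rightarrow> nat \<Rightarrow> nat \<Rightarrow> nat \<Rightarrow> 'a \<Rightarrow> int" where
  "twisted_cobd2 \<omega> e j k l m b = \<omega> j k b * e k l m b - e j l m b + e j k m b - e j k l b"

definition C1_int :: "nat set \<Rightarrow> (nat \<Rightarrow> 'a::topological_space set) \<Rightarrow> (nat \<Rightarrow> nat \<Rightarrow> 'a \<Rightarrow> int) set" where
  "C1_int J U = {\<beta>. \<forall>j\<in>J. \<forall>k\<in>J. locally_constant_on (U j \<inter> U k) (\<beta> j k)}"

definition C2_int :: "nat set \<Rightarrow> (nat \<Rightarrow> 'a::topological_space set) \<Rightarrow> 'a int_cochain2 set" where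
  "C2_int J U = {e. \<forall>j\<in>J. \<forall>k\<in>J. \<forall>l\<in>J. locally_constant_on (U j \<inter> U k \<inter> U l) (e j k l)}"

definition Z2_twisted :: "nat set \<Rightarrow> (nat \<Rightarrow> 'a::topological_space set) \<Rightarrow> 'a sign_cochain \<Rightarrow> 'a int_cochain2 set" where
  "Z2_twisted J U \<omega> = {e \<in> C2_int J U. \<forall>j\<in>J. \<forall>k\<in>J. \<forall>l\<in>J. \<forall>m\<in>J.
      \<forall>b\<in>U j \<inter> U k \<inter> U l \<inter> U m. twisted_cobd2 \<omega> e j k l m b = 0}"

definition cohomologous :: "nat set \<Rightarrow> (nat \<Rightarrow> 'a::topological_space set) \<Rightarrow> 'a sign_cochain
    \<Rightarrow> ('a int_cochain2 \<times> 'a int_cochain2) set" where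
  "cohomologous J U \<omega> = {(e, e'). e \<in> Z2_twisted J U \<omega> \<and> e' \<in> Z2_twisted J U \<omega> \<and>
     (\<exists>\<beta>\<in>C1_int J U. \<forall>j\<in>J. \<forall>k\<in>J. \<forall>l\<in>J. \<forall>b\<in>U j \<inter> U k \<inter> U l.
        e' j k l b - e j k l b = twisted_cobd1 \<omega> \<beta> j k l b)}"

definition H2_twisted :: "nat set \<Rightarrow> (nat \<Rightarrow> 'a::topological_space set) \<Rightarrow> 'a sign_cochain \<Rightarrow> 'a int_cochain2 set set" where
  "H2_twisted J U \<omega> = Z2_twisted J U \<omega> // cohomologous J U \<omega>"

definition H2_class :: "nat set \<Rightarrow> (nat \<Rightarrow> 'a::topological_space set) \<Rightarrow> 'a sign_cochain
    \<Rightarrow> 'a int_cochain2 \<Rightarrow> 'a int_cochain2 set" where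
  "H2_class J U \<omega> e = cohomologous J U \<omega> `` {e}"

text \<open>The coproduct of the groups \<open>H\<^sup>2(U; \<int>\<^sub>\<omega>)\<close> over the classes \<open>[\<omega>]\<close>: pairs of a cocycle \<open>\<omega>\<close> and a
  class in \<open>H\<^sup>2(U; \<int>\<^sub>\<omega>)\<close>, where isomorphic local systems are identified.  The index \<open>[\<omega>]\<close> of the summand
  containing an element \<open>x\<close> is \<open>fst ` x\<close>.\<close>

definition twisted_pairs :: "nat set \<Rightarrow> (nat \<Rightarrow> 'a::topological_space set)
    \<Rightarrow> ('a sign_cochain \<times> 'a int_cochain2 set) set" where
  "twisted_pairs J U = Sigma (Z1_sign J U) (H2_twisted J U)"

definition twisted_iso_rel :: "nat set \<Rightarrow> (nat \<Rightarrow> 'a::topological_space set)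
    \<Rightarrow> (('a sign_cochain \<times> 'a int_cochain2 set) \<times> ('a sign_cochain \<times> 'a int_cochain2 set)) set" where
  "twisted_iso_rel J U = {((\<omega>, c), (\<omega>', c')).
     (\<omega>, c) \<in> twisted_pairs J U \<and> (\<omega>', c') \<in> twisted_pairs J U \<and>
     (\<exists>\<phi> e. sign_gauge J U \<phi> \<omega> \<omega>' \<and> e \<in> Z2_twisted J U \<omega> \<and> c = H2_class J U \<omega> e \<and>
        c' = H2_class J U \<omega>' (\<lambda>j k l b. \<phi> j b * e j k l b))}"

definition twisted_coproduct :: "nat set \<Rightarrow> (nat \<Rightarrow> 'a::topological_space set)
    \<Rightarrow> ('a sign_cochain \<times> 'a int_cochain2 set) set set" where
  "twisted_coproduct J U = twisted_pairs J U // twisted_iso_rel J U"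

definition coproduct_elem :: "nat set \<Rightarrow> (nat \<Rightarrow> 'a::topological_space set)
    \<Rightarrow> 'a sign_cochain \<Rightarrow> 'a int_cochain2 set \<Rightarrow> ('a sign_cochain \<times> 'a int_cochain2 set) set" where
  "coproduct_elem J U \<omega> c = twisted_iso_rel J U `` {(\<omega>, c)}"

section \<open>The characteristic classes\<close>

text \<open>For an orthogonal matrix the determinant is \<open>\<plusminus>1\<close>, so the floor only changes the type.\<close>

definition det_cochain :: "'a O2_cochain \<Rightarrow> 'a sign_cochain" where
  "det_cochain \<Omega> j k b = \<lfloor>det (\<Omega> j k b)\<rfloor>"

definition refl_mat :: "real \<Rightarrow> mat2" where
  "refl_mat s = vector [vector [1, 0], vector [0, s]]"

definition abs_cochain :: "'a O2_cochain \<Rightarrow> 'a O2_cochain" where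
  "abs_cochain \<Omega> j k b = \<Omega> j k b ** refl_mat (det (\<Omega> j k b))"

definition rot :: "real \<Rightarrow> mat2" where
  "rot \<theta> = vector [vector [cos (2 * pi * \<theta>), - sin (2 * pi * \<theta>)],
                     vector [sin (2 * pi * \<theta>), cos (2 * pi * \<theta>)]]"

definition is_lift :: "nat set \<Rightarrow> (nat \<Rightarrow> 'a::topological_space set) \<Rightarrow> 'a O2_cochain
    \<Rightarrow> (nat \<Rightarrow> nat \<Rightarrow> 'a \<Rightarrow> real) \<Rightarrow> bool" where
  "is_lift J U \<Lambda> \<Theta> \<longleftrightarrow> (\<forall>j\<in>J. \<forall>k\<in>J. continuous_on (U j \<inter> U k) (\<Theta> j k) \<and>
                           (\<forall>b\<in>U j \<inter> U k. rot (\<Theta> j k b) = \<Lambda> j k b))"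

text \<open>\<open>is_Delta J U \<omega> \<Lambda> c\<close>: some choice of lifts of \<open>\<Lambda>\<close> yields the class \<open>c\<close>.  The
  description \<open>Delta\<close> is meaningful only where such a \<open>c\<close> exists and is independent of the lifts,
  which has to be established separately; likewise for \<open>is_euler_class\<close> and \<open>euler_class\<close>.\<close>

definition is_Delta :: "nat set \<Rightarrow> (nat \<Rightarrow> 'a::topological_space set) \<Rightarrow> 'a sign_cochain \<Rightarrow> 'a O2_cochain
    \<Rightarrow> 'a int_cochain2 set \<Rightarrow> bool" where
  "is_Delta J U \<omega> \<Lambda> c \<longleftrightarrow> (\<exists>\<Theta>. is_lift J U \<Lambda> \<Theta> \<and>
     c = H2_class J U \<omega> (\<lambda>j k l b. round (twisted_cobd1 \<omega> \<Theta> j k l b)))"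

definition Delta :: "nat set \<Rightarrow> (nat \<Rightarrow> 'a::topological_space set) \<Rightarrow> 'a sign_cochain \<Rightarrow> 'a O2_cochain
    \<Rightarrow> 'a int_cochain2 set" where
  "Delta J U \<omega> \<Lambda> = (THE c. is_Delta J U \<omega> \<Lambda> c)"

definition SW1 :: "nat set \<Rightarrow> (nat \<Rightarrow> 'a::topological_space set) \<Rightarrow> 'a O2_cochain \<Rightarrow> 'a sign_cochain set" where
  "SW1 J U \<Omega> = H1_sign_class J U (det_cochain \<Omega>)"

definition is_euler_class :: "nat set \<Rightarrow> (nat \<Rightarrow> 'a::topological_space set) \<Rightarrow> 'a O2_cochain
    \<Rightarrow> 'a int_cochain2 set \<Rightarrow> bool" where
  "is_euler_class J U \<Omega> c \<longleftrightarrow> (\<exists>\<Theta> e. is_lift J U (abs_cochain \<Omega>) \<Theta> \<and>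
     (\<forall>j\<in>J. \<forall>k\<in>J. \<forall>l\<in>J. \<forall>b\<in>U j \<inter> U k \<inter> U l.
        real_of_int (e j k l b) = twisted_cobd1 (det_cochain \<Omega>) \<Theta> j k l b) \<and>
     c = H2_class J U (det_cochain \<Omega>) e)"

definition euler_class :: "nat set \<Rightarrow> (nat \<Rightarrow> 'a::topological_space set) \<Rightarrow> 'a O2_cochain \<Rightarrow> 'a int_cochain2 set" where
  "euler_class J U \<Omega> = (THE c. is_euler_class J U \<Omega> c)"

section \<open>The projection onto exact cocycles\<close>

definition partition_of_unity :: "nat set \<Rightarrow> (nat \<Rightarrow> 'a::topological_space set) \<Rightarrow> (nat \<Rightarrow> 'a \<Rightarrow> real) \<Rightarrow> bool" where
  "partition_of_unity J U \<rho> \<longleftrightarrow>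
     (\<forall>j\<in>J. continuous_on UNIV (\<rho> j) \<and> (\<forall>b. 0 \<le> \<rho> j b) \<and> closure {b. \<rho> j b \<noteq> 0} \<subseteq> U j) \<and>
     (\<forall>b. finite {j\<in>J. \<rho> j b \<noteq> 0} \<and> (\<Sum>j | j \<in> J \<and> \<rho> j b \<noteq> 0. \<rho> j b) = 1)"

text \<open>\<open>\<real>\<^sup>\<infinity>\<close> is the space of finitely supported sequences, grouped into consecutive pairs: a vector is
  a sequence of elements of \<^typ>\<open>real^2\<close>, an \<open>\<infinity>\<times>2\<close> matrix a sequence of \<open>2\<times>2\<close> blocks, and an
  \<open>\<infinity>\<times>\<infinity>\<close> matrix a double sequence of \<open>2\<times>2\<close> blocks.\<close>

type_synonym rinf = "nat \<Rightarrow> real^2"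

type_synonym rinf2 = "nat \<Rightarrow> mat2"

type_synonym rinfinf = "nat \<Rightarrow> nat \<Rightarrow> mat2"

definition fin_supp :: "(nat \<Rightarrow> 'b::zero) \<Rightarrow> bool" where
  "fin_supp v \<longleftrightarrow> finite {i. v i \<noteq> 0}"

definition inf_inner :: "rinf \<Rightarrow> rinf \<Rightarrow> real" where
  "inf_inner v w = Sum_any (\<lambda>i. v i \<bullet> w i)"

definition inf_mult_vec :: "rinfinf \<Rightarrow> rinf \<Rightarrow> rinf" where
  "inf_mult_vec M v i = Sum_any (\<lambda>k. M i k *v v k)"

definition inf_mult :: "rinfinf \<Rightarrow> rinf2 \<Rightarrow> rinf2" where
  "inf_mult M A i = Sum_any (\<lambda>k. M i k ** A k)"

definition transpose_mult :: "rinf2 \<Rightarrow> rinf2 \<Rightarrow> mat2" where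
  "transpose_mult A B = Sum_any (\<lambda>i. transpose (A i) ** B i)"

definition V2 :: "rinf2 set" where
  "V2 = {A. fin_supp A \<and> transpose_mult A A = mat 1}"

definition sym_part :: "rinfinf \<Rightarrow> rinfinf" where
  "sym_part A i k = (1 / 2) *\<^sub>R (A i k + transpose (A k i))"

definition is_eigenvector :: "rinfinf \<Rightarrow> rinf \<Rightarrow> real \<Rightarrow> bool" where
  "is_eigenvector M v \<mu> \<longleftrightarrow> fin_supp v \<and> v \<noteq> (\<lambda>i. 0) \<and> (\<forall>i. inf_mult_vec M v i = \<mu> *\<^sub>R v i)"

text \<open>The two largest eigenvalues are counted with multiplicity; they determine a plane only if the
  third one is strictly smaller, hence the strict inequality.  \<open>P\<close> is the orthogonal projection onto
  the span of the orthonormal vectors \<open>v\<close> and \<open>w\<close>, i.e. \<open>vv\<^sup>T + ww\<^sup>T\<close>.\<close>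

definition is_top_projection :: "rinfinf \<Rightarrow> rinfinf \<Rightarrow> bool" where
  "is_top_projection A P \<longleftrightarrow> (\<exists>v w \<mu> \<nu>.
     is_eigenvector (sym_part A) v \<mu> \<and> is_eigenvector (sym_part A) w \<nu> \<and>
     inf_inner v v = 1 \<and> inf_inner w w = 1 \<and> inf_inner v w = 0 \<and> \<nu> \<le> \<mu> \<and>
     (\<forall>u \<kappa>. is_eigenvector (sym_part A) u \<kappa> \<and> inf_inner u v = 0 \<and> inf_inner u w = 0 \<longrightarrow> \<kappa> < \<nu>) \<and>
     P = (\<lambda>i k. \<chi> s t. v i $ s * v k $ t + w i $ s * w k $ t))"

definition top_projection :: "rinfinf \<Rightarrow> rinfinf" where
  "top_projection A = (THE P. is_top_projection A P)"

definition polar_factor :: "rinf2 \<Rightarrow> rinf2" where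
  "polar_factor A = (THE V. V \<in> V2 \<and>
     (\<exists>H :: mat2. transpose H = H \<and> (\<forall>x. 0 \<le> x \<bullet> (H *v x)) \<and> (\<forall>i. A i = V i ** H)))"

definition Psi :: "nat set \<Rightarrow> (nat \<Rightarrow> 'a \<Rightarrow> real) \<Rightarrow> 'a O2_cochain \<Rightarrow> nat \<Rightarrow> 'a \<Rightarrow> rinf2" where
  "Psi J \<rho> \<Omega> j b i = (if i \<in> J \<and> \<rho> i b \<noteq> 0 then sqrt (\<rho> i b) *\<^sub>R \<Omega> i j b else 0)"

definition cl_map :: "nat set \<Rightarrow> (nat \<Rightarrow> 'a \<Rightarrow> real) \<Rightarrow> 'a O2_cochain \<Rightarrow> 'a \<Rightarrow> rinfinf" where
  "cl_map J \<rho> \<Omega> b i k =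
     (\<Sum>j | j \<in> J \<and> \<rho> j b \<noteq> 0. \<rho> j b *\<^sub>R (Psi J \<rho> \<Omega> j b i ** transpose (Psi J \<rho> \<Omega> j b k)))"

definition f_map :: "nat set \<Rightarrow> (nat \<Rightarrow> 'a \<Rightarrow> real) \<Rightarrow> 'a O2_cochain \<Rightarrow> 'a \<Rightarrow> rinfinf" where
  "f_map J \<rho> \<Omega> b = top_projection (cl_map J \<rho> \<Omega> b)"

definition Psi_tilde :: "nat set \<Rightarrow> (nat \<Rightarrow> 'a \<Rightarrow> real) \<Rightarrow> 'a O2_cochain \<Rightarrow> nat \<Rightarrow> 'a \<Rightarrow> rinf2" where
  "Psi_tilde J \<rho> \<Omega> j b = polar_factor (inf_mult (f_map J \<rho> \<Omega> b) (Psi J \<rho> \<Omega> j b))"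

definition Pi_Z :: "nat set \<Rightarrow> (nat \<Rightarrow> 'a \<Rightarrow> real) \<Rightarrow> 'a O2_cochain \<Rightarrow> 'a O2_cochain" where
  "Pi_Z J \<rho> \<Omega> j k b = transpose_mult (Psi_tilde J \<rho> \<Omega> j b) (Psi_tilde J \<rho> \<Omega> k b)"

end

(*
  An O(2)-valued map is a rotation times a reflection r(s), and r(s) rot(t) = rot(s t) r(s).
  Two elements of O(2) with different determinants are at distance 2, and two with the same
  determinant and angles t, t' (in turns) at distance 2 sqrt 2 |sin(pi (t - t'))|.  A defect below
  1 therefore makes the determinants an exact cocycle and keeps the twisted coboundary of the
  angles within 1/8 of the integers, so that its rounding is a cocycle.  Moving the cochain by less
  than 1 moves the angles, suitably lifted, by less than 1/8 and the coboundary by less than 3/8,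
  which does not change the rounding up to coboundaries.

  Hence the last part only needs that Pi_Z moves the cochain by less than 1.  At a point, the planes
  spanned by the frames Psi_j are pairwise within epsilon, so the quadratic form of their average is
  at least 1 - epsilon^2 on each of them and at most epsilon^2 on the orthogonal complement of each.
  This gap of the spectrum makes the top eigenplane unique, continuous in the point, and nearly
  equal to each of the planes; the polar factors of the projected frames are then close to Psi_j.
*)
theory Submission
  imports Defs "HOL-Complex_Analysis.Winding_Numbers"
begin

section \<open>Rotations and reflections of the plane\<close>

text \<open>The numbers fit exactly: a coboundary strictly within 1/8 of the integers that moves by
  at most 3/8 stays strictly within 1/2 of the same integers, so for suitable lifts the rounded
  cochains are equal and not just cohomologous. Gauge transformations are covered by the same
  estimate: a suitable lift of the transformed cochain has as coboundary the old one times a sign,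
  with error zero. The obstacle in the last part is continuity. An orthonormal basis of the top
  eigenplane is chosen separately at each point, so neither the basis nor the frames expressed in it
  need be continuous. The 2x2 Gram matrices \<open>G j k\<close> of the projected frames depend on
  the plane alone, and \<open>Pi_Z\<close> at \<open>j\<close>, \<open>k\<close> equals
  \<open>psqrt_inv (G j j) ** G j k ** psqrt_inv (G k k)\<close>. Continuity of the Gram matrices
  follows from a perturbation bound for the eigenplane, and that of \<open>psqrt_inv\<close> from a
  closed formula for the square root of a 2x2 matrix.\<close>

lemma mat2_eq_iff:
  fixes A B :: mat2
  shows "A = B \<longleftrightarrow> A$1$1 = B$1$1 \<and> A$1$2 = B$1$2 \<and> A$2$1 = B$2$1 \<and> A$2$2 = B$2$2"
  unfolding vec_eq_iff[of A B] vec_eq_iff[of "A $ _"] forall_2 by simp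

lemma mat2_mult_nth:
  fixes A B :: mat2
  shows "(A ** B) $ i $ j = A$i$1 * B$1$j + A$i$2 * B$2$j"
  by (simp add: matrix_matrix_mult_def sum_2)

lemma mat2_vec_nth:
  fixes A :: mat2
  shows "(A *v x) $ i = A$i$1 * x$1 + A$i$2 * x$2"
  by (simp add: matrix_vector_mult_def sum_2)

lemma power2_norm_vec2:
  fixes x :: "real^2"
  shows "(norm x)\<^sup>2 = (x$1)\<^sup>2 + (x$2)\<^sup>2"
  by (simp add: norm_vec_def L2_set_def sum_2)

lemma power2_norm_mat2:
  fixes A :: mat2
  shows "(norm A)\<^sup>2 = (A$1$1)\<^sup>2 + (A$1$2)\<^sup>2 + (A$2$1)\<^sup>2 + (A$2$2)\<^sup>2"
  by (simp add: norm_vec_def L2_set_def sum_2)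

lemma rot_nth [simp]:
  "rot t $ 1 $ 1 = cos (2 * pi * t)" "rot t $ 1 $ 2 = - sin (2 * pi * t)"
  "rot t $ 2 $ 1 = sin (2 * pi * t)" "rot t $ 2 $ 2 = cos (2 * pi * t)"
  by (simp_all add: rot_def)

lemma refl_mat_nth [simp]:
  "refl_mat s $ 1 $ 1 = 1" "refl_mat s $ 1 $ 2 = 0" "refl_mat s $ 2 $ 1 = 0" "refl_mat s $ 2 $ 2 = s"
  by (simp_all add: refl_mat_def)

lemma mat_1_nth2 [simp]:
  "(mat 1 :: mat2) $ 1 $ 1 = 1" "(mat 1 :: mat2) $ 1 $ 2 = 0"
  "(mat 1 :: mat2) $ 2 $ 1 = 0" "(mat 1 :: mat2) $ 2 $ 2 = 1"
  by (simp_all add: mat_def)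

lemma rot_add: "rot a ** rot b = rot (a + b)"
  by (simp add: mat2_eq_iff mat2_mult_nth cos_add sin_add algebra_simps)

lemma refl_mat_mult: "refl_mat s ** refl_mat t = refl_mat (s * t)"
  by (simp add: mat2_eq_iff mat2_mult_nth)

lemma refl_mat_1: "refl_mat 1 = mat 1"
  by (simp add: mat2_eq_iff)

lemma refl_mat_rot:
  assumes "s \<in> {1, -1}"
  shows "refl_mat s ** rot t = rot (s * t) ** refl_mat s"
  using assms by (auto simp: mat2_eq_iff mat2_mult_nth)

lemma det_refl_mat: "det (refl_mat s) = s"
  by (simp add: det_2)

lemma det_rot_refl: "det (rot t ** refl_mat s) = s"
proof -
  have "x * (x * s) + y * (y * s) = s" if "x\<^sup>2 + y\<^sup>2 = 1" for x y :: real
    using that by (metis (no_types, opaque_lifting) distrib_right mult.assoc mult_1 power2_eq_square)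
  from this[OF sin_cos_squared_add2, of "2 * pi * t"] show ?thesis by (simp add: det_2 mat2_mult_nth mult_ac)
qed

lemma orthogonal_matrix_det:
  fixes A :: mat2
  assumes "orthogonal_matrix A"
  shows "det A \<in> {1, -1}"
  using det_orthogonal_matrix[OF assms] by auto

lemma orthogonal_refl_mat: "s \<in> {1, -1} \<Longrightarrow> orthogonal_matrix (refl_mat s)"
  by (auto simp: orthogonal_matrix mat2_eq_iff mat2_mult_nth transpose_def)

lemma abs_refl_mat:
  fixes A :: mat2
  assumes "orthogonal_matrix A"
  shows "A ** refl_mat (det A) ** refl_mat (det A) = A"
proof -
  have "det A * det A = 1" using orthogonal_matrix_det[OF assms] by auto
  then show ?thesis by (simp add: refl_mat_mult refl_mat_1 flip: matrix_mul_assoc)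
qed

lemma orthogonal_det_1_iff_rot:
  fixes A :: mat2
  assumes "orthogonal_matrix A" "det A = 1"
  shows "A$2$2 = A$1$1" "A$1$2 = - A$2$1" "(A$1$1)\<^sup>2 + (A$2$1)\<^sup>2 = 1"
proof -
  from assms have *: "A$1$1 * A$1$1 + A$2$1 * A$2$1 = 1" "A$1$1 * A$1$2 + A$2$1 * A$2$2 = 0"
    "A$1$2 * A$1$2 + A$2$2 * A$2$2 = 1" "A$1$1 * A$2$2 - A$1$2 * A$2$1 = 1"
    by (simp_all add: orthogonal_matrix mat2_eq_iff mat2_mult_nth transpose_def det_2)
  from *(1) show "(A$1$1)\<^sup>2 + (A$2$1)\<^sup>2 = 1" by (simp add: power2_eq_square)
  \<comment> \<open>The left side is the sum of the squared column norms minus twice the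
    determinant, that is 1 + 1 - 2.\<close>
  have "(A$2$2 - A$1$1)\<^sup>2 + (A$1$2 + A$2$1)\<^sup>2 = 0" using * by (simp add: power2_eq_square algebra_simps)
  then show "A$2$2 = A$1$1" "A$1$2 = - A$2$1" unfolding sum_power2_eq_zero_iff by simp_all
qed

lemma abs_orthogonal:
  fixes A :: mat2
  assumes "orthogonal_matrix A"
  shows "orthogonal_matrix (A ** refl_mat (det A))" "det (A ** refl_mat (det A)) = 1"
  using orthogonal_matrix_det[OF assms] assms
  by (auto intro!: orthogonal_matrix_mul orthogonal_refl_mat simp: det_mul det_refl_mat)

lemma orthogonal_obtain_rot:
  fixes A :: mat2
  assumes "orthogonal_matrix A"
  obtains t where "A = rot t ** refl_mat (det A)"
proof -
  define B where "B = A ** refl_mat (det A)"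
  note B = orthogonal_det_1_iff_rot[OF abs_orthogonal[OF assms], folded B_def]
  obtain u where "B$1$1 = cos u" "B$2$1 = sin u"
    using sincos_total_2pi_le[OF B(3)] by metis
  then have "B = rot (u / (2 * pi))" using B by (simp add: mat2_eq_iff)
  with abs_refl_mat[OF assms] show thesis by (intro that[of "u / (2 * pi)"]) (simp add: B_def)
qed

lemma norm_rot_refl_diff:
  assumes "s \<in> {1, -1}"
  shows "(norm (rot a ** refl_mat s - rot b ** refl_mat s))\<^sup>2 = 4 - 4 * cos (2 * pi * (a - b))"
proof -
  have "2 * pi * (a - b) = 2 * pi * a - 2 * pi * b" by (simp add: algebra_simps)
  moreover have "(x - x')\<^sup>2 + (y - y')\<^sup>2 + (y - y')\<^sup>2 + (x - x')\<^sup>2 = 4 - 4 * (x * x' + y * y')"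
    if "x\<^sup>2 + y\<^sup>2 = 1" "x'\<^sup>2 + y'\<^sup>2 = 1" for x y x' y' :: real
    using that by (simp add: power2_diff)
  from this[OF sin_cos_squared_add2 sin_cos_squared_add2, of "2 * pi * a" "2 * pi * b"]
  have "(norm (rot a ** refl_mat s - rot b ** refl_mat s))\<^sup>2 = 4 - 4 * cos (2 * pi * a - 2 * pi * b)"
    using assms by (auto simp: power2_norm_mat2 mat2_mult_nth cos_diff power2_commute)
  ultimately show ?thesis by simp
qed

text \<open>Both matrices have squared norm 2, and a rotation is orthogonal to a reflection in the
  entrywise inner product, so the squared distance is 2 + 2.\<close>

lemma norm_diff_det_ne:
  fixes A B :: mat2
  assumes "orthogonal_matrix A" "orthogonal_matrix B" "det A \<noteq> det B"
  shows "norm (A - B) = 2"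
proof -
  obtain a where a: "A = rot a ** refl_mat (det A)" by (rule orthogonal_obtain_rot[OF assms(1)])
  obtain b where b: "B = rot b ** refl_mat (det B)" by (rule orthogonal_obtain_rot[OF assms(2)])
  have dA: "det A \<in> {1, -1}" and dB: "det B = - det A"
    using assms orthogonal_matrix_det[of A] orthogonal_matrix_det[of B] by auto
  have "(x - x')\<^sup>2 + (y + y')\<^sup>2 + (y - y')\<^sup>2 + (x + x')\<^sup>2 = 4"
    if "x\<^sup>2 + y\<^sup>2 = 1" "x'\<^sup>2 + y'\<^sup>2 = 1" for x y x' y' :: real
    using that by (simp add: power2_diff power2_sum)
  from this[OF sin_cos_squared_add2 sin_cos_squared_add2, of "2 * pi * a" "2 * pi * b"]
  have "(norm (rot a ** refl_mat (det A) - rot b ** refl_mat (- det A)))\<^sup>2 = 4"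
    using dA by (auto simp: power2_norm_mat2 mat2_mult_nth power2_commute add.commute)
  with a b dB have "(norm (A - B))\<^sup>2 = 2\<^sup>2" by simp
  then show ?thesis by (subst (asm) power2_eq_iff_nonneg) auto
qed

text \<open>A distance below 1 between matrices of equal determinant means
  \<open>4 - 4 * cos < 1\<close>, hence the hypothesis 3/4. An eighth of a turn has cosine
  \<open>sqrt 2 / 2\<close>, slightly below 3/4; it is the convenient bound because 1/8 + 3 * 1/8 =
  1/2.\<close>

lemma near_int_of_cos:
  assumes "cos (2 * pi * s) > 3 / 4"
  shows "\<bar>s - of_int (round s)\<bar> < 1 / 8"
proof (rule ccontr)
  assume "\<not> ?thesis"
  then have t: "1/8 \<le> \<bar>s - of_int (round s)\<bar>" by simp
  define t where "t = \<bar>s - of_int (round s)\<bar>"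
  \<comment> \<open>The distance to the nearest integer is at most 1/2, so \<open>2 * pi * t\<close>
    stays between 0 and \<open>pi\<close>, where the cosine decreases.\<close>
  have t2: "t \<le> 1/2" using of_int_round_abs_le[of s] by (simp add: t_def abs_minus_commute)
  have "cos (2 * pi * s) = cos (2 * pi * (s - of_int (round s)) + 2 * pi * of_int (round s))"
    by (simp add: algebra_simps)
  also have "\<dots> = cos (2 * pi * (s - of_int (round s)))"
    by (simp only: cos_add sin_int_2pin cos_int_2pin mult_1_right mult_zero_right diff_zero)
  also have "\<dots> = cos \<bar>2 * pi * (s - of_int (round s))\<bar>" by (simp only: cos_abs_real)
  also have "\<dots> = cos (2 * pi * t)" by (simp add: t_def abs_mult)
  also have "\<dots> \<le> cos (pi / 4)"
    using t t2 by (intro cos_monotone_0_pi_le) (auto simp: t_def[symmetric] field_simps)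
  also have "\<dots> = sqrt 2 / 2" by (simp add: cos_45)
  also have "\<dots> < 3/4"
    using real_less_lsqrt[of "3/2" 2] by (simp add: power2_eq_square)
  finally show False using assms by simp
qed

lemma near_int_of_norm_rot:
  assumes "s \<in> {1, -1}" "norm (rot a ** refl_mat s - rot b ** refl_mat s) < 1"
  shows "\<bar>(a - b) - of_int (round (a - b))\<bar> < 1 / 8"
proof (rule near_int_of_cos)
  have "(norm (rot a ** refl_mat s - rot b ** refl_mat s))\<^sup>2 < 1"
    using assms(2) by (simp add: abs_square_less_1)
  then show "cos (2 * pi * (a - b)) > 3 / 4" using norm_rot_refl_diff[OF assms(1), of a b] by simp
qed

lemma rot_eq_iff: "rot a = rot b \<longleftrightarrow> a - b \<in> \<int>"
proof
  assume "rot a = rot b"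
  then have "cos (2 * pi * (a - b)) = 1"
    by (simp add: mat2_eq_iff cos_diff algebra_simps flip: power2_eq_square)
  then obtain n :: int where "2 * pi * (a - b) = of_int n * 2 * pi"
    unfolding cos_one_2pi_int by blast
  then have "a - b = of_int n" by simp
  then show "a - b \<in> \<int>" by simp
next
  assume "a - b \<in> \<int>"
  then obtain n where "a = b + of_int n" by (metis Ints_cases add.commute diff_add_cancel)
  then have "2 * pi * a = 2 * pi * b + 2 * pi * of_int n" by (simp add: algebra_simps)
  then show "rot a = rot b"
    by (simp add: mat2_eq_iff cos_add sin_add sin_int_2pin cos_int_2pin)
qed

section \<open>Continuity of matrix-valued maps\<close>

lemma continuous_on_mat2_iff:
  fixes A :: "'a::topological_space \<Rightarrow> mat2"
  shows "continuous_on S A \<longleftrightarrow> (\<forall>i j. continuous_on S (\<lambda>b. A b $ i $ j))"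
proof
  assume "\<forall>i j. continuous_on S (\<lambda>b. A b $ i $ j)"
  then have "continuous_on S (\<lambda>b. \<chi> i j. A b $ i $ j)"
    by (intro continuous_on_vec_lambda) auto
  then show "continuous_on S A" by simp
qed (auto intro!: continuous_on_component)

lemma continuous_on_mat2_mult [continuous_intros]:
  fixes A B :: "'a::topological_space \<Rightarrow> mat2"
  assumes "continuous_on S A" "continuous_on S B"
  shows "continuous_on S (\<lambda>b. A b ** B b)"
  using assms by (auto simp: continuous_on_mat2_iff mat2_mult_nth intro!: continuous_intros)

lemma continuous_on_det2 [continuous_intros]:
  fixes A :: "'a::topological_space \<Rightarrow> mat2"
  assumes "continuous_on S A"
  shows "continuous_on S (\<lambda>b. det (A b))"
  using assms by (auto simp: continuous_on_mat2_iff det_2 intro!: continuous_intros)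

lemma continuous_on_refl_mat [continuous_intros]:
  assumes "continuous_on S f"
  shows "continuous_on S (\<lambda>b. refl_mat (f b))"
  using assms unfolding continuous_on_mat2_iff forall_2 by (simp add: continuous_intros)

lemma continuous_on_transpose2 [continuous_intros]:
  fixes A :: "'a::topological_space \<Rightarrow> mat2"
  assumes "continuous_on S A"
  shows "continuous_on S (\<lambda>b. transpose (A b))"
  using assms by (auto simp: continuous_on_mat2_iff transpose_def)

section \<open>Lifting circle-valued maps\<close>

text \<open>The library's lifting theorems for covering spaces ask for a normed domain; here the lift is
  obtained from the winding numbers of the images of paths.\<close>

lemma simply_connected_obtain_path:
  fixes S :: "'a::topological_space set"
  assumes "simply_connected S" "a \<in> S" "b \<in> S"
  obtains p where "path p" "path_image p \<subseteq> S" "pathstart p = a" "pathfinish p = b"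
proof -
  have "homotopic_loops S (\<lambda>_. a) (\<lambda>_. b)"
    using assms(2,3)
    by (intro assms(1)[unfolded simply_connected_def, rule_format])
      (auto simp: path_def path_image_def pathstart_def pathfinish_def)
  from homotopic_loops_imp_path_component_value[OF this, of 0]
  have "path_component S a b" by simp
  then show thesis using that by (auto simp: path_component_def)
qed

lemma winding_number_simply_connected_loop:
  fixes S :: "'a::topological_space set" and f :: "'a \<Rightarrow> complex"
  assumes S: "simply_connected S" and f: "continuous_on S f" "\<And>x. x \<in> S \<Longrightarrow> f x \<noteq> 0"
    and p: "path p" "path_image p \<subseteq> S" "pathfinish p = pathstart p"
  shows "winding_number (f \<circ> p) 0 = 0"
proof -
  define a where "a = pathstart p"
  have a: "a \<in> S" using p by (auto simp: a_def pathstart_in_path_image subset_iff)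
  have "homotopic_loops S p (\<lambda>_. a)"
    using p a by (intro S[unfolded simply_connected_def, rule_format])
      (auto simp: path_def path_image_def pathstart_def pathfinish_def)
  then have "homotopic_loops (- {0}) (f \<circ> p) (f \<circ> (\<lambda>_. a))"
    by (rule homotopic_loops_continuous_image) (use f in auto)
  then have "winding_number (f \<circ> p) 0 = winding_number (f \<circ> (\<lambda>_. a)) 0"
    by (rule winding_number_homotopic_loops)
  also have "f \<circ> (\<lambda>_. a) = linepath (f a) (f a)" by (auto simp: linepath_def algebra_simps)
  also have "winding_number (linepath (f a) (f a)) 0 = 0"
    using f(2)[OF a] by (intro winding_number_trivial) auto
  finally show ?thesis .
qed

text \<open>Running along \<open>p\<close> and back along \<open>q\<close> is a loop. The winding
  number thus depends on the end points only, which makes the lift well defined.\<close>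

lemma winding_number_paths_eq:
  fixes S :: "'a::topological_space set" and f :: "'a \<Rightarrow> complex"
  assumes S: "simply_connected S" and f: "continuous_on S f" "\<And>x. x \<in> S \<Longrightarrow> f x \<noteq> 0"
    and p: "path p" "path_image p \<subseteq> S" and q: "path q" "path_image q \<subseteq> S"
    and pq: "pathstart p = pathstart q" "pathfinish p = pathfinish q"
  shows "winding_number (f \<circ> p) 0 = winding_number (f \<circ> q) 0"
proof -
  have f0: "path (f \<circ> r)" "0 \<notin> path_image (f \<circ> r)" if "path r" "path_image r \<subseteq> S" for r
    using that f by (auto intro!: path_continuous_image intro: continuous_on_subset simp: path_image_compose)
  have "0 = winding_number (f \<circ> (p +++ reversepath q)) 0"
    using p q pq
    by (intro winding_number_simply_connected_loop[OF S f, symmetric]) (auto simp: path_image_join)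
  also have "\<dots> = winding_number (f \<circ> p) 0 + winding_number (reversepath (f \<circ> q)) 0"
    unfolding path_compose_join path_compose_reversepath
    using f0[OF p] f0[OF q] pq by (intro winding_number_join) (auto simp: pathstart_compose pathfinish_compose)
  also have "winding_number (reversepath (f \<circ> q)) 0 = - winding_number (f \<circ> q) 0"
    using f0[OF q] by (rule winding_number_reversepath)
  finally show ?thesis by (simp add: comp_def)
qed

lemma simply_connected_circle_lift:
  fixes S :: "'a::topological_space set" and f :: "'a \<Rightarrow> complex"
  assumes S: "simply_connected S" "locally path_connected S"
    and f: "continuous_on S f" "\<And>x. x \<in> S \<Longrightarrow> norm (f x) = 1"
  obtains \<theta> :: "'a \<Rightarrow> real" where "continuous_on S \<theta>" "\<And>x. x \<in> S \<Longrightarrow> f x = cis (2 * pi * \<theta> x)"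
proof (cases "S = {}")
  case True
  then show thesis using that[of "\<lambda>_. 0"] by simp
next
  case False
  then obtain a where a: "a \<in> S" by auto
  have f_nz: "f x \<noteq> 0" if "x \<in> S" for x using f(2)[OF that] by auto
  have "\<exists>p. path p \<and> path_image p \<subseteq> S \<and> pathstart p = a \<and> pathfinish p = x" if "x \<in> S" for x
    using simply_connected_obtain_path[OF S(1) a that] by metis
  then obtain P where P: "path (P x)" "path_image (P x) \<subseteq> S" "pathstart (P x) = a" "pathfinish (P x) = x"
    if "x \<in> S" for x by metis
  have f0: "path (f \<circ> r)" "0 \<notin> path_image (f \<circ> r)" if "path r" "path_image r \<subseteq> S" for r
    using that f f_nz by (auto intro!: path_continuous_image intro: continuous_on_subset simp: path_image_compose)
  define w where "w x = winding_number (f \<circ> P x) 0" for x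
  have w: "f x = exp (2 * pi * \<i> * w x) * f a" if "x \<in> S" for x
    using winding_number_exp_2pi[OF f0[OF P(1,2)[OF that]]] P[OF that]
    by (simp add: w_def pathstart_compose pathfinish_compose)
  \<comment> \<open>Extending the path from \<open>a\<close> to \<open>x\<close> by \<open>q\<close>
    changes the winding number additively; this reduces continuity at \<open>x\<close> to paths near
    \<open>x\<close>.\<close>
  have w_diff: "w y = w x + winding_number (f \<circ> q) 0"
    if x: "x \<in> S" and q: "path q" "path_image q \<subseteq> S" "pathstart q = x" "pathfinish q = y" for x y q
  proof -
    have y: "y \<in> S" using q by auto
    have "w y = winding_number (f \<circ> (P x +++ q)) 0"
      unfolding w_def using P[OF x] P[OF y] q
      by (intro winding_number_paths_eq[OF S(1) f(1) f_nz]) (auto simp: path_image_join)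
    also have "\<dots> = w x + winding_number (f \<circ> q) 0"
      unfolding w_def path_compose_join using P[OF x] q f0
      by (intro winding_number_join) (auto simp: pathstart_compose pathfinish_compose)
    finally show ?thesis .
  qed
  have "continuous_on S w"
    unfolding continuous_on_def
  proof
    fix x assume x: "x \<in> S"
    \<comment> \<open>Near \<open>x\<close> the winding number is given by the principal logarithm
      of \<open>f y / f x\<close>, which is continuous while the quotient stays in the unit disc
      around 1 and so off the branch cut.\<close>
    define g where "g y = w x + Ln (f y / f x) / (2 * of_real pi * \<i>)" for y
    have "openin (top_of_set S) (S \<inter> (\<lambda>y. f y / f x) -` ball 1 1)"
      using f f_nz[OF x] by (intro continuous_openin_preimage_gen continuous_intros) auto
    moreover have "x \<in> S \<inter> (\<lambda>y. f y / f x) -` ball 1 1" using x f_nz[OF x] by simp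
    ultimately obtain T V where T: "openin (top_of_set S) T" "path_connected V" "x \<in> T" "T \<subseteq> V"
      "V \<subseteq> S \<inter> (\<lambda>y. f y / f x) -` ball 1 1"
      using locallyE[OF S(2)] by metis
    have nonpos: "f y / f x \<notin> \<real>\<^sub>\<le>\<^sub>0" if "y \<in> V" for y
    proof -
      have "norm (1 - f y / f x) < 1" using that T(5) by (auto simp: dist_norm)
      then have "\<bar>Re (1 - f y / f x)\<bar> < 1" using abs_Re_le_cmod order_le_less_trans by blast
      then show ?thesis by (auto simp: complex_nonpos_Reals_iff)
    qed
    have wg: "w y = g y" if y: "y \<in> V" for y
    proof -
      have "x \<in> V" using T by auto
      then obtain q where q: "path q" "path_image q \<subseteq> V" "pathstart q = x" "pathfinish q = y"
        using T(2) y unfolding path_connected_def by metis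
      then have qS: "path_image q \<subseteq> S" using T by auto
      \<comment> \<open>An explicit logarithm of \<open>f\<close> along \<open>q\<close>; the
        winding number is the difference of its end values divided by
        \<open>2 * pi * \<i>\<close>.\<close>
      define L where "L t = Ln (f (q t) / f x) + Ln (f x)" for t
      have "f (q t) / f x \<notin> \<real>\<^sub>\<le>\<^sub>0" if "t \<in> {0..1}" for t
        using q(2) that by (intro nonpos) (auto simp: path_image_def)
      then have "path L"
        unfolding path_def L_def using f0(1)[OF q(1) qS] f_nz[OF x]
        by (intro continuous_intros) (auto simp: path_def o_def)
      have "f (q t) = exp (L t)" if "t \<in> {0..1}" for t
      proof -
        have "q t \<in> S" using that qS by (auto simp: path_image_def)
        then show ?thesis using f_nz x by (simp add: L_def exp_add)
      qed
      then have "winding_number (f \<circ> q) 0 = winding_number (exp \<circ> L) 0"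
        by (intro winding_number_cong) auto
      also have "\<dots> = (pathfinish L - pathstart L) / (2 * of_real pi * \<i>)"
        using \<open>path L\<close> by (rule winding_number_compose_exp)
      also have "\<dots> = Ln (f y / f x) / (2 * of_real pi * \<i>)"
        using q f_nz[OF x] by (simp add: L_def pathfinish_def pathstart_def)
      finally show ?thesis using w_diff[OF x q(1) qS q(3,4)] by (simp add: g_def)
    qed
    have "(f \<longlongrightarrow> f x) (at x within S)" using f(1) x by (auto simp: continuous_on_def)
    then have "(g \<longlongrightarrow> g x) (at x within S)"
      unfolding g_def using nonpos[of x] T(3,4) x f_nz[OF x] by (intro tendsto_intros) auto
    moreover have "g x = w x" using wg T(3,4) by auto
    moreover have "eventually (\<lambda>y. g y = w y) (at x within S)"
    proof -
      obtain O' where O': "open O'" "T = S \<inter> O'" using T(1) by (auto simp: openin_open)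
      then show ?thesis using T wg unfolding eventually_at_topological by (metis IntI subsetD IntE)
    qed
    ultimately show "(w \<longlongrightarrow> w x) (at x within S)" by (metis tendsto_cong)
  qed
  \<comment> \<open>The winding number only measures the change of angle from \<open>a\<close>; the
    angle \<open>c\<close> of \<open>f a\<close> supplies the additive constant.\<close>
  obtain c where c: "f a = cis c" using f(2)[OF a] by (metis complex_norm_eq_1_exp cis_conv_exp)
  define \<theta> where "\<theta> x = Re (w x) + c / (2 * pi)" for x
  show thesis
  proof (rule that)
    show "continuous_on S \<theta>" unfolding \<theta>_def
      using \<open>continuous_on S w\<close> by (intro continuous_intros) auto
    fix x assume x: "x \<in> S"
    \<comment> \<open>The values of \<open>f\<close> have norm 1, so the exponential has norm 1 and
      the winding number is real.\<close>
    have "norm (f x) = exp (- 2 * pi * Im (w x)) * norm (f a)"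
      by (subst w[OF x]) (simp add: norm_mult)
    then have "Im (w x) = 0" using f(2) x a by simp
    then have "w x = of_real (Re (w x))" by (simp add: complex_eq_iff)
    then have "exp (2 * pi * \<i> * w x) = cis (2 * pi * Re (w x))"
      unfolding cis_conv_exp by (metis mult.assoc mult.commute of_real_mult of_real_numeral)
    then show "f x = cis (2 * pi * \<theta> x)"
      using w[OF x] c by (simp add: \<theta>_def cis_mult ring_distribs)
  qed
qed

lemma simply_connected_rot_lift:
  fixes S :: "'a::topological_space set" and A :: "'a \<Rightarrow> mat2"
  assumes S: "simply_connected S" "locally path_connected S"
    and A: "continuous_on S A" "\<And>b. b \<in> S \<Longrightarrow> orthogonal_matrix (A b)"
  obtains \<theta> :: "'a \<Rightarrow> real" where "continuous_on S \<theta>"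
    "\<And>b. b \<in> S \<Longrightarrow> rot (\<theta> b) = A b ** refl_mat (det (A b))"
proof -
  define B where "B b = A b ** refl_mat (det (A b))" for b
  have B: "continuous_on S B" unfolding B_def using A(1) by (intro continuous_intros)
  have B': "B b $ 2 $ 2 = B b $ 1 $ 1" "B b $ 1 $ 2 = - B b $ 2 $ 1" "(B b $ 1 $ 1)\<^sup>2 + (B b $ 2 $ 1)\<^sup>2 = 1"
    if "b \<in> S" for b
    using orthogonal_det_1_iff_rot[OF abs_orthogonal[OF A(2)[OF that]]] unfolding B_def by auto
  \<comment> \<open>A rotation is determined by its first column, read here as a unit complex
    number.\<close>
  define f where "f b = Complex (B b $ 1 $ 1) (B b $ 2 $ 1)" for b
  have "continuous_on S f" unfolding f_def Complex_eq using B
    by (intro continuous_intros) (auto simp: continuous_on_mat2_iff)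
  moreover have "norm (f b) = 1" if "b \<in> S" for b
    using B'(3)[OF that] by (simp add: f_def cmod_def)
  ultimately obtain \<theta> where \<theta>: "continuous_on S \<theta>" "\<And>b. b \<in> S \<Longrightarrow> f b = cis (2 * pi * \<theta> b)"
    using simply_connected_circle_lift[OF S] by metis
  have "rot (\<theta> b) = B b" if "b \<in> S" for b
    using \<theta>(2)[OF that] B'(1,2)[OF that] by (simp add: f_def complex_eq_iff mat2_eq_iff)
  with \<theta>(1) show thesis using that unfolding B_def by blast
qed

section \<open>Locally constant functions\<close>

text \<open>The neighbourhood form of the definition, in which two functions can be combined by
  intersecting neighbourhoods.\<close>

lemma locally_constant_on_iff:
  "locally_constant_on S f \<longleftrightarrow> (\<forall>x\<in>S. \<exists>T. open T \<and> x \<in> T \<and> (\<forall>y\<in>S \<inter> T. f y = f x))"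
proof
  assume L: "locally_constant_on S f"
  show "\<forall>x\<in>S. \<exists>T. open T \<and> x \<in> T \<and> (\<forall>y\<in>S \<inter> T. f y = f x)"
  proof
    fix x assume "x \<in> S"
    obtain A B where AB: "openin (top_of_set S) A" "f constant_on B" "x \<in> A" "A \<subseteq> B" "B \<subseteq> S"
      by (rule locallyE[OF L[unfolded locally_constant_on_def] openin_subtopology_self \<open>x \<in> S\<close>])
    then obtain T where "open T" "A = S \<inter> T" by (auto simp: openin_open)
    moreover from AB(2) obtain c where "\<And>y. y \<in> B \<Longrightarrow> f y = c" unfolding constant_on_def by blast
    then have "f y = f x" if "y \<in> A" for y using that AB(3,4) by (metis subsetD)
    ultimately show "\<exists>T. open T \<and> x \<in> T \<and> (\<forall>y\<in>S \<inter> T. f y = f x)" using AB(3) by blast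
  qed
next
  assume R: "\<forall>x\<in>S. \<exists>T. open T \<and> x \<in> T \<and> (\<forall>y\<in>S \<inter> T. f y = f x)"
  show "locally_constant_on S f" unfolding locally_constant_on_def locally_def
  proof (intro allI impI)
    fix w x assume w: "openin (top_of_set S) w \<and> x \<in> w"
    then obtain W where W: "open W" "w = S \<inter> W" by (auto simp: openin_open)
    with w R obtain T where T: "open T" "x \<in> T" "\<forall>y\<in>S \<inter> T. f y = f x" by blast
    show "\<exists>A B. openin (top_of_set S) A \<and> f constant_on B \<and> x \<in> A \<and> A \<subseteq> B \<and> B \<subseteq> w"
    proof (intro exI conjI)
      show "openin (top_of_set S) (S \<inter> (W \<inter> T))" using W T by (intro openin_open_Int) auto
      show "f constant_on (S \<inter> (W \<inter> T))" using T(3) unfolding constant_on_def by blast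
    qed (use w W T in auto)
  qed
qed

lemma locally_constant_on_const [simp]: "locally_constant_on S (\<lambda>_. c)"
  by (auto simp: locally_constant_on_iff)

lemma locally_constant_on_subset:
  "locally_constant_on S f \<Longrightarrow> T \<subseteq> S \<Longrightarrow> locally_constant_on T f"
  unfolding locally_constant_on_iff by (meson IntE IntI subsetD)

lemma locally_constant_on_compose2:
  assumes "locally_constant_on S f" "locally_constant_on S g"
  shows "locally_constant_on S (\<lambda>x. h (f x) (g x))"
  unfolding locally_constant_on_iff
proof
  fix x assume x: "x \<in> S"
  from assms x obtain A B where "open A" "x \<in> A" "\<forall>y\<in>S \<inter> A. f y = f x"
    "open B" "x \<in> B" "\<forall>y\<in>S \<inter> B. g y = g x" unfolding locally_constant_on_iff by metis
  then show "\<exists>T. open T \<and> x \<in> T \<and> (\<forall>y\<in>S \<inter> T. h (f y) (g y) = h (f x) (g x))"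
    by (intro exI[of _ "A \<inter> B"]) auto
qed

lemma locally_constant_on_cong:
  assumes "locally_constant_on S f" "\<And>x. x \<in> S \<Longrightarrow> f x = g x"
  shows "locally_constant_on S g"
  using assms unfolding locally_constant_on_iff by (metis IntE)

lemma locally_constant_on_imp_continuous_on:
  assumes "locally_constant_on S f"
  shows "continuous_on S f"
  unfolding continuous_on_def
proof
  fix x assume "x \<in> S"
  then obtain T where T: "open T" "x \<in> T" "\<forall>y\<in>S \<inter> T. f y = f x"
    using assms unfolding locally_constant_on_iff by metis
  then have "eventually (\<lambda>y. f y = f x) (at x within S)"
    unfolding eventually_at_topological by blast
  then show "(f \<longlongrightarrow> f x) (at x within S)" by (rule tendsto_eventually)
qed

text \<open>On a neighbourhood where \<open>s\<close> varies by less than 1/4, two values of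
  \<open>e\<close> differ by less than 3/4, hence agree. It is applied to rounded coboundaries and,
  with error zero, to continuous functions with integer values.\<close>

lemma locally_constant_on_near_int:
  fixes s :: "'a::topological_space \<Rightarrow> real" and e :: "'a \<Rightarrow> int"
  assumes "continuous_on S s" "\<And>x. x \<in> S \<Longrightarrow> \<bar>s x - of_int (e x)\<bar> < 1 / 4"
  shows "locally_constant_on S e"
  unfolding locally_constant_on_iff
proof
  fix x assume x: "x \<in> S"
  have "(s \<longlongrightarrow> s x) (at x within S)" using assms(1) x by (auto simp: continuous_on_def)
  then have "eventually (\<lambda>y. dist (s y) (s x) < 1 / 4) (at x within S)" by (rule tendstoD) simp
  then obtain T where T: "open T" "x \<in> T" "\<And>y. y \<in> T \<Longrightarrow> y \<noteq> x \<Longrightarrow> y \<in> S \<Longrightarrow> dist (s y) (s x) < 1 / 4"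
    unfolding eventually_at_topological by metis
  have "e y = e x" if y: "y \<in> S \<inter> T" for y
  proof (cases "y = x")
    case False
    then have "\<bar>s y - s x\<bar> < 1/4" using T(3)[of y] y by (auto simp: dist_real_def)
    then have "\<bar>real_of_int (e y) - real_of_int (e x)\<bar> < 1"
      using assms(2)[OF x] assms(2)[of y] IntD1[OF y] unfolding abs_less_iff by linarith
    then show ?thesis by linarith
  qed simp
  with T show "\<exists>T. open T \<and> x \<in> T \<and> (\<forall>y\<in>S \<inter> T. e y = e x)" by blast
qed

lemma locally_constant_on_sign:
  fixes f :: "'a::topological_space \<Rightarrow> real" and e :: "'a \<Rightarrow> int"
  assumes "continuous_on S f" "\<And>x. x \<in> S \<Longrightarrow> f x = of_int (e x)"
  shows "locally_constant_on S e"
  using assms by (intro locally_constant_on_near_int[of S f]) auto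

section \<open>Twisted cohomology\<close>

context
  fixes J :: "nat set" and U :: "nat \<Rightarrow> 'a::topological_space set"
begin

lemma C0_signD:
  assumes "\<phi> \<in> C0_sign J U" "j \<in> J"
  shows "locally_constant_on (U j) (\<phi> j)" "b \<in> U j \<Longrightarrow> \<phi> j b * \<phi> j b = 1"
    "b \<in> U j \<Longrightarrow> \<phi> j b * (\<phi> j b * x) = x"
proof -
  show "locally_constant_on (U j) (\<phi> j)" using assms by (simp add: C0_sign_def)
  assume "b \<in> U j"
  with assms have "\<phi> j b \<in> {1, -1}" by (simp add: C0_sign_def)
  then show "\<phi> j b * \<phi> j b = 1" "\<phi> j b * (\<phi> j b * x) = x" by auto
qed

lemma C0_sign_const_1: "(\<lambda>_ _. 1) \<in> C0_sign J U"
  by (auto simp: C0_sign_def)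

lemma C0_sign_mult:
  assumes "\<phi> \<in> C0_sign J U" "\<psi> \<in> C0_sign J U"
  shows "(\<lambda>j b. \<psi> j b * \<phi> j b) \<in> C0_sign J U"
  unfolding C0_sign_def mem_Collect_eq
proof (intro ballI conjI)
  fix j assume j: "j \<in> J"
  show "locally_constant_on (U j) (\<lambda>b. \<psi> j b * \<phi> j b)"
    using assms j by (intro locally_constant_on_compose2[where h=times]) (auto simp: C0_sign_def)
  fix b assume "b \<in> U j"
  with assms j have "\<phi> j b \<in> {1, -1}" "\<psi> j b \<in> {1, -1}" by (simp_all add: C0_sign_def)
  then show "\<psi> j b * \<phi> j b \<in> {1, -1}" by auto
qed

lemma sign_gaugeD:
  assumes "sign_gauge J U \<phi> \<omega> \<omega>'"
  shows "\<phi> \<in> C0_sign J U"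
    "j \<in> J \<Longrightarrow> k \<in> J \<Longrightarrow> b \<in> U j \<Longrightarrow> b \<in> U k \<Longrightarrow> \<omega>' j k b = \<phi> j b * \<omega> j k b * \<phi> k b"
  using assms by (auto simp: sign_gauge_def)

lemma sign_gauge_refl:
  assumes "\<And>j k b. j \<in> J \<Longrightarrow> k \<in> J \<Longrightarrow> b \<in> U j \<Longrightarrow> b \<in> U k \<Longrightarrow> \<omega>' j k b = \<omega> j k b"
  shows "sign_gauge J U (\<lambda>_ _. 1) \<omega> \<omega>'"
  using assms by (auto simp: sign_gauge_def C0_sign_const_1)

text \<open>A sign is its own inverse, so the same \<open>\<phi>\<close> undoes the change.\<close>

lemma sign_gauge_sym:
  assumes "sign_gauge J U \<phi> \<omega> \<omega>'"
  shows "sign_gauge J U \<phi> \<omega>' \<omega>"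
proof -
  note D = sign_gaugeD[OF assms]
  have "\<omega> j k b = \<phi> j b * \<omega>' j k b * \<phi> k b" if "j \<in> J" "k \<in> J" "b \<in> U j" "b \<in> U k" for j k b
    using D(2)[OF that] C0_signD(2,3)[OF D(1)] that by (simp add: mult_ac)
  with D(1) show ?thesis by (auto simp: sign_gauge_def)
qed

lemma sign_gauge_trans:
  assumes "sign_gauge J U \<phi> \<omega> \<omega>'" "sign_gauge J U \<psi> \<omega>' \<omega>''"
  shows "sign_gauge J U (\<lambda>j b. \<psi> j b * \<phi> j b) \<omega> \<omega>''"
  using assms by (auto simp: sign_gauge_def C0_sign_mult mult_ac)

lemma C1_int_add: "\<alpha> \<in> C1_int J U \<Longrightarrow> \<beta> \<in> C1_int J U \<Longrightarrow> (\<lambda>j k b. \<alpha> j k b + \<beta> j k b) \<in> C1_int J U"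
  unfolding C1_int_def using locally_constant_on_compose2[where h="(+)"] by blast

lemma C1_int_uminus: "\<alpha> \<in> C1_int J U \<Longrightarrow> (\<lambda>j k b. - \<alpha> j k b) \<in> C1_int J U"
  unfolding C1_int_def using locally_constant_on_compose2[where h="\<lambda>x y. - x"] by blast

lemma cohomologousI:
  assumes "e \<in> Z2_twisted J U \<omega>" "e' \<in> Z2_twisted J U \<omega>" "\<beta> \<in> C1_int J U"
    "\<And>j k l b. \<lbrakk>j \<in> J; k \<in> J; l \<in> J; b \<in> U j; b \<in> U k; b \<in> U l\<rbrakk> \<Longrightarrow>
      e' j k l b - e j k l b = twisted_cobd1 \<omega> \<beta> j k l b"
  shows "(e, e') \<in> cohomologous J U \<omega>"
  using assms unfolding cohomologous_def by auto

lemma cohomologousE: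
  assumes "(e, e') \<in> cohomologous J U \<omega>"
  obtains \<beta> where "e \<in> Z2_twisted J U \<omega>" "e' \<in> Z2_twisted J U \<omega>" "\<beta> \<in> C1_int J U"
    "\<And>j k l b. \<lbrakk>j \<in> J; k \<in> J; l \<in> J; b \<in> U j; b \<in> U k; b \<in> U l\<rbrakk> \<Longrightarrow>
      e' j k l b - e j k l b = twisted_cobd1 \<omega> \<beta> j k l b"
  using assms unfolding cohomologous_def by auto

text \<open>The zero 1-cochain is the witness. This turns equality on intersections, the only place
  where the values of the total functions matter, into equality of classes.\<close>

lemma cohomologous_cong:
  assumes e: "e \<in> Z2_twisted J U \<omega>"
    and eq: "\<And>j k l b. \<lbrakk>j \<in> J; k \<in> J; l \<in> J; b \<in> U j; b \<in> U k; b \<in> U l\<rbrakk> \<Longrightarrow> e j k l b = e' j k l b"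
  shows "e' \<in> Z2_twisted J U \<omega>" "(e, e') \<in> cohomologous J U \<omega>"
proof -
  have "e' \<in> C2_int J U"
    unfolding C2_int_def mem_Collect_eq
  proof (intro ballI)
    fix j k l assume *: "j \<in> J" "k \<in> J" "l \<in> J"
    show "locally_constant_on (U j \<inter> U k \<inter> U l) (e' j k l)"
      by (rule locally_constant_on_cong[of _ "e j k l"]) (use e eq * in \<open>auto simp: Z2_twisted_def C2_int_def\<close>)
  qed
  moreover have "twisted_cobd2 \<omega> e' j k l m b = 0"
    if "j \<in> J" "k \<in> J" "l \<in> J" "m \<in> J" "b \<in> U j \<inter> U k \<inter> U l \<inter> U m" for j k l m b
  proof -
    have "twisted_cobd2 \<omega> e' j k l m b = twisted_cobd2 \<omega> e j k l m b"
      using that by (simp add: twisted_cobd2_def eq[symmetric])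
    also have "\<dots> = 0" using e that by (simp add: Z2_twisted_def)
    finally show ?thesis .
  qed
  ultimately show "e' \<in> Z2_twisted J U \<omega>" unfolding Z2_twisted_def by auto
  with e eq show "(e, e') \<in> cohomologous J U \<omega>"
    by (intro cohomologousI[where \<beta>="\<lambda>_ _ _. 0"]) (auto simp: twisted_cobd1_def C1_int_def)
qed

lemma equiv_cohomologous: "equiv (Z2_twisted J U \<omega>) (cohomologous J U \<omega>)"
proof (rule equivI)
  show "cohomologous J U \<omega> \<subseteq> Z2_twisted J U \<omega> \<times> Z2_twisted J U \<omega>"
    by (auto simp: cohomologous_def)
  show "refl_on (Z2_twisted J U \<omega>) (cohomologous J U \<omega>)"
    by (rule refl_onI) (simp add: cohomologous_cong(2))
  show "sym (cohomologous J U \<omega>)"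
  proof (rule symI, elim cohomologousE)
    fix e e' \<beta> assume A: "e \<in> Z2_twisted J U \<omega>" "e' \<in> Z2_twisted J U \<omega>" "\<beta> \<in> C1_int J U"
      "\<And>j k l b. \<lbrakk>j \<in> J; k \<in> J; l \<in> J; b \<in> U j; b \<in> U k; b \<in> U l\<rbrakk> \<Longrightarrow>
        e' j k l b - e j k l b = twisted_cobd1 \<omega> \<beta> j k l b"
    show "(e', e) \<in> cohomologous J U \<omega>"
    proof (rule cohomologousI[OF A(2,1) C1_int_uminus[OF A(3)]])
      fix j k l b assume "j \<in> J" "k \<in> J" "l \<in> J" "b \<in> U j" "b \<in> U k" "b \<in> U l"
      then show "e j k l b - e' j k l b = twisted_cobd1 \<omega> (\<lambda>j k b. - \<beta> j k b) j k l b"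
        using A(4)[of j k l b] by (simp add: twisted_cobd1_def algebra_simps)
    qed
  qed
  show "trans (cohomologous J U \<omega>)"
  proof (rule transI, elim cohomologousE)
    fix e e' e'' \<beta> \<beta>' assume A: "e \<in> Z2_twisted J U \<omega>" "e'' \<in> Z2_twisted J U \<omega>"
      "\<beta> \<in> C1_int J U" "\<beta>' \<in> C1_int J U"
      and B: "\<And>j k l b. \<lbrakk>j \<in> J; k \<in> J; l \<in> J; b \<in> U j; b \<in> U k; b \<in> U l\<rbrakk> \<Longrightarrow>
        e' j k l b - e j k l b = twisted_cobd1 \<omega> \<beta> j k l b"
      "\<And>j k l b. \<lbrakk>j \<in> J; k \<in> J; l \<in> J; b \<in> U j; b \<in> U k; b \<in> U l\<rbrakk> \<Longrightarrow>
        e'' j k l b - e' j k l b = twisted_cobd1 \<omega> \<beta>' j k l b"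
    show "(e, e'') \<in> cohomologous J U \<omega>"
    proof (rule cohomologousI[OF A(1,2) C1_int_add[OF A(3,4)]])
      fix j k l b assume "j \<in> J" "k \<in> J" "l \<in> J" "b \<in> U j" "b \<in> U k" "b \<in> U l"
      then show "e'' j k l b - e j k l b = twisted_cobd1 \<omega> (\<lambda>j k b. \<beta> j k b + \<beta>' j k b) j k l b"
        using B(1)[of j k l b] B(2)[of j k l b] by (simp add: twisted_cobd1_def algebra_simps)
    qed
  qed
qed

lemma H2_class_eq: "(e, e') \<in> cohomologous J U \<omega> \<Longrightarrow> H2_class J U \<omega> e = H2_class J U \<omega> e'"
  unfolding H2_class_def by (rule equiv_class_eq[OF equiv_cohomologous])

lemma H2_class_eq_iff:
  assumes "e \<in> Z2_twisted J U \<omega>" "e' \<in> Z2_twisted J U \<omega>"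
  shows "H2_class J U \<omega> e = H2_class J U \<omega> e' \<longleftrightarrow> (e, e') \<in> cohomologous J U \<omega>"
  unfolding H2_class_def using eq_equiv_class_iff[OF equiv_cohomologous assms] .

lemma H2_class_in: "e \<in> Z2_twisted J U \<omega> \<Longrightarrow> H2_class J U \<omega> e \<in> H2_twisted J U \<omega>"
  unfolding H2_class_def H2_twisted_def by (rule quotientI)

lemma H2_twistedE:
  assumes "c \<in> H2_twisted J U \<omega>"
  obtains e where "e \<in> Z2_twisted J U \<omega>" "c = H2_class J U \<omega> e"
  using assms unfolding H2_class_def H2_twisted_def by (auto elim: quotientE)

text \<open>In \<open>\<omega>'\<close> the factor \<open>\<phi> k\<close> meets the
  \<open>\<phi> k\<close> in front of \<open>e k l m\<close> and cancels, so \<open>\<phi> j\<close>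
  factors out of the whole coboundary.\<close>

lemma sign_gauge_Z2:
  assumes g: "sign_gauge J U \<phi> \<omega> \<omega>'" and e: "e \<in> Z2_twisted J U \<omega>"
  shows "(\<lambda>j k l b. \<phi> j b * e j k l b) \<in> Z2_twisted J U \<omega>'"
proof -
  note D = sign_gaugeD[OF g]
  have "locally_constant_on (U j \<inter> U k \<inter> U l) (\<lambda>b. \<phi> j b * e j k l b)"
    if "j \<in> J" "k \<in> J" "l \<in> J" for j k l
    using e that locally_constant_on_subset[OF C0_signD(1)[OF D(1)], of j "U j \<inter> U k \<inter> U l"]
    by (intro locally_constant_on_compose2[where h=times]) (auto simp: Z2_twisted_def C2_int_def)
  moreover have "twisted_cobd2 \<omega>' (\<lambda>j k l b. \<phi> j b * e j k l b) j k l m b = 0"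
    if *: "j \<in> J" "k \<in> J" "l \<in> J" "m \<in> J" "b \<in> U j \<inter> U k \<inter> U l \<inter> U m" for j k l m b
  proof -
    have "twisted_cobd2 \<omega>' (\<lambda>j k l b. \<phi> j b * e j k l b) j k l m b = \<phi> j b * twisted_cobd2 \<omega> e j k l m b"
      using D(2)[of j k b] C0_signD(2,3)[OF D(1), of k b] *
      unfolding twisted_cobd2_def by (simp add: algebra_simps)
    also have "\<dots> = 0" using e * by (simp add: Z2_twisted_def)
    finally show ?thesis .
  qed
  ultimately show ?thesis by (auto simp: Z2_twisted_def C2_int_def)
qed

text \<open>The witness is \<open>\<phi> j\<close> times \<open>\<beta> j k\<close>; the same
  cancellation of \<open>\<phi> k\<close> occurs one degree lower.\<close>

lemma sign_gauge_cohomologous: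
  assumes g: "sign_gauge J U \<phi> \<omega> \<omega>'" and e: "(e, e') \<in> cohomologous J U \<omega>"
  shows "(\<lambda>j k l b. \<phi> j b * e j k l b, \<lambda>j k l b. \<phi> j b * e' j k l b) \<in> cohomologous J U \<omega>'"
proof -
  note D = sign_gaugeD[OF g]
  from e obtain \<beta> where A: "e \<in> Z2_twisted J U \<omega>" "e' \<in> Z2_twisted J U \<omega>" "\<beta> \<in> C1_int J U"
    "\<And>j k l b. \<lbrakk>j \<in> J; k \<in> J; l \<in> J; b \<in> U j; b \<in> U k; b \<in> U l\<rbrakk> \<Longrightarrow>
      e' j k l b - e j k l b = twisted_cobd1 \<omega> \<beta> j k l b" by (elim cohomologousE) blast
  show ?thesis
  proof (rule cohomologousI)
    show "(\<lambda>j k b. \<phi> j b * \<beta> j k b) \<in> C1_int J U"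
      unfolding C1_int_def mem_Collect_eq
    proof (intro ballI locally_constant_on_compose2[where h=times])
      fix j k assume "j \<in> J" "k \<in> J"
      then show "locally_constant_on (U j \<inter> U k) (\<phi> j)" "locally_constant_on (U j \<inter> U k) (\<beta> j k)"
        using locally_constant_on_subset[OF C0_signD(1)[OF D(1)]] A(3) by (auto simp: C1_int_def)
    qed
    fix j k l b assume *: "j \<in> J" "k \<in> J" "l \<in> J" "b \<in> U j" "b \<in> U k" "b \<in> U l"
    have "\<phi> j b * e' j k l b - \<phi> j b * e j k l b = \<phi> j b * twisted_cobd1 \<omega> \<beta> j k l b"
      using A(4)[OF *] by (simp add: algebra_simps)
    also have "\<dots> = twisted_cobd1 \<omega>' (\<lambda>j k b. \<phi> j b * \<beta> j k b) j k l b"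
      using D(2)[of j k b] C0_signD(2,3)[OF D(1), of k b] *
      unfolding twisted_cobd1_def by (simp add: algebra_simps)
    finally show "\<phi> j b * e' j k l b - \<phi> j b * e j k l b = twisted_cobd1 \<omega>' (\<lambda>j k b. \<phi> j b * \<beta> j k b) j k l b" .
  qed (use A sign_gauge_Z2[OF g] in auto)
qed

text \<open>The relation asks for the class of the transported cocycle itself; a cohomologous
  \<open>e'\<close> is allowed here because a rounded lift comes with a representative of its
  own.\<close>

lemma twisted_iso_relI:
  assumes "\<omega> \<in> Z1_sign J U" "\<omega>' \<in> Z1_sign J U" "sign_gauge J U \<phi> \<omega> \<omega>'" "e \<in> Z2_twisted J U \<omega>"
    "(\<lambda>j k l b. \<phi> j b * e j k l b, e') \<in> cohomologous J U \<omega>'"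
  shows "((\<omega>, H2_class J U \<omega> e), (\<omega>', H2_class J U \<omega>' e')) \<in> twisted_iso_rel J U"
  using assms H2_class_eq[OF assms(5)] cohomologousE[OF assms(5)] H2_class_in
  unfolding twisted_iso_rel_def twisted_pairs_def by blast

lemma twisted_iso_relE:
  assumes "(p, p') \<in> twisted_iso_rel J U"
  obtains \<omega> \<omega>' \<phi> e where "p = (\<omega>, H2_class J U \<omega> e)" "p' = (\<omega>', H2_class J U \<omega>' (\<lambda>j k l b. \<phi> j b * e j k l b))"
    "\<omega> \<in> Z1_sign J U" "\<omega>' \<in> Z1_sign J U" "sign_gauge J U \<phi> \<omega> \<omega>'" "e \<in> Z2_twisted J U \<omega>"
  using assms unfolding twisted_iso_rel_def twisted_pairs_def by blast

lemma equiv_twisted_iso_rel: "equiv (twisted_pairs J U) (twisted_iso_rel J U)"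
proof (rule equivI)
  show "twisted_iso_rel J U \<subseteq> twisted_pairs J U \<times> twisted_pairs J U"
    by (auto simp: twisted_iso_rel_def)
  show "refl_on (twisted_pairs J U) (twisted_iso_rel J U)"
  proof (rule refl_onI)
    fix p assume "p \<in> twisted_pairs J U"
    then obtain \<omega> e where "p = (\<omega>, H2_class J U \<omega> e)" "\<omega> \<in> Z1_sign J U" "e \<in> Z2_twisted J U \<omega>"
      by (auto simp: twisted_pairs_def elim!: H2_twistedE)
    then show "(p, p) \<in> twisted_iso_rel J U"
      using twisted_iso_relI[OF _ _ sign_gauge_refl, of \<omega> \<omega> e e] cohomologous_cong by auto
  qed
  show "sym (twisted_iso_rel J U)"
  proof (rule symI)
    fix p p' assume "(p, p') \<in> twisted_iso_rel J U"
    then obtain \<omega> \<omega>' \<phi> e where p: "p = (\<omega>, H2_class J U \<omega> e)"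
      "p' = (\<omega>', H2_class J U \<omega>' (\<lambda>j k l b. \<phi> j b * e j k l b))"
      and g: "\<omega> \<in> Z1_sign J U" "\<omega>' \<in> Z1_sign J U" "sign_gauge J U \<phi> \<omega> \<omega>'" "e \<in> Z2_twisted J U \<omega>"
      by (elim twisted_iso_relE)
    show "(p', p) \<in> twisted_iso_rel J U" unfolding p
    proof (rule twisted_iso_relI[OF g(2,1) sign_gauge_sym[OF g(3)] sign_gauge_Z2[OF g(3,4)]])
      note Z = sign_gauge_Z2[OF sign_gauge_sym[OF g(3)] sign_gauge_Z2[OF g(3,4)]]
      \<comment> \<open>Transporting twice gives back \<open>e\<close> only over the sets
        \<open>U j\<close>, since \<open>\<phi>\<close> is arbitrary elsewhere; hence cohomologous
        instead of equal.\<close>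
      show "(\<lambda>j k l b. \<phi> j b * (\<phi> j b * e j k l b), e) \<in> cohomologous J U \<omega>"
        by (rule cohomologous_cong(2)[OF Z]) (use C0_signD(3)[OF sign_gaugeD(1)[OF g(3)]] in auto)
    qed
  qed
  show "trans (twisted_iso_rel J U)"
  proof (rule transI)
    fix p p' p'' assume "(p, p') \<in> twisted_iso_rel J U" "(p', p'') \<in> twisted_iso_rel J U"
    then obtain \<omega> \<omega>' \<phi> e \<omega>'' \<phi>' e' where p: "p = (\<omega>, H2_class J U \<omega> e)"
      "p' = (\<omega>', H2_class J U \<omega>' (\<lambda>j k l b. \<phi> j b * e j k l b))"
      and g: "\<omega> \<in> Z1_sign J U" "\<omega>' \<in> Z1_sign J U" "sign_gauge J U \<phi> \<omega> \<omega>'" "e \<in> Z2_twisted J U \<omega>"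
      and p': "p' = (\<omega>', H2_class J U \<omega>' e')"
      "p'' = (\<omega>'', H2_class J U \<omega>'' (\<lambda>j k l b. \<phi>' j b * e' j k l b))"
      and g': "\<omega>'' \<in> Z1_sign J U" "sign_gauge J U \<phi>' \<omega>' \<omega>''" "e' \<in> Z2_twisted J U \<omega>'"
      by (elim twisted_iso_relE) blast
    \<comment> \<open>The middle pair comes with two representatives of one class; they differ by a
      coboundary, which \<open>\<phi>'\<close> carries on to \<open>\<omega>''\<close>.\<close>
    have "(\<lambda>j k l b. \<phi> j b * e j k l b, e') \<in> cohomologous J U \<omega>'"
      using p(2) p'(1) H2_class_eq_iff[OF sign_gauge_Z2[OF g(3,4)] g'(3)] by simp
    from sign_gauge_cohomologous[OF g'(2) this]
    show "(p, p'') \<in> twisted_iso_rel J U" unfolding p p'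
      by (intro twisted_iso_relI[OF g(1) g'(1) sign_gauge_trans[OF g(3) g'(2)] g(4)]) (simp add: mult_ac)
  qed
qed

lemma coproduct_elem_in:
  assumes "\<omega> \<in> Z1_sign J U" "c \<in> H2_twisted J U \<omega>"
  shows "coproduct_elem J U \<omega> c \<in> twisted_coproduct J U"
  using assms unfolding coproduct_elem_def twisted_coproduct_def
  by (intro quotientI) (simp add: twisted_pairs_def)

lemma coproduct_elem_eqI:
  assumes "\<omega> \<in> Z1_sign J U" "\<omega>' \<in> Z1_sign J U" "sign_gauge J U \<phi> \<omega> \<omega>'" "e \<in> Z2_twisted J U \<omega>"
    "(\<lambda>j k l b. \<phi> j b * e j k l b, e') \<in> cohomologous J U \<omega>'"
  shows "coproduct_elem J U \<omega> (H2_class J U \<omega> e) = coproduct_elem J U \<omega>' (H2_class J U \<omega>' e')"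
  unfolding coproduct_elem_def by (rule equiv_class_eq[OF equiv_twisted_iso_rel twisted_iso_relI[OF assms]])

text \<open>For the inclusion from right to left, a representative of \<open>c\<close> is
  transported along the given gauge, so every cocycle of the sign class occurs as a first
  component.\<close>

lemma fst_coproduct_elem:
  assumes "\<omega> \<in> Z1_sign J U" "c \<in> H2_twisted J U \<omega>"
  shows "fst ` coproduct_elem J U \<omega> c = H1_sign_class J U \<omega>"
proof (intro equalityI subsetI)
  fix \<omega>' assume "\<omega>' \<in> fst ` coproduct_elem J U \<omega> c"
  then show "\<omega>' \<in> H1_sign_class J U \<omega>"
    by (auto simp: coproduct_elem_def H1_sign_class_def elim!: twisted_iso_relE)
next
  fix \<omega>' assume "\<omega>' \<in> H1_sign_class J U \<omega>"
  then obtain \<phi> where g: "\<omega>' \<in> Z1_sign J U" "sign_gauge J U \<phi> \<omega> \<omega>'" by (auto simp: H1_sign_class_def)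
  from assms(2) obtain e where e: "e \<in> Z2_twisted J U \<omega>" "c = H2_class J U \<omega> e" by (rule H2_twistedE)
  from twisted_iso_relI[OF assms(1) g e(1) cohomologous_cong(2)[OF sign_gauge_Z2[OF g(2) e(1)]]]
  have "(\<omega>', H2_class J U \<omega>' (\<lambda>j k l b. \<phi> j b * e j k l b)) \<in> coproduct_elem J U \<omega> c"
    by (simp add: coproduct_elem_def e)
  then show "\<omega>' \<in> fst ` coproduct_elem J U \<omega> c" by force
qed

end

section \<open>Characteristic classes of approximate cocycles\<close>

text \<open>The exact value is \<open>sqrt 2\<close>; the bound only serves to show that the sets
  below the suprema are bounded.\<close>

lemma norm_orthogonal_mat2:
  fixes A :: mat2
  assumes "orthogonal_matrix A"
  shows "norm A \<le> 2"
proof -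
  from assms have "A$1$1 * A$1$1 + A$2$1 * A$2$1 = 1" "A$1$2 * A$1$2 + A$2$2 * A$2$2 = 1"
    by (simp_all add: orthogonal_matrix mat2_eq_iff mat2_mult_nth transpose_def)
  then have "(norm A)\<^sup>2 = 2" unfolding power2_norm_mat2 by (simp add: power2_eq_square)
  also have "\<dots> \<le> 2\<^sup>2" by simp
  finally show ?thesis by (rule power2_le_imp_le) simp
qed

text \<open>The later arguments take place at one point, where this bound is what the supremum
  yields. Exact cocycles satisfy it directly for every positive bound.\<close>

definition pointwise_Z1 :: "nat set \<Rightarrow> (nat \<Rightarrow> 'a::topological_space set) \<Rightarrow> real \<Rightarrow> 'a O2_cochain set" where
  "pointwise_Z1 J U \<epsilon> = {\<Omega> \<in> C1_O2 J U. \<forall>j\<in>J. \<forall>k\<in>J. \<forall>l\<in>J. \<forall>b\<in>U j \<inter> U k \<inter> U l.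
     norm (\<Omega> j k b ** \<Omega> k l b - \<Omega> j l b) < \<epsilon>}"

context
  fixes J :: "nat set" and U :: "nat \<Rightarrow> 'a::topological_space set"
begin

lemma C1_O2D:
  assumes "\<Omega> \<in> C1_O2 J U" "j \<in> J" "k \<in> J"
  shows "continuous_on (U j \<inter> U k) (\<Omega> j k)" "b \<in> U j \<Longrightarrow> b \<in> U k \<Longrightarrow> orthogonal_matrix (\<Omega> j k b)"
  using assms by (simp_all add: C1_O2_def)

lemma Z1_approx_subset_pointwise: "Z1_approx J U \<epsilon> \<subseteq> pointwise_Z1 J U \<epsilon>"
proof
  fix \<Omega> assume "\<Omega> \<in> Z1_approx J U \<epsilon>"
  then have \<Omega>: "\<Omega> \<in> C1_O2 J U" "cocycle_defect J U \<Omega> < \<epsilon>" by (simp_all add: Z1_approx_def)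
  let ?S = "{norm (\<Omega> j k b ** \<Omega> k l b - \<Omega> j l b) | j k l b.
            j \<in> J \<and> k \<in> J \<and> l \<in> J \<and> b \<in> U j \<inter> U k \<inter> U l}"
  \<comment> \<open>Two orthogonal matrices, each of norm at most 2. Boundedness is what lets the
    supremum control its elements.\<close>
  have "bdd_above ?S"
  proof (rule bdd_aboveI[of _ 4])
    fix x assume "x \<in> ?S"
    then obtain j k l b where *: "j \<in> J" "k \<in> J" "l \<in> J" "b \<in> U j" "b \<in> U k" "b \<in> U l"
      and x: "x = norm (\<Omega> j k b ** \<Omega> k l b - \<Omega> j l b)" by auto
    have "x \<le> norm (\<Omega> j k b ** \<Omega> k l b) + norm (\<Omega> j l b)" unfolding x by (rule norm_triangle_ineq4)
    also have "\<dots> \<le> 2 + 2"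
      using C1_O2D(2)[OF \<Omega>(1)] * by (intro add_mono norm_orthogonal_mat2 orthogonal_matrix_mul) auto
    finally show "x \<le> 4" by simp
  qed
  then have "x < \<epsilon>" if "x \<in> ?S" for x
    using cSup_upper[OF that] \<Omega>(2) by (simp add: cocycle_defect_def)
  then show "\<Omega> \<in> pointwise_Z1 J U \<epsilon>" using \<Omega>(1) unfolding pointwise_Z1_def by blast
qed

lemma pointwise_Z1_mono: "\<epsilon> \<le> \<epsilon>' \<Longrightarrow> pointwise_Z1 J U \<epsilon> \<subseteq> pointwise_Z1 J U \<epsilon>'"
  unfolding pointwise_Z1_def using less_le_trans by blast

lemma Z1_exact_subset_pointwise: "0 < \<epsilon> \<Longrightarrow> Z1_exact J U \<subseteq> pointwise_Z1 J U \<epsilon>"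
  unfolding Z1_exact_def pointwise_Z1_def by auto

lemma pointwise_Z1D:
  assumes "\<Omega> \<in> pointwise_Z1 J U \<epsilon>"
  shows "\<Omega> \<in> C1_O2 J U"
    "\<lbrakk>j \<in> J; k \<in> J; l \<in> J; b \<in> U j; b \<in> U k; b \<in> U l\<rbrakk> \<Longrightarrow> norm (\<Omega> j k b ** \<Omega> k l b - \<Omega> j l b) < \<epsilon>"
  using assms by (simp_all add: pointwise_Z1_def)

section \<open>Determinants and lifts of a cochain\<close>

lemma of_int_det_cochain:
  assumes "\<Omega> \<in> C1_O2 J U" "j \<in> J" "k \<in> J" "b \<in> U j" "b \<in> U k"
  shows "real_of_int (det_cochain \<Omega> j k b) = det (\<Omega> j k b)" "det_cochain \<Omega> j k b \<in> {1, -1}"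
proof -
  have "det (\<Omega> j k b) = of_int 1 \<or> det (\<Omega> j k b) = of_int (- 1)"
    using orthogonal_matrix_det[OF C1_O2D(2)[OF assms]] by simp
  then obtain n where n: "n \<in> {1, -1}" "det (\<Omega> j k b) = real_of_int n" by blast
  then have "det_cochain \<Omega> j k b = n" by (simp only: det_cochain_def floor_of_int)
  with n show "real_of_int (det_cochain \<Omega> j k b) = det (\<Omega> j k b)" "det_cochain \<Omega> j k b \<in> {1, -1}" by simp_all
qed

lemma locally_constant_det_cochain:
  assumes "\<Omega> \<in> C1_O2 J U" "j \<in> J" "k \<in> J"
  shows "locally_constant_on (U j \<inter> U k) (det_cochain \<Omega> j k)"
proof (rule locally_constant_on_sign)
  show "continuous_on (U j \<inter> U k) (\<lambda>b. det (\<Omega> j k b))"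
    using C1_O2D(1)[OF assms] by (rule continuous_on_det2)
qed (use of_int_det_cochain[OF assms] in auto)

lemma det_cochain_in_Z1_sign:
  assumes "\<Omega> \<in> pointwise_Z1 J U 1"
  shows "det_cochain \<Omega> \<in> Z1_sign J U"
proof -
  note \<Omega> = pointwise_Z1D[OF assms]
  have "det_cochain \<Omega> j k b * det_cochain \<Omega> k l b = det_cochain \<Omega> j l b"
    if *: "j \<in> J" "k \<in> J" "l \<in> J" "b \<in> U j" "b \<in> U k" "b \<in> U l" for j k l b
  proof -
    have "norm (\<Omega> j k b ** \<Omega> k l b - \<Omega> j l b) \<noteq> 2" using \<Omega>(2)[OF *] by simp
    then have "det (\<Omega> j k b ** \<Omega> k l b) = det (\<Omega> j l b)"
      using norm_diff_det_ne[of "\<Omega> j k b ** \<Omega> k l b" "\<Omega> j l b"] C1_O2D(2)[OF \<Omega>(1)] *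
      by (auto intro: orthogonal_matrix_mul)
    then have "real_of_int (det_cochain \<Omega> j k b * det_cochain \<Omega> k l b) = real_of_int (det_cochain \<Omega> j l b)"
      using * by (simp add: of_int_det_cochain(1)[OF \<Omega>(1)] det_mul)
    then show ?thesis unfolding of_int_eq_iff .
  qed
  then show ?thesis unfolding Z1_sign_def
    using locally_constant_det_cochain[OF \<Omega>(1)] of_int_det_cochain(2)[OF \<Omega>(1)] by auto
qed

lemma is_lift_form:
  assumes "\<Omega> \<in> C1_O2 J U" "is_lift J U (abs_cochain \<Omega>) \<Theta>" "j \<in> J" "k \<in> J" "b \<in> U j" "b \<in> U k"
  shows "\<Omega> j k b = rot (\<Theta> j k b) ** refl_mat (real_of_int (det_cochain \<Omega> j k b))"
proof -
  have "rot (\<Theta> j k b) = \<Omega> j k b ** refl_mat (det (\<Omega> j k b))"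
    using assms by (simp add: is_lift_def abs_cochain_def)
  then show ?thesis
    using abs_refl_mat[OF C1_O2D(2)[OF assms(1,3,4,5,6)]] of_int_det_cochain(1)[OF assms(1,3,4,5,6)] by simp
qed

lemma is_liftI:
  assumes "\<Omega> \<in> C1_O2 J U"
    "\<And>j k. j \<in> J \<Longrightarrow> k \<in> J \<Longrightarrow> continuous_on (U j \<inter> U k) (\<Theta> j k)"
    "\<And>j k b. \<lbrakk>j \<in> J; k \<in> J; b \<in> U j; b \<in> U k\<rbrakk> \<Longrightarrow>
      \<Omega> j k b = rot (\<Theta> j k b) ** refl_mat (real_of_int (det_cochain \<Omega> j k b))"
  shows "is_lift J U (abs_cochain \<Omega>) \<Theta>"
  unfolding is_lift_def
proof (intro ballI conjI)
  fix j k b assume *: "j \<in> J" "k \<in> J" "b \<in> U j \<inter> U k"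
  let ?s = "real_of_int (det_cochain \<Omega> j k b)"
  have "?s * ?s = 1" using of_int_det_cochain(2)[OF assms(1), of j k b] * by auto
  have "abs_cochain \<Omega> j k b = \<Omega> j k b ** refl_mat ?s"
    using of_int_det_cochain(1)[OF assms(1), of j k b] * by (simp add: abs_cochain_def)
  also have "\<Omega> j k b = rot (\<Theta> j k b) ** refl_mat ?s" using assms(3) * by auto
  also have "rot (\<Theta> j k b) ** refl_mat ?s ** refl_mat ?s = rot (\<Theta> j k b)"
    using \<open>?s * ?s = 1\<close> by (simp add: refl_mat_mult refl_mat_1 flip: matrix_mul_assoc)
  finally show "rot (\<Theta> j k b) = abs_cochain \<Omega> j k b" by simp
qed (use assms(2) in auto)

lemma continuous_on_det_cochain_mult:
  assumes "\<omega> \<in> Z1_sign J U" "j \<in> J" "k \<in> J" "T \<subseteq> U j \<inter> U k" "continuous_on T f"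
  shows "continuous_on T (\<lambda>b. real_of_int (\<omega> j k b) * f b)"
proof (rule continuous_on_mult[OF _ assms(5)])
  have "locally_constant_on T (\<omega> j k)"
    using assms by (intro locally_constant_on_subset[OF _ assms(4)]) (auto simp: Z1_sign_def)
  then have "locally_constant_on T (\<lambda>b. real_of_int (\<omega> j k b))"
    by (rule locally_constant_on_compose2[where h="\<lambda>x y. real_of_int x"]) (rule locally_constant_on_const)
  then show "continuous_on T (\<lambda>b. real_of_int (\<omega> j k b))" by (rule locally_constant_on_imp_continuous_on)
qed

lemma continuous_on_twisted_cobd1:
  assumes "\<omega> \<in> Z1_sign J U" and \<Theta>: "\<And>j k. j \<in> J \<Longrightarrow> k \<in> J \<Longrightarrow> continuous_on (U j \<inter> U k) (\<Theta> j k)"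
    and J: "j \<in> J" "k \<in> J" "l \<in> J"
  shows "continuous_on (U j \<inter> U k \<inter> U l) (\<lambda>b. twisted_cobd1 \<omega> \<Theta> j k l b :: real)"
  unfolding twisted_cobd1_def
  by (intro continuous_on_add continuous_on_diff continuous_on_det_cochain_mult[OF assms(1) J(1,2)]
      continuous_on_subset[OF \<Theta>]) (use J in auto)

text \<open>With \<open>\<Omega>\<close> written as rotation times reflection, \<open>\<Omega>\<^sub>j\<^sub>k\<Omega>\<^sub>k\<^sub>l\<close> is the rotation by
  \<open>\<Theta>\<^sub>j\<^sub>k + \<omega>\<^sub>j\<^sub>k\<Theta>\<^sub>k\<^sub>l\<close> times a reflection, so the defect controls the distance of the coboundary from
  the integers.\<close>

lemma is_lift_mult:
  assumes \<Omega>: "\<Omega> \<in> pointwise_Z1 J U 1" and \<Theta>: "is_lift J U (abs_cochain \<Omega>) \<Theta>"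
    and *: "j \<in> J" "k \<in> J" "l \<in> J" "b \<in> U j" "b \<in> U k" "b \<in> U l"
  shows "\<Omega> j k b ** \<Omega> k l b = rot (twisted_cobd1 (det_cochain \<Omega>) \<Theta> j k l b + \<Theta> j l b) **
    refl_mat (of_int (det_cochain \<Omega> j l b))"
proof -
  note D = pointwise_Z1D[OF \<Omega>]
  define s where "s j k = real_of_int (det_cochain \<Omega> j k b)" for j k
  have s: "s j k \<in> {1, -1}" using of_int_det_cochain(2)[OF D(1) *(1,2,4,5)] by (auto simp: s_def)
  have sjl: "s j k * s k l = s j l"
    using det_cochain_in_Z1_sign[OF \<Omega>] * unfolding s_def Z1_sign_def by (auto simp flip: of_int_mult)
  have "\<Omega> j k b ** \<Omega> k l b = rot (\<Theta> j k b) ** (refl_mat (s j k) ** rot (\<Theta> k l b)) ** refl_mat (s k l)"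
    using is_lift_form[OF D(1) \<Theta> *(1,2,4,5)] is_lift_form[OF D(1) \<Theta> *(2,3,5,6)]
    by (simp add: s_def matrix_mul_assoc)
  also have "\<dots> = (rot (\<Theta> j k b) ** rot (s j k * \<Theta> k l b)) ** (refl_mat (s j k) ** refl_mat (s k l))"
    by (subst refl_mat_rot[OF s]) (simp only: matrix_mul_assoc)
  also have "\<dots> = rot (\<Theta> j k b + s j k * \<Theta> k l b) ** refl_mat (s j l)"
    by (simp only: rot_add refl_mat_mult sjl)
  finally show ?thesis by (simp add: twisted_cobd1_def s_def algebra_simps)
qed

lemma twisted_cobd1_near_int:
  assumes \<Omega>: "\<Omega> \<in> pointwise_Z1 J U 1" and \<Theta>: "is_lift J U (abs_cochain \<Omega>) \<Theta>"
    and *: "j \<in> J" "k \<in> J" "l \<in> J" "b \<in> U j" "b \<in> U k" "b \<in> U l"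
  shows "\<bar>twisted_cobd1 (det_cochain \<Omega>) \<Theta> j k l b - of_int (round (twisted_cobd1 (det_cochain \<Omega>) \<Theta> j k l b))\<bar> < 1 / 8"
proof -
  note D = pointwise_Z1D[OF \<Omega>]
  let ?x = "twisted_cobd1 (det_cochain \<Omega>) \<Theta> j k l b" and ?s = "real_of_int (det_cochain \<Omega> j l b)"
  have s: "?s \<in> {1, -1}" using of_int_det_cochain(2)[OF D(1) *(1,3,4,6)] by auto
  have "norm (rot (?x + \<Theta> j l b) ** refl_mat ?s - rot (\<Theta> j l b) ** refl_mat ?s) < 1"
    using D(2)[OF *] is_lift_form[OF D(1) \<Theta> *(1,3,4,6)] is_lift_mult[OF \<Omega> \<Theta> *] by simp
  from near_int_of_norm_rot[OF s this] show ?thesis by simp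
qed

lemma round_twisted_cobd1_in_Z2:
  assumes \<Omega>: "\<Omega> \<in> pointwise_Z1 J U 1" and \<Theta>: "is_lift J U (abs_cochain \<Omega>) \<Theta>"
  shows "(\<lambda>j k l b. round (twisted_cobd1 (det_cochain \<Omega>) \<Theta> j k l b)) \<in> Z2_twisted J U (det_cochain \<Omega>)"
proof -
  define \<omega> where "\<omega> = det_cochain \<Omega>"
  define s where "s = (twisted_cobd1 \<omega> \<Theta> :: nat \<Rightarrow> nat \<Rightarrow> nat \<Rightarrow> 'a \<Rightarrow> real)"
  define e where "e j k l b = round (s j k l b)" for j k l b
  have \<omega>: "\<omega> \<in> Z1_sign J U" unfolding \<omega>_def by (rule det_cochain_in_Z1_sign[OF \<Omega>])
  have near: "\<bar>s j k l b - of_int (e j k l b)\<bar> < 1 / 8"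
    if "j \<in> J" "k \<in> J" "l \<in> J" "b \<in> U j" "b \<in> U k" "b \<in> U l" for j k l b
    unfolding e_def s_def \<omega>_def by (rule twisted_cobd1_near_int[OF \<Omega> \<Theta> that])
  have \<Theta>c: "continuous_on (U j \<inter> U k) (\<Theta> j k)" if "j \<in> J" "k \<in> J" for j k
    using \<Theta> that by (auto simp: is_lift_def)
  have "locally_constant_on (U j \<inter> U k \<inter> U l) (e j k l)" if J: "j \<in> J" "k \<in> J" "l \<in> J" for j k l
  proof (rule locally_constant_on_near_int)
    show "continuous_on (U j \<inter> U k \<inter> U l) (s j k l)"
      unfolding s_def by (intro continuous_on_twisted_cobd1 \<omega> \<Theta>c J)
    show "\<bar>s j k l b - of_int (e j k l b)\<bar> < 1 / 4" if "b \<in> U j \<inter> U k \<inter> U l" for b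
      using near[OF J, of b] that by auto
  qed
  moreover have "twisted_cobd2 \<omega> e j k l m b = 0"
    if *: "j \<in> J" "k \<in> J" "l \<in> J" "m \<in> J" "b \<in> U j" "b \<in> U k" "b \<in> U l" "b \<in> U m" for j k l m b
  proof -
    define w where "w = real_of_int (\<omega> j k b)"
    have "\<omega> j k b \<in> {1, -1}" using \<omega> * by (simp add: Z1_sign_def)
    then have w: "w = 1 \<or> w = -1" by (auto simp: w_def)
    have ww: "real_of_int (\<omega> j l b) = w * real_of_int (\<omega> k l b)"
      using \<omega> * unfolding w_def Z1_sign_def by (auto simp flip: of_int_mult)
    \<comment> \<open>The real coboundary of the coboundary vanishes because the signs form a
      cocycle. Replacing its four terms by their roundings costs less than 4/8, so the resulting
      integer has absolute value below 1.\<close>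
    have "w * s k l m b - s j l m b + s j k m b - s j k l b = 0"
      unfolding s_def twisted_cobd1_def w_def[symmetric] ww by (simp add: algebra_simps)
    moreover have "\<bar>w * s k l m b - w * of_int (e k l m b)\<bar> < 1/8"
      using near[of k l m b] * w by (auto simp: abs_minus_commute)
    moreover have "\<bar>s j l m b - of_int (e j l m b)\<bar> < 1/8" "\<bar>s j k m b - of_int (e j k m b)\<bar> < 1/8"
      "\<bar>s j k l b - of_int (e j k l b)\<bar> < 1/8"
      using near * by auto
    ultimately have "\<bar>w * of_int (e k l m b) - of_int (e j l m b) + of_int (e j k m b) - of_int (e j k l b)\<bar> < 1"
      unfolding abs_less_iff by linarith
    then have "\<bar>real_of_int (twisted_cobd2 \<omega> e j k l m b)\<bar> < 1"
      by (simp add: twisted_cobd2_def w_def)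
    then show ?thesis by linarith
  qed
  ultimately have "e \<in> Z2_twisted J U \<omega>" unfolding Z2_twisted_def C2_int_def by auto
  then show ?thesis unfolding e_def[abs_def] s_def \<omega>_def .
qed

lemma round_of_near_int: "\<bar>x - real_of_int n\<bar> < 1 / 2 \<Longrightarrow> round x = n"
  by (rule round_unique') (auto simp: abs_minus_commute)

text \<open>Both lifts give the same rotations, so they differ by integers, which are locally
  constant by continuity. Rounding commutes with adding the integer coboundary of this
  difference.\<close>

lemma lifts_cohomologous:
  assumes \<Omega>: "\<Omega> \<in> pointwise_Z1 J U 1"
    and \<Theta>: "is_lift J U (abs_cochain \<Omega>) \<Theta>" "is_lift J U (abs_cochain \<Omega>) \<Theta>'"
  shows "(\<lambda>j k l b. round (twisted_cobd1 (det_cochain \<Omega>) \<Theta> j k l b),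
          \<lambda>j k l b. round (twisted_cobd1 (det_cochain \<Omega>) \<Theta>' j k l b)) \<in> cohomologous J U (det_cochain \<Omega>)"
proof (rule cohomologousI)
  define \<beta> where "\<beta> j k b = round (\<Theta>' j k b - \<Theta> j k b)" for j k b
  have \<beta>: "\<Theta>' j k b - \<Theta> j k b = of_int (\<beta> j k b)" if "j \<in> J" "k \<in> J" "b \<in> U j" "b \<in> U k" for j k b
  proof -
    have "rot (\<Theta>' j k b) = rot (\<Theta> j k b)" using \<Theta> that by (simp add: is_lift_def)
    then have "\<Theta>' j k b - \<Theta> j k b \<in> \<int>" by (simp add: rot_eq_iff)
    then show ?thesis unfolding \<beta>_def by (elim Ints_cases) simp
  qed
  show "\<beta> \<in> C1_int J U" unfolding C1_int_def mem_Collect_eq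
  proof (intro ballI)
    fix j k assume J: "j \<in> J" "k \<in> J"
    have "continuous_on (U j \<inter> U k) (\<lambda>b. \<Theta>' j k b - \<Theta> j k b)"
      using \<Theta> J by (intro continuous_on_diff) (simp_all add: is_lift_def)
    then show "locally_constant_on (U j \<inter> U k) (\<beta> j k)"
      by (rule locally_constant_on_sign) (use \<beta> J in auto)
  qed
  fix j k l b assume *: "j \<in> J" "k \<in> J" "l \<in> J" "b \<in> U j" "b \<in> U k" "b \<in> U l"
  have eq: "\<Theta>' p q b = \<Theta> p q b + of_int (\<beta> p q b)" if "p \<in> {j,k,l}" "q \<in> {j,k,l}" for p q
    using \<beta>[of p q b] that * by auto
  let ?s = "\<lambda>\<Theta>. twisted_cobd1 (det_cochain \<Omega>) \<Theta> j k l b"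
  have "?s \<Theta>' = ?s \<Theta> + of_int (twisted_cobd1 (det_cochain \<Omega>) \<beta> j k l b)"
    unfolding twisted_cobd1_def by (simp add: eq algebra_simps)
  then have "round (?s \<Theta>') = round (?s \<Theta>) + twisted_cobd1 (det_cochain \<Omega>) \<beta> j k l b"
    using twisted_cobd1_near_int[OF \<Omega> \<Theta>(1) *] by (intro round_of_near_int) simp
  then show "round (?s \<Theta>') - round (?s \<Theta>) = twisted_cobd1 (det_cochain \<Omega>) \<beta> j k l b" by simp
qed (use round_twisted_cobd1_in_Z2[OF \<Omega>] \<Theta> in auto)

lemma is_Delta_unique:
  assumes "\<Omega> \<in> pointwise_Z1 J U 1" "is_lift J U (abs_cochain \<Omega>) \<Theta>"
  shows "is_Delta J U (det_cochain \<Omega>) (abs_cochain \<Omega>) c \<longleftrightarrow>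
    c = H2_class J U (det_cochain \<Omega>) (\<lambda>j k l b. round (twisted_cobd1 (det_cochain \<Omega>) \<Theta> j k l b))"
  using assms(2) H2_class_eq[OF lifts_cohomologous[OF assms(1)]] unfolding is_Delta_def by blast

lemma Delta_eq:
  assumes "\<Omega> \<in> pointwise_Z1 J U 1" "is_lift J U (abs_cochain \<Omega>) \<Theta>"
  shows "Delta J U (det_cochain \<Omega>) (abs_cochain \<Omega>) =
    H2_class J U (det_cochain \<Omega>) (\<lambda>j k l b. round (twisted_cobd1 (det_cochain \<Omega>) \<Theta> j k l b))"
  unfolding Delta_def is_Delta_unique[OF assms] by simp

definition Cl_elem :: "'a O2_cochain \<Rightarrow> ('a sign_cochain \<times> 'a int_cochain2 set) set" where
  "Cl_elem \<Omega> = coproduct_elem J U (det_cochain \<Omega>) (Delta J U (det_cochain \<Omega>) (abs_cochain \<Omega>))"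

text \<open>The rounding error below 1/8 and the allowed 3/8 add up to less than 1/2, so after
  multiplication by \<open>\<phi>\<close> the two integer cocycles agree as functions. Gauge
  invariance uses this with error zero, stability with three errors of 1/8.\<close>

lemma Cl_elem_eqI:
  assumes \<Omega>: "\<Omega> \<in> pointwise_Z1 J U 1" "\<Omega>' \<in> pointwise_Z1 J U 1"
    and \<Theta>: "is_lift J U (abs_cochain \<Omega>) \<Theta>" "is_lift J U (abs_cochain \<Omega>') \<Theta>'"
    and g: "sign_gauge J U \<phi> (det_cochain \<Omega>) (det_cochain \<Omega>')"
    and near: "\<And>j k l b. \<lbrakk>j \<in> J; k \<in> J; l \<in> J; b \<in> U j; b \<in> U k; b \<in> U l\<rbrakk> \<Longrightarrow>
      \<bar>twisted_cobd1 (det_cochain \<Omega>') \<Theta>' j k l b - \<phi> j b * twisted_cobd1 (det_cochain \<Omega>) \<Theta> j k l b\<bar> \<le> 3 / 8"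
  shows "Cl_elem \<Omega> = Cl_elem \<Omega>'"
proof -
  let ?e = "\<lambda>\<Omega> \<Theta> j k l b. round (twisted_cobd1 (det_cochain \<Omega>) \<Theta> j k l b)"
  have "(\<lambda>j k l b. \<phi> j b * ?e \<Omega> \<Theta> j k l b, ?e \<Omega>' \<Theta>') \<in> cohomologous J U (det_cochain \<Omega>')"
  proof (rule cohomologous_cong(2)[OF sign_gauge_Z2[OF g round_twisted_cobd1_in_Z2[OF \<Omega>(1) \<Theta>(1)]]])
    fix j k l b assume *: "j \<in> J" "k \<in> J" "l \<in> J" "b \<in> U j" "b \<in> U k" "b \<in> U l"
    let ?s = "twisted_cobd1 (det_cochain \<Omega>) \<Theta> j k l b" and ?s' = "twisted_cobd1 (det_cochain \<Omega>') \<Theta>' j k l b"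
    have "real_of_int (\<phi> j b) = 1 \<or> real_of_int (\<phi> j b) = -1"
    proof -
      have "\<phi> j b \<in> {1, -1}" using sign_gaugeD(1)[OF g] * by (simp add: C0_sign_def)
      then show ?thesis by auto
    qed
    then have "\<bar>real_of_int (\<phi> j b) * ?s - real_of_int (\<phi> j b) * real_of_int (round ?s)\<bar> < 1/8"
      using twisted_cobd1_near_int[OF \<Omega>(1) \<Theta>(1) *] by (auto simp: abs_minus_commute)
    with near[OF *] have "\<bar>?s' - real_of_int (\<phi> j b) * real_of_int (round ?s)\<bar> < 1/2"
      unfolding abs_le_iff abs_less_iff by linarith
    then show "\<phi> j b * round ?s = round ?s'" by (intro round_of_near_int[symmetric]) simp
  qed
  then show ?thesis
    unfolding Cl_elem_def Delta_eq[OF \<Omega>(1) \<Theta>(1)] Delta_eq[OF \<Omega>(2) \<Theta>(2)]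
    by (intro coproduct_elem_eqI[OF det_cochain_in_Z1_sign[OF \<Omega>(1)] det_cochain_in_Z1_sign[OF \<Omega>(2)] g
        round_twisted_cobd1_in_Z2[OF \<Omega>(1) \<Theta>(1)]])
qed

text \<open>For an exact cocycle the coboundary of a lift is already integral, so rounding changes
  nothing; an integer cochain \<open>e\<close> as in the definition agrees with the rounding on
  triple intersections.\<close>

lemma is_euler_class_iff_is_Delta:
  assumes \<Omega>: "\<Omega> \<in> Z1_exact J U"
  shows "is_euler_class J U \<Omega> c \<longleftrightarrow> is_Delta J U (det_cochain \<Omega>) (abs_cochain \<Omega>) c"
proof -
  let ?s = "\<lambda>\<Theta>. twisted_cobd1 (det_cochain \<Omega>) \<Theta>" and ?H = "H2_class J U (det_cochain \<Omega>)"
  have \<Omega>1: "\<Omega> \<in> pointwise_Z1 J U 1" using \<Omega> Z1_exact_subset_pointwise[of 1] by auto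
  have int: "?s \<Theta> j k l b = real_of_int (round (?s \<Theta> j k l b))"
    if \<Theta>: "is_lift J U (abs_cochain \<Omega>) \<Theta>" and *: "j \<in> J" "k \<in> J" "l \<in> J" "b \<in> U j" "b \<in> U k" "b \<in> U l"
    for \<Theta> j k l b
  proof -
    note D = pointwise_Z1D[OF \<Omega>1]
    let ?w = "real_of_int (det_cochain \<Omega> j l b)"
    have "?w * ?w = 1" using of_int_det_cochain(2)[OF D(1) *(1,3,4,6)] by auto
    have "rot (?s \<Theta> j k l b + \<Theta> j l b) ** refl_mat ?w = rot (\<Theta> j l b) ** refl_mat ?w"
      using \<Omega> * is_lift_form[OF D(1) \<Theta> *(1,3,4,6)] is_lift_mult[OF \<Omega>1 \<Theta> *] by (simp add: Z1_exact_def)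
    then have "rot (?s \<Theta> j k l b + \<Theta> j l b) ** refl_mat ?w ** refl_mat ?w = rot (\<Theta> j l b) ** refl_mat ?w ** refl_mat ?w"
      by simp
    then have "rot (?s \<Theta> j k l b + \<Theta> j l b) = rot (\<Theta> j l b)"
      using \<open>?w * ?w = 1\<close> by (simp add: refl_mat_mult refl_mat_1 flip: matrix_mul_assoc)
    then have "?s \<Theta> j k l b \<in> \<int>" by (simp add: rot_eq_iff)
    then show ?thesis by (elim Ints_cases) simp
  qed
  show ?thesis
  proof
    assume "is_euler_class J U \<Omega> c"
    then obtain \<Theta> e where \<Theta>: "is_lift J U (abs_cochain \<Omega>) \<Theta>"
      and e: "\<And>j k l b. \<lbrakk>j \<in> J; k \<in> J; l \<in> J; b \<in> U j; b \<in> U k; b \<in> U l\<rbrakk> \<Longrightarrow> real_of_int (e j k l b) = ?s \<Theta> j k l b"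
      and c: "c = ?H e" unfolding is_euler_class_def by blast
    have "round (?s \<Theta> j k l b) = e j k l b"
      if "j \<in> J" "k \<in> J" "l \<in> J" "b \<in> U j" "b \<in> U k" "b \<in> U l" for j k l b
      using e[OF that] by (metis round_of_int)
    then have "?H (\<lambda>j k l b. round (?s \<Theta> j k l b)) = c"
      unfolding c by (intro H2_class_eq cohomologous_cong(2) round_twisted_cobd1_in_Z2 \<Omega>1 \<Theta>)
    then show "is_Delta J U (det_cochain \<Omega>) (abs_cochain \<Omega>) c" unfolding is_Delta_def using \<Theta> by blast
  next
    assume "is_Delta J U (det_cochain \<Omega>) (abs_cochain \<Omega>) c"
    then obtain \<Theta> where \<Theta>: "is_lift J U (abs_cochain \<Omega>) \<Theta>"
      "c = ?H (\<lambda>j k l b. round (?s \<Theta> j k l b))" unfolding is_Delta_def by blast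
    then show "is_euler_class J U \<Omega> c" unfolding is_euler_class_def using int[OF \<Theta>(1)]
      by (intro exI[of _ \<Theta>] exI[of _ "\<lambda>j k l b. round (?s \<Theta> j k l b)"]) simp
  qed
qed

lemma euler_class_eq_Delta:
  assumes "\<Omega> \<in> Z1_exact J U"
  shows "euler_class J U \<Omega> = Delta J U (det_cochain \<Omega>) (abs_cochain \<Omega>)"
proof -
  have "is_euler_class J U \<Omega> = is_Delta J U (det_cochain \<Omega>) (abs_cochain \<Omega>)"
    by (intro ext is_euler_class_iff_is_Delta assms)
  then show ?thesis by (simp add: euler_class_def Delta_def)
qed

end

section \<open>Gauge equivalence of approximate cocycles\<close>

lemma matrix_inv_orthogonal:
  fixes A :: "real^'n^'n"
  assumes "orthogonal_matrix A"
  shows "matrix_inv A = transpose A"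
proof -
  have A: "A ** transpose A = mat 1" "transpose A ** A = mat 1"
    using assms by (auto simp: orthogonal_matrix_def)
  have inv: "A ** matrix_inv A = mat 1 \<and> matrix_inv A ** A = mat 1"
    unfolding matrix_inv_def by (rule someI[of "\<lambda>B. A ** B = mat 1 \<and> B ** A = mat 1" "transpose A"]) (simp add: A)
  have "matrix_inv A = matrix_inv A ** (A ** transpose A)" by (simp add: A)
  also have "\<dots> = matrix_inv A ** A ** transpose A" by (simp add: matrix_mul_assoc)
  also have "\<dots> = transpose A" using inv by simp
  finally show ?thesis .
qed

lemma orthogonal_matrix_transpose_iff:
  fixes A :: "real^'n^'n"
  shows "orthogonal_matrix (transpose A) \<longleftrightarrow> orthogonal_matrix A"
  by (auto simp: orthogonal_matrix_def)

lemma transpose_rot_refl: "transpose (rot a ** refl_mat s) = refl_mat s ** rot (- a)"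
  by (simp add: mat2_eq_iff mat2_mult_nth transpose_def)

context
  fixes J :: "nat set" and U :: "nat \<Rightarrow> 'a::topological_space set"
begin

text \<open>The gauge action with the inverse written as a transpose, so that inverse and composite
  gauge transformations are visibly continuous.\<close>

definition O2_gauge :: "(nat \<Rightarrow> 'a \<Rightarrow> mat2) \<Rightarrow> 'a O2_cochain \<Rightarrow> 'a O2_cochain \<Rightarrow> bool" where
  "O2_gauge \<phi> \<Omega> \<Omega>' \<longleftrightarrow>
     (\<forall>j\<in>J. continuous_on (U j) (\<phi> j) \<and> (\<forall>b\<in>U j. orthogonal_matrix (\<phi> j b))) \<and>
     (\<forall>j\<in>J. \<forall>k\<in>J. \<forall>b\<in>U j \<inter> U k. \<Omega>' j k b = \<phi> j b ** \<Omega> j k b ** transpose (\<phi> k b))"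

lemma gauge_rel_iff:
  "(\<Omega>, \<Omega>') \<in> gauge_rel J U \<epsilon> \<longleftrightarrow>
    \<Omega> \<in> Z1_approx J U \<epsilon> \<and> \<Omega>' \<in> Z1_approx J U \<epsilon> \<and> (\<exists>\<phi>. O2_gauge \<phi> \<Omega> \<Omega>')"
proof -
  have "(\<forall>j\<in>J. continuous_on (U j) (\<phi> j) \<and> (\<forall>b\<in>U j. orthogonal_matrix (\<phi> j b))) \<and>
        (\<forall>j\<in>J. \<forall>k\<in>J. \<forall>b\<in>U j \<inter> U k. \<Omega>' j k b = \<phi> j b ** \<Omega> j k b ** matrix_inv (\<phi> k b)) \<longleftrightarrow> O2_gauge \<phi> \<Omega> \<Omega>'" for \<phi>
    unfolding O2_gauge_def by (intro conj_cong refl ball_cong) (simp add: matrix_inv_orthogonal)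
  then show ?thesis unfolding gauge_rel_def by simp
qed

lemma equiv_gauge_rel: "equiv (Z1_approx J U \<epsilon>) (gauge_rel J U \<epsilon>)"
proof (rule equivI)
  show "gauge_rel J U \<epsilon> \<subseteq> Z1_approx J U \<epsilon> \<times> Z1_approx J U \<epsilon>" by (auto simp: gauge_rel_def)
  have "O2_gauge (\<lambda>_ _. mat 1) \<Omega> \<Omega>" for \<Omega> by (simp add: O2_gauge_def orthogonal_matrix_id)
  then show "refl_on (Z1_approx J U \<epsilon>) (gauge_rel J U \<epsilon>)"
    unfolding refl_on_def gauge_rel_iff by blast
  show "sym (gauge_rel J U \<epsilon>)"
  proof (rule symI)
    fix \<Omega> \<Omega>' assume "(\<Omega>, \<Omega>') \<in> gauge_rel J U \<epsilon>"
    then obtain \<phi> where Z: "\<Omega> \<in> Z1_approx J U \<epsilon>" "\<Omega>' \<in> Z1_approx J U \<epsilon>" and \<phi>: "O2_gauge \<phi> \<Omega> \<Omega>'"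
      unfolding gauge_rel_iff by blast
    have "O2_gauge (\<lambda>j b. transpose (\<phi> j b)) \<Omega>' \<Omega>"
      unfolding O2_gauge_def
    proof (intro conjI ballI)
      fix j assume j: "j \<in> J"
      then show "continuous_on (U j) (\<lambda>b. transpose (\<phi> j b))"
        using \<phi> unfolding O2_gauge_def by (intro continuous_on_transpose2) simp
      fix b assume b: "b \<in> U j"
      show "orthogonal_matrix (transpose (\<phi> j b))" using \<phi> j b by (simp add: O2_gauge_def orthogonal_matrix_transpose_iff)
    next
      fix j k b assume *: "j \<in> J" "k \<in> J" "b \<in> U j \<inter> U k"
      have T: "transpose (\<phi> j b) ** \<phi> j b = mat 1" "transpose (\<phi> k b) ** \<phi> k b = mat 1"
        using \<phi> * by (simp_all add: O2_gauge_def orthogonal_matrix)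
      have "transpose (\<phi> j b) ** \<Omega>' j k b ** transpose (transpose (\<phi> k b)) =
        (transpose (\<phi> j b) ** \<phi> j b) ** \<Omega> j k b ** (transpose (\<phi> k b) ** \<phi> k b)"
        using \<phi> * by (simp add: O2_gauge_def matrix_mul_assoc)
      then show "\<Omega> j k b = transpose (\<phi> j b) ** \<Omega>' j k b ** transpose (transpose (\<phi> k b))" by (simp add: T)
    qed
    with Z show "(\<Omega>', \<Omega>) \<in> gauge_rel J U \<epsilon>" unfolding gauge_rel_iff by blast
  qed
  show "trans (gauge_rel J U \<epsilon>)"
  proof (rule transI)
    fix \<Omega> \<Omega>' \<Omega>'' assume "(\<Omega>, \<Omega>') \<in> gauge_rel J U \<epsilon>" "(\<Omega>', \<Omega>'') \<in> gauge_rel J U \<epsilon>"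
    then obtain \<phi> \<psi> where Z: "\<Omega> \<in> Z1_approx J U \<epsilon>" "\<Omega>'' \<in> Z1_approx J U \<epsilon>"
      and \<phi>: "O2_gauge \<phi> \<Omega> \<Omega>'" and \<psi>: "O2_gauge \<psi> \<Omega>' \<Omega>''"
      unfolding gauge_rel_iff by blast
    have "O2_gauge (\<lambda>j b. \<psi> j b ** \<phi> j b) \<Omega> \<Omega>''"
      unfolding O2_gauge_def
    proof (intro conjI ballI)
      fix j assume j: "j \<in> J"
      then show "continuous_on (U j) (\<lambda>b. \<psi> j b ** \<phi> j b)"
        using \<phi> \<psi> unfolding O2_gauge_def by (intro continuous_on_mat2_mult) simp_all
      fix b assume b: "b \<in> U j"
      show "orthogonal_matrix (\<psi> j b ** \<phi> j b)"
        using \<phi> \<psi> j b by (intro orthogonal_matrix_mul) (simp_all add: O2_gauge_def)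
    next
      fix j k b assume *: "j \<in> J" "k \<in> J" "b \<in> U j \<inter> U k"
      then show "\<Omega>'' j k b = \<psi> j b ** \<phi> j b ** \<Omega> j k b ** transpose (\<psi> k b ** \<phi> k b)"
        using \<phi> \<psi> by (simp add: O2_gauge_def matrix_transpose_mul matrix_mul_assoc)
    qed
    with Z show "(\<Omega>, \<Omega>'') \<in> gauge_rel J U \<epsilon>" unfolding gauge_rel_iff by blast
  qed
qed

lemma orbit_in:
  assumes "\<Omega> \<in> Z1_approx J U \<epsilon>"
  shows "orbit J U \<epsilon> \<Omega> \<in> H1_approx J U \<epsilon>" "\<Omega> \<in> orbit J U \<epsilon> \<Omega>"
  using assms equiv_class_self[OF equiv_gauge_rel assms]
  unfolding orbit_def H1_approx_def by (auto intro: quotientI)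

lemma H1_approx_nonempty:
  assumes "x \<in> H1_approx J U \<epsilon>"
  obtains \<Omega> where "\<Omega> \<in> x"
  using assms in_quotient_imp_non_empty[OF equiv_gauge_rel] unfolding H1_approx_def by blast

context
  assumes good: "\<forall>j\<in>J. \<forall>k\<in>J. simply_connected (U j \<inter> U k) \<and> locally path_connected (U j \<inter> U k)"
begin

lemma lift_exists:
  assumes "\<Omega> \<in> C1_O2 J U"
  obtains \<Theta> where "is_lift J U (abs_cochain \<Omega>) \<Theta>"
proof -
  have "\<exists>\<theta>. continuous_on (U j \<inter> U k) \<theta> \<and> (\<forall>b\<in>U j \<inter> U k. rot (\<theta> b) = abs_cochain \<Omega> j k b)"
    if jk: "j \<in> J" "k \<in> J" for j k
  proof -
    have "continuous_on (U j \<inter> U k) (\<Omega> j k)" "\<And>b. b \<in> U j \<inter> U k \<Longrightarrow> orthogonal_matrix (\<Omega> j k b)"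
      using C1_O2D[OF assms jk] by auto
    then obtain \<theta> where "continuous_on (U j \<inter> U k) \<theta>"
      "\<And>b. b \<in> U j \<inter> U k \<Longrightarrow> rot (\<theta> b) = \<Omega> j k b ** refl_mat (det (\<Omega> j k b))"
      using simply_connected_rot_lift[of "U j \<inter> U k" "\<Omega> j k"] good jk by blast
    then show ?thesis unfolding abs_cochain_def by blast
  qed
  then obtain \<Theta> where "\<And>j k. j \<in> J \<Longrightarrow> k \<in> J \<Longrightarrow>
      continuous_on (U j \<inter> U k) (\<Theta> j k) \<and> (\<forall>b\<in>U j \<inter> U k. rot (\<Theta> j k b) = abs_cochain \<Omega> j k b)" by metis
  then have "is_lift J U (abs_cochain \<Omega>) \<Theta>" unfolding is_lift_def by blast
  then show thesis by (rule that)
qed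

text \<open>Write \<open>\<phi> j\<close> as the rotation by \<open>\<alpha> j\<close> times the
  reflection of sign \<open>\<sigma> j\<close>. Moving all reflections to the right gives the new
  matrix the angle \<open>\<Theta>'\<close>. In the coboundary of \<open>\<Theta>'\<close> the
  angles \<open>\<alpha>\<close> cancel, since they enter as the twisted coboundary of a 0-cochain,
  and \<open>\<sigma> j\<close> times the old coboundary remains.\<close>

lemma Cl_elem_gauge:
  assumes \<Omega>: "\<Omega> \<in> pointwise_Z1 J U 1" "\<Omega>' \<in> pointwise_Z1 J U 1" and \<phi>: "O2_gauge \<phi> \<Omega> \<Omega>'"
  shows "Cl_elem J U \<Omega> = Cl_elem J U \<Omega>'"
proof -
  note C = pointwise_Z1D(1)[OF \<Omega>(1)] pointwise_Z1D(1)[OF \<Omega>(2)]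
  note Z = det_cochain_in_Z1_sign[OF \<Omega>(1)] det_cochain_in_Z1_sign[OF \<Omega>(2)]
  obtain \<Theta> where \<Theta>: "is_lift J U (abs_cochain \<Omega>) \<Theta>" by (rule lift_exists[OF C(1)])
  \<comment> \<open>A 0-cochain is read as a 1-cochain independent of its second index; on the
    diagonal, where \<open>U j \<inter> U j\<close> is \<open>U j\<close>, the lemmas on 1-cochains
    then lift \<open>\<phi> j\<close>.\<close>
  have \<phi>C: "(\<lambda>j k. \<phi> j) \<in> C1_O2 J U"
    using \<phi> by (auto simp: C1_O2_def O2_gauge_def intro: continuous_on_subset)
  obtain \<alpha>' where \<alpha>': "is_lift J U (abs_cochain (\<lambda>j k. \<phi> j)) \<alpha>'" by (rule lift_exists[OF \<phi>C])
  define \<alpha> where "\<alpha> j = \<alpha>' j j" for j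
  define \<sigma> where "\<sigma> j b = det_cochain (\<lambda>j k. \<phi> j) j j b" for j b
  have \<phi>_form: "\<phi> j b = rot (\<alpha> j b) ** refl_mat (of_int (\<sigma> j b))" if "j \<in> J" "b \<in> U j" for j b
    using is_lift_form[OF \<phi>C \<alpha>', of j j b] that by (simp add: \<alpha>_def \<sigma>_def)
  have \<sigma>: "\<sigma> j b \<in> {1, -1}" if "j \<in> J" "b \<in> U j" for j b
    using of_int_det_cochain(2)[OF \<phi>C, of j j b] that by (simp add: \<sigma>_def)
  have \<sigma>_C0: "\<sigma> \<in> C0_sign J U"
    unfolding C0_sign_def mem_Collect_eq
  proof (intro ballI conjI)
    fix j assume "j \<in> J"
    then show "locally_constant_on (U j) (\<sigma> j)"
      using locally_constant_det_cochain[OF \<phi>C, of j j] by (simp add: \<sigma>_def[abs_def])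
  qed (rule \<sigma>)
  define \<Theta>' where "\<Theta>' j k b = \<alpha> j b + of_int (\<sigma> j b) * \<Theta> j k b - of_int (det_cochain \<Omega>' j k b) * \<alpha> k b" for j k b
  have "det_cochain \<Omega>' j k b = \<sigma> j b * det_cochain \<Omega> j k b * \<sigma> k b \<and>
    \<Omega>' j k b = rot (\<Theta>' j k b) ** refl_mat (of_int (det_cochain \<Omega>' j k b))"
    if *: "j \<in> J" "k \<in> J" "b \<in> U j" "b \<in> U k" for j k b
  proof -
    define s t w w' where "s = real_of_int (\<sigma> j b)" and "t = real_of_int (\<sigma> k b)"
      and "w = real_of_int (det_cochain \<Omega> j k b)" and "w' = real_of_int (det_cochain \<Omega>' j k b)"
    have st: "s \<in> {1, -1}" "t \<in> {1, -1}" "w \<in> {1, -1}"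
      using \<sigma>[of j b] \<sigma>[of k b] of_int_det_cochain(2)[OF C(1) *] * by (auto simp: s_def t_def w_def)
    then have swt: "s * w * t \<in> {1, -1}" by auto
    have "\<Omega>' j k b = \<phi> j b ** \<Omega> j k b ** transpose (\<phi> k b)" using \<phi> * by (simp add: O2_gauge_def)
    also have "\<dots> = (rot (\<alpha> j b) ** refl_mat s) ** (rot (\<Theta> j k b) ** refl_mat w) ** (refl_mat t ** rot (- \<alpha> k b))"
      using \<phi>_form[of j b] \<phi>_form[of k b] * is_lift_form[OF C(1) \<Theta> *]
      by (simp add: s_def t_def w_def transpose_rot_refl)
    also have "\<dots> = rot (\<alpha> j b) ** (refl_mat s ** rot (\<Theta> j k b)) ** refl_mat (w * t) ** rot (- \<alpha> k b)"
      by (simp only: matrix_mul_assoc refl_mat_mult[symmetric])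
    also have "\<dots> = (rot (\<alpha> j b) ** rot (s * \<Theta> j k b)) ** (refl_mat (s * w * t) ** rot (- \<alpha> k b))"
      by (simp only: refl_mat_rot[OF st(1)] matrix_mul_assoc refl_mat_mult[symmetric])
    also have "\<dots> = (rot (\<alpha> j b + s * \<Theta> j k b) ** rot (s * w * t * - \<alpha> k b)) ** refl_mat (s * w * t)"
      by (simp only: rot_add refl_mat_rot[OF swt] matrix_mul_assoc)
    also have "\<dots> = rot (\<alpha> j b + s * \<Theta> j k b - s * w * t * \<alpha> k b) ** refl_mat (s * w * t)"
      by (simp add: rot_add)
    finally have eq: "\<Omega>' j k b = rot (\<alpha> j b + s * \<Theta> j k b - s * w * t * \<alpha> k b) ** refl_mat (s * w * t)" .
    then have "w' = s * w * t"
      using of_int_det_cochain(1)[OF C(2) *] by (simp add: w'_def det_rot_refl)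
    then have dd: "real_of_int (det_cochain \<Omega>' j k b) = s * w * t" by (simp add: w'_def)
    then have "real_of_int (det_cochain \<Omega>' j k b) = real_of_int (\<sigma> j b * det_cochain \<Omega> j k b * \<sigma> k b)"
      by (simp add: w_def s_def t_def)
    then have "det_cochain \<Omega>' j k b = \<sigma> j b * det_cochain \<Omega> j k b * \<sigma> k b" unfolding of_int_eq_iff .
    moreover have "\<Theta>' j k b = \<alpha> j b + s * \<Theta> j k b - s * w * t * \<alpha> k b"
      unfolding \<Theta>'_def dd by (simp add: s_def)
    then have "\<Omega>' j k b = rot (\<Theta>' j k b) ** refl_mat (of_int (det_cochain \<Omega>' j k b))"
      unfolding dd by (simp only: eq)
    ultimately show ?thesis ..
  qed
  note form = this[THEN conjunct1] this[THEN conjunct2]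
  have g: "sign_gauge J U \<sigma> (det_cochain \<Omega>) (det_cochain \<Omega>')"
    unfolding sign_gauge_def using \<sigma>_C0 form(1) by blast
  have "is_lift J U (abs_cochain \<Omega>') \<Theta>'"
  proof (rule is_liftI[OF C(2) _ form(2)])
    fix j k assume jk: "j \<in> J" "k \<in> J"
    have \<alpha>c: "continuous_on (U j) (\<alpha> j)" if "j \<in> J" for j
    proof -
      have "continuous_on (U j \<inter> U j) (\<alpha>' j j)" using \<alpha>' that unfolding is_lift_def by blast
      then show ?thesis by (simp add: \<alpha>_def[abs_def])
    qed
    have "locally_constant_on (U j) (\<lambda>b. real_of_int (\<sigma> j b))"
      by (rule locally_constant_on_compose2[where h="\<lambda>x y. real_of_int x" and g="\<lambda>_. ()"])
        (use C0_signD(1)[OF \<sigma>_C0 jk(1)] in auto)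
    then have \<sigma>c: "continuous_on (U j) (\<lambda>b. real_of_int (\<sigma> j b))" by (rule locally_constant_on_imp_continuous_on)
    show "continuous_on (U j \<inter> U k) (\<Theta>' j k)"
      unfolding \<Theta>'_def
    proof (intro continuous_on_diff continuous_on_add continuous_on_mult)
      show "continuous_on (U j \<inter> U k) (\<alpha> j)" using \<alpha>c[OF jk(1)] by (rule continuous_on_subset) auto
      show "continuous_on (U j \<inter> U k) (\<lambda>b. real_of_int (\<sigma> j b))" using \<sigma>c by (rule continuous_on_subset) auto
      show "continuous_on (U j \<inter> U k) (\<Theta> j k)" using \<Theta> jk unfolding is_lift_def by blast
      show "continuous_on (U j \<inter> U k) (\<lambda>b. real_of_int (det_cochain \<Omega>' j k b))"
        using continuous_on_det_cochain_mult[OF Z(2) jk order_refl continuous_on_const, of 1] by simp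
      show "continuous_on (U j \<inter> U k) (\<alpha> k)" using \<alpha>c[OF jk(2)] by (rule continuous_on_subset) auto
    qed
  qed
  then show ?thesis
  proof (rule Cl_elem_eqI[OF \<Omega> \<Theta> _ g])
    fix j k l b assume *: "j \<in> J" "k \<in> J" "l \<in> J" "b \<in> U j" "b \<in> U k" "b \<in> U l"
    define w where "w p q = real_of_int (det_cochain \<Omega>' p q b)" for p q
    have 1: "w j k * w k l = w j l"
      using Z(2) * unfolding w_def Z1_sign_def by (auto simp flip: of_int_mult)
    \<comment> \<open>The gauge relation of the signs, in the form that pulls
      \<open>\<sigma> j\<close> out of the term with \<open>\<Theta> k l\<close>.\<close>
    have "det_cochain \<Omega>' j k b * \<sigma> k b = \<sigma> j b * det_cochain \<Omega> j k b"
      using form(1)[OF *(1,2,4,5)] C0_signD(2,3)[OF \<sigma>_C0 *(2,5)] by (simp add: mult_ac)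
    then have 2: "w j k * of_int (\<sigma> k b) = of_int (\<sigma> j b) * of_int (det_cochain \<Omega> j k b)"
      unfolding w_def of_int_mult[symmetric] of_int_eq_iff .
    have "twisted_cobd1 (det_cochain \<Omega>') \<Theta>' j k l b =
      (w j k * of_int (\<sigma> k b)) * \<Theta> k l b - of_int (\<sigma> j b) * \<Theta> j l b + of_int (\<sigma> j b) * \<Theta> j k b
        - (w j k * w k l) * \<alpha> l b + w j l * \<alpha> l b"
      by (simp add: twisted_cobd1_def \<Theta>'_def w_def algebra_simps)
    also have "\<dots> = \<sigma> j b * twisted_cobd1 (det_cochain \<Omega>) \<Theta> j k l b"
      unfolding 1 2 by (simp add: twisted_cobd1_def algebra_simps)
    finally show "\<bar>twisted_cobd1 (det_cochain \<Omega>') \<Theta>' j k l b - \<sigma> j b * twisted_cobd1 (det_cochain \<Omega>) \<Theta> j k l b\<bar> \<le> 3 / 8"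
      by simp
  qed
qed

lemma Cl_elem_close:
  assumes \<Omega>: "\<Omega> \<in> pointwise_Z1 J U 1" "\<Omega>' \<in> pointwise_Z1 J U 1"
    and close: "\<And>j k b. \<lbrakk>j \<in> J; k \<in> J; b \<in> U j; b \<in> U k\<rbrakk> \<Longrightarrow> norm (\<Omega> j k b - \<Omega>' j k b) < 1"
  shows "Cl_elem J U \<Omega> = Cl_elem J U \<Omega>'"
proof -
  note C = pointwise_Z1D(1)[OF \<Omega>(1)] pointwise_Z1D(1)[OF \<Omega>(2)]
  obtain \<Theta> where \<Theta>: "is_lift J U (abs_cochain \<Omega>) \<Theta>" by (rule lift_exists[OF C(1)])
  obtain T where T: "is_lift J U (abs_cochain \<Omega>') T" by (rule lift_exists[OF C(2)])
  have w: "det_cochain \<Omega>' j k b = det_cochain \<Omega> j k b" if *: "j \<in> J" "k \<in> J" "b \<in> U j" "b \<in> U k" for j k b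
  proof -
    have "det (\<Omega> j k b) = det (\<Omega>' j k b)"
      using norm_diff_det_ne[OF C1_O2D(2)[OF C(1) *] C1_O2D(2)[OF C(2) *]] close[OF *] by fastforce
    then show ?thesis by (simp add: det_cochain_def)
  qed
  \<comment> \<open>\<open>T\<close> is an arbitrary lift; subtracting the integers nearest to
    \<open>T - \<Theta>\<close> brings it within 1/8 of \<open>\<Theta>\<close>. These integers are
    locally constant, so the shifted lift is still continuous.\<close>
  define n where "n j k b = round (T j k b - \<Theta> j k b)" for j k b
  define \<Theta>' where "\<Theta>' j k b = T j k b - of_int (n j k b)" for j k b
  have near: "\<bar>(T j k b - \<Theta> j k b) - of_int (n j k b)\<bar> < 1 / 8"
    if *: "j \<in> J" "k \<in> J" "b \<in> U j" "b \<in> U k" for j k b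
    unfolding n_def
  proof (rule near_int_of_norm_rot)
    let ?s = "real_of_int (det_cochain \<Omega> j k b)"
    show "?s \<in> {1, -1}" using of_int_det_cochain(2)[OF C(1) *] by auto
    have "\<Omega> j k b = rot (\<Theta> j k b) ** refl_mat ?s" by (rule is_lift_form[OF C(1) \<Theta> *])
    moreover have "\<Omega>' j k b = rot (T j k b) ** refl_mat ?s" using is_lift_form[OF C(2) T *] w[OF *] by simp
    ultimately show "norm (rot (T j k b) ** refl_mat ?s - rot (\<Theta> j k b) ** refl_mat ?s) < 1"
      using close[OF *] by (simp add: norm_minus_commute)
  qed
  have "is_lift J U (abs_cochain \<Omega>') \<Theta>'"
    unfolding is_lift_def
  proof (intro ballI conjI)
    fix j k assume jk: "j \<in> J" "k \<in> J"
    have c: "continuous_on (U j \<inter> U k) (T j k)" "continuous_on (U j \<inter> U k) (\<Theta> j k)"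
      using \<Theta> T jk unfolding is_lift_def by blast+
    have "locally_constant_on (U j \<inter> U k) (n j k)"
    proof (rule locally_constant_on_near_int)
      show "continuous_on (U j \<inter> U k) (\<lambda>b. T j k b - \<Theta> j k b)" using c by (intro continuous_on_diff)
      show "\<bar>T j k b - \<Theta> j k b - of_int (n j k b)\<bar> < 1 / 4" if "b \<in> U j \<inter> U k" for b
        using near[OF jk, of b] that by auto
    qed
    then have "locally_constant_on (U j \<inter> U k) (\<lambda>b. real_of_int (n j k b))"
      by (rule locally_constant_on_compose2[where h="\<lambda>x y. real_of_int x" and g="\<lambda>_. ()"]) auto
    then have "continuous_on (U j \<inter> U k) (\<lambda>b. real_of_int (n j k b))" by (rule locally_constant_on_imp_continuous_on)
    with c show "continuous_on (U j \<inter> U k) (\<Theta>' j k)" unfolding \<Theta>'_def by (intro continuous_on_diff)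
    fix b assume "b \<in> U j \<inter> U k"
    then have "rot (T j k b) = abs_cochain \<Omega>' j k b" using T jk by (simp add: is_lift_def)
    moreover have "rot (\<Theta>' j k b) = rot (T j k b)" unfolding rot_eq_iff \<Theta>'_def by simp
    ultimately show "rot (\<Theta>' j k b) = abs_cochain \<Omega>' j k b" by simp
  qed
  moreover have "sign_gauge J U (\<lambda>_ _. 1) (det_cochain \<Omega>) (det_cochain \<Omega>')"
    by (rule sign_gauge_refl) (rule w)
  ultimately show ?thesis
  proof (rule Cl_elem_eqI[OF \<Omega> \<Theta>])
    fix j k l b assume *: "j \<in> J" "k \<in> J" "l \<in> J" "b \<in> U j" "b \<in> U k" "b \<in> U l"
    define d where "d p q = \<Theta>' p q b - \<Theta> p q b" for p q
    have d: "\<bar>d k l\<bar> < 1/8" "\<bar>d j l\<bar> < 1/8" "\<bar>d j k\<bar> < 1/8"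
      using near[of k l b] near[of j l b] near[of j k b] * by (auto simp: d_def \<Theta>'_def algebra_simps)
    have s: "real_of_int (det_cochain \<Omega> j k b) \<in> {1, -1}" using of_int_det_cochain(2)[OF C(1) *(1,2,4,5)] by auto
    have "twisted_cobd1 (det_cochain \<Omega>') \<Theta>' j k l b - real_of_int 1 * twisted_cobd1 (det_cochain \<Omega>) \<Theta> j k l b =
      of_int (det_cochain \<Omega> j k b) * d k l - d j l + d j k"
      using w[OF *(1,2,4,5)] by (simp add: twisted_cobd1_def d_def algebra_simps)
    also have "\<bar>\<dots>\<bar> \<le> \<bar>of_int (det_cochain \<Omega> j k b) * d k l\<bar> + \<bar>d j l\<bar> + \<bar>d j k\<bar>"
      by linarith
    also have "\<bar>of_int (det_cochain \<Omega> j k b) * d k l\<bar> = \<bar>d k l\<bar>" using s by auto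
    finally show "\<bar>twisted_cobd1 (det_cochain \<Omega>') \<Theta>' j k l b - real_of_int 1 * twisted_cobd1 (det_cochain \<Omega>) \<Theta> j k l b\<bar> \<le> 3 / 8"
      using d by linarith
  qed
qed

section \<open>The map on orbits and its stability\<close>

lemma is_Delta_ex1:
  assumes "\<Omega> \<in> pointwise_Z1 J U 1"
  shows "\<exists>!c. is_Delta J U (det_cochain \<Omega>) (abs_cochain \<Omega>) c"
    "Delta J U (det_cochain \<Omega>) (abs_cochain \<Omega>) \<in> H2_twisted J U (det_cochain \<Omega>)"
proof -
  obtain \<Theta> where \<Theta>: "is_lift J U (abs_cochain \<Omega>) \<Theta>" by (rule lift_exists[OF pointwise_Z1D(1)[OF assms]])
  show "\<exists>!c. is_Delta J U (det_cochain \<Omega>) (abs_cochain \<Omega>) c" unfolding is_Delta_unique[OF assms \<Theta>] by simp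
  show "Delta J U (det_cochain \<Omega>) (abs_cochain \<Omega>) \<in> H2_twisted J U (det_cochain \<Omega>)"
    unfolding Delta_eq[OF assms \<Theta>] by (intro H2_class_in round_twisted_cobd1_in_Z2 assms \<Theta>)
qed

text \<open>The representative is arbitrary; gauge invariance gives every other one the same
  value.\<close>

definition Cl_map :: "'a O2_cochain set \<Rightarrow> ('a sign_cochain \<times> 'a int_cochain2 set) set" where
  "Cl_map x = Cl_elem J U (SOME \<Omega>. \<Omega> \<in> x)"

lemma Cl_map_eq:
  assumes \<epsilon>: "\<epsilon> \<le> 1" and x: "x \<in> H1_approx J U \<epsilon>" "\<Omega> \<in> x"
  shows "Cl_map x = Cl_elem J U \<Omega>" "\<Omega> \<in> pointwise_Z1 J U 1"
proof -
  note E = equiv_gauge_rel[of \<epsilon>]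
  have sub: "Z1_approx J U \<epsilon> \<subseteq> pointwise_Z1 J U 1"
    using Z1_approx_subset_pointwise[of J U \<epsilon>] pointwise_Z1_mono[OF \<epsilon>, of J U] by blast
  have "(SOME \<Omega>. \<Omega> \<in> x) \<in> x" using x(2) by (rule someI[of "\<lambda>\<Omega>. \<Omega> \<in> x"])
  then have "(\<Omega>, SOME \<Omega>. \<Omega> \<in> x) \<in> gauge_rel J U \<epsilon>"
    using quotient_eq_iff[OF E _ _ x(2)] x unfolding H1_approx_def by blast
  then obtain \<phi> where "\<Omega> \<in> pointwise_Z1 J U 1" "(SOME \<Omega>. \<Omega> \<in> x) \<in> pointwise_Z1 J U 1"
    "O2_gauge \<phi> \<Omega> (SOME \<Omega>. \<Omega> \<in> x)" unfolding gauge_rel_iff using sub by blast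
  then show "Cl_map x = Cl_elem J U \<Omega>" "\<Omega> \<in> pointwise_Z1 J U 1"
    using Cl_elem_gauge unfolding Cl_map_def by auto
qed

lemma Cl_map_stable:
  assumes \<epsilon>: "\<epsilon> \<le> 1" and x: "x \<in> H1_approx J U \<epsilon>" and y: "y \<in> H1_approx J U \<epsilon>" and d: "dH J U x y < 1"
  shows "Cl_map x = Cl_map y"
proof -
  \<comment> \<open>Orbits are nonempty, so an infimum below 1 is witnessed by a pair of
    representatives at distance below 1.\<close>
  obtain a b where "a \<in> x" "b \<in> y" using H1_approx_nonempty x y by metis
  then have "{dZ J U \<Omega> \<Omega>' | \<Omega> \<Omega>'. \<Omega> \<in> x \<and> \<Omega>' \<in> y} \<noteq> {}" by blast
  from cInf_lessD[OF this] d obtain \<Omega> \<Omega>' where \<Omega>: "\<Omega> \<in> x" "\<Omega>' \<in> y" "dZ J U \<Omega> \<Omega>' < 1"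
    unfolding dH_def by blast
  note P = Cl_map_eq(2)[OF \<epsilon> x \<Omega>(1)] Cl_map_eq(2)[OF \<epsilon> y \<Omega>(2)]
  note C = pointwise_Z1D(1)[OF P(1)] pointwise_Z1D(1)[OF P(2)]
  let ?S = "{norm (\<Omega> j k b - \<Omega>' j k b) | j k b. j \<in> J \<and> k \<in> J \<and> b \<in> U j \<inter> U k}"
  have "bdd_above ?S"
  proof (rule bdd_aboveI[of _ 4])
    fix r assume "r \<in> ?S"
    then obtain j k b where *: "j \<in> J" "k \<in> J" "b \<in> U j" "b \<in> U k" and r: "r = norm (\<Omega> j k b - \<Omega>' j k b)" by auto
    have "r \<le> norm (\<Omega> j k b) + norm (\<Omega>' j k b)" unfolding r by (rule norm_triangle_ineq4)
    also have "\<dots> \<le> 2 + 2" by (intro add_mono norm_orthogonal_mat2 C1_O2D(2)[OF C(1) *] C1_O2D(2)[OF C(2) *])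
    finally show "r \<le> 4" by simp
  qed
  then have "r < 1" if "r \<in> ?S" for r using cSup_upper[OF that] \<Omega>(3) by (simp add: dZ_def)
  then have "norm (\<Omega> j k b - \<Omega>' j k b) < 1" if "j \<in> J" "k \<in> J" "b \<in> U j" "b \<in> U k" for j k b
    using that by blast
  then show ?thesis
    using Cl_elem_close[OF P] Cl_map_eq(1)[OF \<epsilon> x \<Omega>(1)] Cl_map_eq(1)[OF \<epsilon> y \<Omega>(2)] by simp
qed

end

end

section \<open>Polar decomposition of 2x2 matrices\<close>

lemma norm_mat2_vec_le:
  fixes A :: mat2
  shows "norm (A *v x) \<le> norm A * norm x"
proof (rule power2_le_imp_le)
  \<comment> \<open>By Lagrange's identity the right side exceeds the left by the square of
    \<open>a * y - b * x\<close>.\<close>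
  have CS: "(a * x + b * y)\<^sup>2 \<le> (a\<^sup>2 + b\<^sup>2) * (x\<^sup>2 + y\<^sup>2)" for a b x y :: real
    using zero_le_power2[of "a * y - b * x"] by (simp add: power2_eq_square algebra_simps)
  have "(norm (A *v x))\<^sup>2 \<le> ((A$1$1)\<^sup>2 + (A$1$2)\<^sup>2) * ((x$1)\<^sup>2 + (x$2)\<^sup>2) + ((A$2$1)\<^sup>2 + (A$2$2)\<^sup>2) * ((x$1)\<^sup>2 + (x$2)\<^sup>2)"
    unfolding power2_norm_vec2 mat2_vec_nth by (intro add_mono CS)
  also have "\<dots> = (norm A * norm x)\<^sup>2"
    by (simp add: power_mult_distrib power2_norm_mat2 power2_norm_vec2 algebra_simps)
  finally show "(norm (A *v x))\<^sup>2 \<le> (norm A * norm x)\<^sup>2" .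
qed simp

lemma inner_vec2: "x \<bullet> y = x$1 * y$1 + x$2 * y$2" for x y :: "real^2"
  by (simp add: inner_vec_def sum_2)

lemma inner_mat2_transpose: "x \<bullet> (A *v y) = (transpose A *v x) \<bullet> y" for A :: mat2
  by (simp add: inner_vec2 mat2_vec_nth transpose_def algebra_simps)

lemma inner_axis_mat2: "axis s 1 \<bullet> (A *v axis t 1) = A $ s $ t" for A :: mat2
  by (simp add: inner_axis' matrix_vector_mult_basis column_def)

lemma inner_gram_mat2: "x \<bullet> ((transpose A ** B) *v y) = (A *v x) \<bullet> (B *v y)" for A B :: mat2
  by (simp only: inner_mat2_transpose matrix_vector_mul_assoc[symmetric] transpose_transpose)

lemma transpose_eq_self_nth:
  fixes H :: mat2
  assumes "transpose H = H"
  shows "H$2$1 = H$1$2"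
  using arg_cong[OF assms, of "\<lambda>A. A$1$2"] by (simp add: transpose_def)

lemma quad_form_mat2:
  fixes H :: mat2
  assumes "transpose H = H"
  shows "x \<bullet> (H *v x) = H$1$1 * (x$1)\<^sup>2 + 2 * H$1$2 * x$1 * x$2 + H$2$2 * (x$2)\<^sup>2"
proof -
  have "H$2$1 = H$1$2" using assms by (rule transpose_eq_self_nth)
  then show ?thesis by (simp add: inner_vec2 mat2_vec_nth power2_eq_square algebra_simps)
qed

lemma psd_mat2:
  fixes H :: mat2
  assumes H: "transpose H = H" "\<And>x. 0 \<le> x \<bullet> (H *v x)"
  shows "0 \<le> H$1$1" "0 \<le> H$2$2" "0 \<le> det H"
proof -
  note q = quad_form_mat2[OF H(1)]
  have Q: "0 \<le> H$1$1 * a\<^sup>2 + 2 * H$1$2 * a * b + H$2$2 * b\<^sup>2" for a b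
    using H(2)[of "vector [a, b]"] unfolding q by (simp only: vector_2)
  show h1: "0 \<le> H$1$1" using Q[of 1 0] by simp
  show "0 \<le> H$2$2" using Q[of 0 1] by simp
  have sym: "H$2$1 = H$1$2" using H(1) by (rule transpose_eq_self_nth)
  show "0 \<le> det H"
  proof (cases "H$1$1 = 0")
    case True
    have "H$1$2 = 0"
    proof (rule ccontr)
      assume nz: "H$1$2 \<noteq> 0"
      \<comment> \<open>With \<open>H$1$1 = 0\<close> the form at \<open>(a, 1)\<close> is affine in
        \<open>a\<close>; this \<open>a\<close> gives it the value -1.\<close>
      have "0 \<le> 2 * H$1$2 * (- (H$2$2 + 1) / (2 * H$1$2)) * 1 + H$2$2"
        using Q[of "- (H$2$2 + 1) / (2 * H$1$2)" 1] True by simp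
      also have "\<dots> = -1" using nz by simp
      finally show False by simp
    qed
    then show ?thesis by (simp add: det_2 True sym)
  next
    case False
    \<comment> \<open>At \<open>(- H$1$2, H$1$1)\<close> the form takes the value
      \<open>H$1$1 * det H\<close>.\<close>
    have "0 \<le> H$1$1 * det H"
      using Q[of "- H$1$2" "H$1$1"] by (simp add: det_2 sym power2_eq_square algebra_simps)
    then show ?thesis using False h1 by (simp add: zero_le_mult_iff)
  qed
qed

text \<open>The square root of a positive definite matrix in closed form. By Cayley-Hamilton a root
  \<open>H\<close> with trace \<open>t\<close> and determinant \<open>d\<close> satisfies
  \<open>H^2 = t H - d\<close>. Here \<open>d = sqrt (det G)\<close> and
  \<open>t^2 = trace G + 2 d\<close>, so \<open>H = (G + d) / t\<close>.\<close>

definition psqrt :: "mat2 \<Rightarrow> mat2" where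
  "psqrt G = (1 / sqrt (trace G + 2 * sqrt (det G))) *\<^sub>R (G + mat (sqrt (det G)))"

text \<open>The inverse of \<open>psqrt G\<close>, by the Cayley-Hamilton theorem.\<close>

definition psqrt_inv :: "mat2 \<Rightarrow> mat2" where
  "psqrt_inv G = (1 / sqrt (det G)) *\<^sub>R (mat (sqrt (trace G + 2 * sqrt (det G))) - psqrt G)"

lemma mat_nth2:
  "(mat c :: mat2) $ 1 $ 1 = c" "(mat c :: mat2) $ 1 $ 2 = 0"
  "(mat c :: mat2) $ 2 $ 1 = 0" "(mat c :: mat2) $ 2 $ 2 = c"
  by (simp_all add: mat_def)

lemma trace_2: "trace A = A$1$1 + A$2$2" for A :: mat2
  by (simp add: trace_def sum_2)

text \<open>\<open>d\<close> and \<open>t\<close> turn out to be the determinant and the trace of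
  the square root of \<open>G\<close>.\<close>

context
  fixes C G :: mat2 and d t :: real
  assumes C: "det C \<noteq> 0" and G: "G = transpose C ** C"
    and d: "d = sqrt (det G)" and t: "t = sqrt (trace G + 2 * d)"
begin

lemma gram_sym: "transpose G = G" "G$2$1 = G$1$2"
  unfolding G by (simp_all add: mat2_eq_iff mat2_mult_nth transpose_def)

lemma gram_quad: "x \<bullet> (G *v x) = (norm (C *v x))\<^sup>2"
  unfolding G power2_norm_eq_inner by (rule inner_gram_mat2)

lemma gram_det: "d > 0" "d\<^sup>2 = G$1$1 * G$2$2 - G$1$2 * G$1$2"
proof -
  have "det G = (det C)\<^sup>2" by (simp add: G det_mul det_transpose power2_eq_square)
  with C show "d > 0" by (simp add: d)
  from \<open>det G = _\<close> have "0 \<le> det G" by simp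
  then show "d\<^sup>2 = G$1$1 * G$2$2 - G$1$2 * G$1$2" by (simp add: d det_2 gram_sym)
qed

lemma gram_trace: "t > 0" "t\<^sup>2 = G$1$1 + G$2$2 + 2 * d" "0 \<le> G$1$1" "0 \<le> G$2$2"
proof -
  show g: "0 \<le> G$1$1" "0 \<le> G$2$2" using psd_mat2(1,2)[OF gram_sym(1)] gram_quad by auto
  then show "t > 0" "t\<^sup>2 = G$1$1 + G$2$2 + 2 * d" using gram_det(1) by (simp_all add: t trace_2)
qed

lemma psqrt_nth:
  "t * psqrt G $ 1 $ 1 = G$1$1 + d" "t * psqrt G $ 1 $ 2 = G$1$2"
  "t * psqrt G $ 2 $ 1 = G$1$2" "t * psqrt G $ 2 $ 2 = G$2$2 + d"
  using gram_trace(1) by (simp_all add: psqrt_def mat_nth2 gram_sym(2) flip: d t)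

lemma psqrt_sym: "transpose (psqrt G) = psqrt G"
  by (simp add: psqrt_def mat2_eq_iff transpose_def mat_nth2 gram_sym(2))

text \<open>This is \<open>t H = G + d\<close> as an identity of quadratic forms; positivity of the
  root and its lower bound are read off from it.\<close>

lemma psqrt_quad: "t * (x \<bullet> (psqrt G *v x)) = (norm (C *v x))\<^sup>2 + d * (norm x)\<^sup>2"
proof -
  have "t * (x \<bullet> (psqrt G *v x)) = (t * psqrt G $ 1 $ 1) * (x$1)\<^sup>2 + 2 * (t * psqrt G $ 1 $ 2) * x$1 * x$2
      + (t * psqrt G $ 2 $ 2) * (x$2)\<^sup>2"
    by (simp add: quad_form_mat2[OF psqrt_sym] algebra_simps)
  also have "\<dots> = x \<bullet> (G *v x) + d * (norm x)\<^sup>2"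
    unfolding psqrt_nth quad_form_mat2[OF gram_sym(1)] power2_norm_vec2 by (simp add: algebra_simps)
  finally show ?thesis by (simp add: gram_quad)
qed

lemma psqrt_psd: "0 \<le> x \<bullet> (psqrt G *v x)"
proof -
  have "0 \<le> t * (x \<bullet> (psqrt G *v x))" using gram_det(1) by (simp add: psqrt_quad)
  then show ?thesis using gram_trace(1) by (simp add: zero_le_mult_iff)
qed

lemma psqrt_square: "psqrt G ** psqrt G = G"
proof -
  define H where "H = psqrt G"
  note n = psqrt_nth[folded H_def]
  note dd = gram_det(2) and tt = gram_trace(2)
  \<comment> \<open>Clearing the factor \<open>1 / t\<close> leaves
    \<open>(G + d)^2 = t^2 G\<close>, which is Cayley-Hamilton for \<open>G\<close>.\<close>
  have cancel: "x = y" if "t\<^sup>2 * x = t\<^sup>2 * y" for x y using that gram_trace(1) by simp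
  have e: "t\<^sup>2 * (a * b + c * e) = (t * a) * (t * b) + (t * c) * (t * e)" for a b c e
    by (simp add: power2_eq_square algebra_simps)
  have dd': "d * d = G$1$1 * G$2$2 - G$1$2 * G$1$2" using dd by (simp add: power2_eq_square)
  have "H $ 1 $ 1 * H $ 1 $ 1 + H $ 1 $ 2 * H $ 2 $ 1 = G$1$1"
    by (rule cancel) (subst e, simp only: n tt, simp add: algebra_simps dd')
  moreover have "H $ 2 $ 1 * H $ 1 $ 2 + H $ 2 $ 2 * H $ 2 $ 2 = G$2$2"
    by (rule cancel) (subst e, simp only: n tt, simp add: algebra_simps dd')
  moreover have "H $ 1 $ 1 * H $ 1 $ 2 + H $ 1 $ 2 * H $ 2 $ 2 = G$1$2"
    by (rule cancel) (subst e, simp only: n tt, simp add: algebra_simps)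
  moreover have "H $ 2 $ 1 * H $ 1 $ 1 + H $ 2 $ 2 * H $ 2 $ 1 = G$1$2"
    by (rule cancel) (subst e, simp only: n tt, simp add: algebra_simps)
  ultimately have "H ** H = G" by (simp only: mat2_eq_iff mat2_mult_nth gram_sym(2) simp_thms)
  then show ?thesis by (simp add: H_def)
qed

lemma psqrt_trace: "psqrt G $ 1 $ 1 + psqrt G $ 2 $ 2 = t"
proof -
  have "t * (psqrt G $ 1 $ 1 + psqrt G $ 2 $ 2) = t * t"
    unfolding distrib_left psqrt_nth using gram_trace(2) by (simp add: power2_eq_square)
  then show ?thesis using gram_trace(1) by simp
qed

lemma psqrt_det: "det (psqrt G) = d"
proof -
  have "(det (psqrt G))\<^sup>2 = det G" by (simp add: power2_eq_square psqrt_square flip: det_mul)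
  moreover have "0 \<le> det (psqrt G)" using psd_mat2(3)[OF psqrt_sym psqrt_psd] .
  ultimately show ?thesis by (metis d real_sqrt_unique)
qed

lemma psqrt_mult_inv: "psqrt G ** psqrt_inv G = mat 1" "psqrt_inv G ** psqrt G = mat 1"
proof -
  define H where "H = psqrt G"
  have tr: "t = H$1$1 + H$2$2" and dt: "H$1$1 * H$2$2 - H$1$2 * H$2$1 = d"
    using psqrt_trace psqrt_det by (simp_all add: H_def det_2)
  have inv: "psqrt_inv G = (1 / d) *\<^sub>R (mat t - H)" by (simp add: psqrt_inv_def H_def d t)
  have "H ** psqrt_inv G = (1 / d) *\<^sub>R (H ** (mat t - H))" "psqrt_inv G ** H = (1 / d) *\<^sub>R ((mat t - H) ** H)"
    unfolding inv by (simp_all add: mat2_eq_iff mat2_mult_nth algebra_simps)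
  moreover have "H ** (mat t - H) = mat d" "(mat t - H) ** H = mat d"
    unfolding mat2_eq_iff mat2_mult_nth using dt by (simp_all add: mat_nth2 tr algebra_simps)
  moreover have "(1 / d) *\<^sub>R (mat d :: mat2) = mat 1" using gram_det(1) by (simp add: mat2_eq_iff mat_nth2)
  ultimately show "psqrt G ** psqrt_inv G = mat 1" "psqrt_inv G ** psqrt G = mat 1" by (simp_all add: H_def)
qed

lemma psqrt_inv_sym: "transpose (psqrt_inv G) = psqrt_inv G"
  using transpose_eq_self_nth[OF psqrt_sym] by (simp add: psqrt_inv_def mat2_eq_iff transpose_def mat_nth2)

text \<open>Cayley-Hamilton recovers \<open>H\<close> from its square, its trace and its
  determinant; nonnegativity decides the signs of the two square roots involved.\<close>

lemma psqrt_unique: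
  assumes H: "transpose H = H" "\<And>x. 0 \<le> x \<bullet> (H *v x)" "H ** H = G"
  shows "H = psqrt G"
proof -
  note p = psd_mat2[OF H(1,2)]
  have "(det H)\<^sup>2 = det G" using H(3) by (simp add: power2_eq_square flip: det_mul)
  then have d': "det H = d" using p(3) by (metis d real_sqrt_unique)
  have "(H$1$1 + H$2$2)\<^sup>2 = trace (H ** H) + 2 * det H"
    by (simp add: trace_2 mat2_mult_nth det_2 power2_eq_square algebra_simps)
  then have "(H$1$1 + H$2$2)\<^sup>2 = trace G + 2 * d" by (simp add: H(3) d')
  then have t': "H$1$1 + H$2$2 = t" using p(1,2) unfolding t by (metis add_nonneg_nonneg real_sqrt_unique)
  have "t *\<^sub>R H = H ** H + mat (det H)"
    by (simp add: mat2_eq_iff mat2_mult_nth det_2 mat_nth2 algebra_simps flip: t')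
  then have "t *\<^sub>R H = G + mat d" by (simp add: H(3) d')
  then have "(1 / t) *\<^sub>R (t *\<^sub>R H) = psqrt G" by (simp add: psqrt_def flip: d t)
  then show ?thesis using gram_trace(1) by simp
qed

end

text \<open>The orthogonal factor \<open>C (C^T C)^(-1/2)\<close> in the polar decomposition of an
  invertible \<open>C\<close>.\<close>

definition polar2 :: "mat2 \<Rightarrow> mat2" where
  "polar2 C = C ** psqrt_inv (transpose C ** C)"

lemma polar2_orthogonal:
  assumes "det C \<noteq> 0"
  shows "orthogonal_matrix (polar2 C)"
proof -
  let ?G = "transpose C ** C"
  note P = psqrt_mult_inv[OF assms refl refl refl] psqrt_square[OF assms refl refl refl] psqrt_inv_sym[OF assms refl refl refl]
  have "transpose (polar2 C) ** polar2 C = psqrt_inv ?G ** ?G ** psqrt_inv ?G"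
    by (simp add: polar2_def matrix_transpose_mul P matrix_mul_assoc)
  also have "\<dots> = (psqrt_inv ?G ** psqrt ?G) ** (psqrt ?G ** psqrt_inv ?G)"
    by (subst P(3)[symmetric]) (simp only: matrix_mul_assoc)
  also have "\<dots> = mat 1" by (simp add: P)
  finally show ?thesis by (simp add: orthogonal_matrix)
qed

lemma polar2_mult_psqrt:
  assumes "det C \<noteq> 0"
  shows "polar2 C ** psqrt (transpose C ** C) = C"
  using psqrt_mult_inv(2)[OF assms refl refl refl] by (simp add: polar2_def flip: matrix_mul_assoc)

lemma transpose_polar2_mult:
  assumes "det C \<noteq> 0"
  shows "transpose (polar2 C) ** C = psqrt (transpose C ** C)"
proof -
  have "transpose (polar2 C) ** (polar2 C ** psqrt (transpose C ** C)) = psqrt (transpose C ** C)"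
    using polar2_orthogonal[OF assms] by (simp add: matrix_mul_assoc orthogonal_matrix)
  then show ?thesis by (simp add: polar2_mult_psqrt[OF assms])
qed

text \<open>The eigenvalues of \<open>C^T C\<close> lie between \<open>m\<close> and 1, where a
  square root is at least the number itself. Concretely, \<open>t\<close> times the form of the root
  is at least \<open>2 m\<close> on unit vectors, and \<open>t \<le> 2\<close>.\<close>

lemma psqrt_gram_lower_bound:
  fixes C :: mat2
  assumes m: "0 < m" and lo: "\<And>x. m * (norm x)\<^sup>2 \<le> (norm (C *v x))\<^sup>2" and hi: "\<And>x. norm (C *v x) \<le> norm x"
  shows "det C \<noteq> 0" "m * (norm x)\<^sup>2 \<le> x \<bullet> (psqrt (transpose C ** C) *v x)"
proof -
  define G where "G = transpose C ** C"
  have quad: "x \<bullet> (G *v x) = (norm (C *v x))\<^sup>2" for x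
    unfolding G_def power2_norm_eq_inner by (rule inner_gram_mat2)
  have sym: "transpose G = G" "G$2$1 = G$1$2" by (simp_all add: G_def mat2_eq_iff mat2_mult_nth transpose_def)
  have G1: "m \<le> G$1$1" "m \<le> G$2$2" "G$1$1 \<le> 1" "G$2$2 \<le> 1"
  proof -
    have "G $ s $ s = (norm (C *v axis s 1))\<^sup>2" for s using quad[of "axis s 1"] by (simp add: inner_axis_mat2)
    moreover have "(norm (C *v axis s 1))\<^sup>2 \<le> 1" "m \<le> (norm (C *v axis s 1))\<^sup>2" for s
      using hi[of "axis s 1"] lo[of "axis s 1"] by (simp_all add: abs_square_le_1)
    ultimately show "m \<le> G$1$1" "m \<le> G$2$2" "G$1$1 \<le> 1" "G$2$2 \<le> 1" by simp_all
  qed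
  \<comment> \<open>Positivity of \<open>G - m\<close> gives
    \<open>det G \<ge> m * trace G - m^2\<close>, and the trace is at least
    \<open>2 m\<close>.\<close>
  have "0 \<le> det (G - mat m)"
  proof (rule psd_mat2(3))
    show "transpose (G - mat m) = G - mat m" using sym by (simp add: mat2_eq_iff transpose_def mat_nth2)
    fix x
    have "x \<bullet> ((G - mat m) *v x) = x \<bullet> (G *v x) - m * (norm x)\<^sup>2"
      unfolding power2_norm_vec2 by (simp add: inner_vec2 mat2_vec_nth mat_nth2 power2_eq_square algebra_simps)
    then show "0 \<le> x \<bullet> ((G - mat m) *v x)" using lo[of x] by (simp add: quad)
  qed
  then have "m * (G$1$1 + G$2$2) - m * m \<le> det G" by (simp add: det_2 mat_nth2 sym algebra_simps)
  moreover have "m * (m + m) \<le> m * (G$1$1 + G$2$2)" using G1 m by (intro mult_left_mono) auto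
  ultimately have detG: "m\<^sup>2 \<le> det G" by (simp add: power2_eq_square algebra_simps)
  moreover have "det G = (det C)\<^sup>2" by (simp add: G_def det_mul det_transpose power2_eq_square)
  ultimately show C: "det C \<noteq> 0" using m by auto
  define d t where "d = sqrt (det G)" and "t = sqrt (trace G + 2 * d)"
  note P = gram_det[OF C G_def d_def t_def] gram_trace[OF C G_def d_def t_def] psqrt_quad[OF C G_def d_def t_def]
  have "m \<le> d" unfolding d_def using detG m by (simp add: real_le_rsqrt)
  have "d\<^sup>2 \<le> 1"
    using G1 m mult_mono[of "G$1$1" 1 "G$2$2" 1] by (simp add: P(2)) (smt (verit) zero_le_square)
  then have "d \<le> 1" using power2_le_imp_le[of d 1] by simp
  then have "t\<^sup>2 \<le> 2\<^sup>2" using G1 by (simp add: P(4))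
  then have "t \<le> 2" by (rule power2_le_imp_le) simp
  have "t * (m * (norm x)\<^sup>2) \<le> 2 * (m * (norm x)\<^sup>2)" using \<open>t \<le> 2\<close> m by (intro mult_right_mono) auto
  also have "\<dots> = m * (norm x)\<^sup>2 + m * (norm x)\<^sup>2" by simp
  also have "\<dots> \<le> (norm (C *v x))\<^sup>2 + d * (norm x)\<^sup>2" using lo \<open>m \<le> d\<close> by (intro add_mono mult_right_mono) auto
  also have "\<dots> = t * (x \<bullet> (psqrt G *v x))" by (simp add: P)
  finally show "m * (norm x)\<^sup>2 \<le> x \<bullet> (psqrt (transpose C ** C) *v x)"
    using P(3) by (simp add: G_def)
qed

section \<open>Averages of nearby planes\<close>

definition span_proj :: "'a::real_inner \<Rightarrow> 'a \<Rightarrow> 'a \<Rightarrow> 'a" where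
  "span_proj v w x = (v \<bullet> x) *\<^sub>R v + (w \<bullet> x) *\<^sub>R w"

text \<open>The coefficient matrix of \<open>v'\<close>, \<open>w'\<close> in the basis
  \<open>v\<close>, \<open>w\<close> has orthonormal columns, hence also orthonormal rows, and the
  latter is equality of the projections.\<close>

lemma span_proj_unique:
  fixes v w :: "'a::real_inner"
  assumes on: "v \<bullet> v = 1" "w \<bullet> w = 1" "v \<bullet> w = 0" and on': "v' \<bullet> v' = 1" "w' \<bullet> w' = 1" "v' \<bullet> w' = 0"
    and sp: "span_proj v w v' = v'" "span_proj v w w' = w'"
  shows "span_proj v w = span_proj v' w'"
proof
  fix x
  define a b c e where "a = v \<bullet> v'" "b = w \<bullet> v'" "c = v \<bullet> w'" "e = w \<bullet> w'"
  have v': "v' = a *\<^sub>R v + b *\<^sub>R w" and w': "w' = c *\<^sub>R v + e *\<^sub>R w"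
    using sp by (simp_all add: span_proj_def a_b_c_e_def)
  have on2: "w \<bullet> v = 0" using on by (simp add: inner_commute)
  have ab: "a * a + b * b = 1" and ce: "c * c + e * e = 1" and ac: "a * c + b * e = 0"
    using on' unfolding v' w' by (simp_all add: inner_add_left inner_add_right on on2 mult.commute)
  \<comment> \<open>For the coefficient matrix \<open>A\<close> both sides are squared norms, of
    \<open>A A^T - 1\<close> and of \<open>A^T A - 1\<close>; the second is zero by
    orthonormality.\<close>
  have "(a * a + c * c - 1)\<^sup>2 + (b * b + e * e - 1)\<^sup>2 + 2 * (a * b + c * e)\<^sup>2 =
     (a * a + b * b)\<^sup>2 + (c * c + e * e)\<^sup>2 + 2 * (a * c + b * e)\<^sup>2 + 2 - 2 * (a * a + b * b) - 2 * (c * c + e * e)"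
    by (simp add: power2_eq_square algebra_simps)
  also have "\<dots> = 0" by (simp add: ab ce ac)
  finally have "(a * a + c * c - 1)\<^sup>2 + (b * b + e * e - 1)\<^sup>2 + 2 * (a * b + c * e)\<^sup>2 = 0" .
  moreover have "0 \<le> (a * a + c * c - 1)\<^sup>2" "0 \<le> (b * b + e * e - 1)\<^sup>2" "0 \<le> (a * b + c * e)\<^sup>2" by simp_all
  ultimately have "(a * a + c * c - 1)\<^sup>2 = 0" "(b * b + e * e - 1)\<^sup>2 = 0" "(a * b + c * e)\<^sup>2 = 0"
    by linarith+
  then have E: "a * a + c * c = 1" "b * b + e * e = 1" "a * b + c * e = 0" by simp_all
  have "span_proj v' w' x = ((a * a + c * c) * (v \<bullet> x) + (a * b + c * e) * (w \<bullet> x)) *\<^sub>R v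
     + ((a * b + c * e) * (v \<bullet> x) + (b * b + e * e) * (w \<bullet> x)) *\<^sub>R w"
    unfolding span_proj_def v' w' by (simp add: inner_add_left algebra_simps)
  then show "span_proj v w x = span_proj v' w' x" by (simp add: E span_proj_def)
qed

text \<open>The maps \<open>T j\<close> are isometric embeddings of the plane with adjoints \<open>Tt j\<close>, and \<open>avg\<close> is the
  average, with weights \<open>r\<close>, of the projections onto their ranges.\<close>

locale frames =
  fixes I K :: "nat set" and r :: "nat \<Rightarrow> real" and T :: "nat \<Rightarrow> real^2 \<Rightarrow> 'a::real_inner"
    and Tt :: "nat \<Rightarrow> 'a \<Rightarrow> real^2" and Om :: "nat \<Rightarrow> nat \<Rightarrow> mat2" and \<epsilon> :: real
  assumes I: "finite I" "I \<subseteq> K" "sum r I = 1" "\<And>j. j \<in> I \<Longrightarrow> 0 \<le> r j"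
    and lin: "\<And>j. j \<in> K \<Longrightarrow> linear (T j)"
    and adj: "\<And>j x y. j \<in> K \<Longrightarrow> T j y \<bullet> x = y \<bullet> Tt j x"
    and iso: "\<And>j y. j \<in> K \<Longrightarrow> Tt j (T j y) = y"
    and Om: "\<And>j k. j \<in> K \<Longrightarrow> k \<in> K \<Longrightarrow> orthogonal_matrix (Om j k)"
    and near: "\<And>j k y. j \<in> K \<Longrightarrow> k \<in> K \<Longrightarrow> norm (T j y - T k (Om k j *v y)) \<le> \<epsilon> * norm y"
    and \<epsilon>: "0 \<le> \<epsilon>" "\<epsilon> < 1 / 9"
begin

definition avg :: "'a \<Rightarrow> 'a" where
  "avg x = (\<Sum>j\<in>I. r j *\<^sub>R T j (Tt j x))"

definition form :: "'a \<Rightarrow> 'a \<Rightarrow> real" where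
  "form x y = (\<Sum>j\<in>I. r j * (Tt j x \<bullet> Tt j y))"

lemma eps2: "\<epsilon>\<^sup>2 \<le> 1 / 81"
  using power_mono[of \<epsilon> "1/9" 2] \<epsilon> by (simp add: power2_eq_square)

lemma avg_inner: "avg x \<bullet> y = form x y"
  unfolding avg_def form_def inner_sum_left using I(2) by (intro sum.cong) (auto simp: adj)

lemma form_sym: "form x y = form y x"
  unfolding form_def by (simp add: inner_commute)

lemma linear_Tt:
  assumes "j \<in> K"
  shows "linear (Tt j)"
proof (rule linearI)
  fix x y
  have "z \<bullet> Tt j (x + y) = z \<bullet> (Tt j x + Tt j y)" for z
    using adj[OF assms, of z "x + y"] adj[OF assms, of z x] adj[OF assms, of z y] by (simp add: inner_add_right)
  then show "Tt j (x + y) = Tt j x + Tt j y" using vector_eq_ldot[of "Tt j (x + y)" "Tt j x + Tt j y"] by blast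
next
  fix c x
  have "z \<bullet> Tt j (c *\<^sub>R x) = z \<bullet> (c *\<^sub>R Tt j x)" for z
    using adj[OF assms, of z "c *\<^sub>R x"] adj[OF assms, of z x] by simp
  then show "Tt j (c *\<^sub>R x) = c *\<^sub>R Tt j x" using vector_eq_ldot[of "Tt j (c *\<^sub>R x)" "c *\<^sub>R Tt j x"] by blast
qed

lemma linear_avg: "linear avg"
proof -
  have "linear (\<lambda>x. r j *\<^sub>R T j (Tt j x))" if "j \<in> I" for j
    using that I(2) linear_compose[OF linear_Tt lin] by (intro linear_compose_scale_right) (auto simp: o_def)
  then show ?thesis unfolding avg_def[abs_def] by (intro linear_compose_sum) auto
qed

lemma form_add: "form (x + y) z = form x z + form y z" "form x (y + z) = form x y + form x z"
  using linear_add[OF linear_avg] form_sym by (simp_all add: inner_add_left inner_add_right flip: avg_inner)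

lemma form_scaleR: "form (c *\<^sub>R x) z = c * form x z" "form x (c *\<^sub>R z) = c * form x z"
  using linear_scale[OF linear_avg] by (simp_all flip: avg_inner)

lemma form_diff: "form (x - y) z = form x z - form y z" "form x (y - z) = form x y - form x z"
  using linear_diff[OF linear_avg] form_sym by (simp_all add: inner_diff_left inner_diff_right flip: avg_inner)

lemma norm_T: "j \<in> K \<Longrightarrow> norm (T j y) = norm y"
  unfolding norm_eq_sqrt_inner by (simp add: adj iso)

lemma T_inner: "j \<in> K \<Longrightarrow> T j x \<bullet> T j y = x \<bullet> y"
  by (simp add: adj iso)

lemma norm_Tt_le:
  assumes "j \<in> K"
  shows "norm (Tt j x) \<le> norm x"
proof -
  have "(norm (Tt j x))\<^sup>2 = T j (Tt j x) \<bullet> x" by (simp add: power2_norm_eq_inner adj[OF assms])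
  also have "\<dots> \<le> norm (Tt j x) * norm x" using norm_cauchy_schwarz norm_T[OF assms] by metis
  finally show ?thesis by (cases "norm (Tt j x) = 0") (auto simp: power2_eq_square)
qed

lemma form_self: "form x x = (\<Sum>j\<in>I. r j * (norm (Tt j x))\<^sup>2)"
  by (simp add: form_def power2_norm_eq_inner)

lemma form_le_weighted:
  assumes "\<And>j. j \<in> I \<Longrightarrow> (norm (Tt j x))\<^sup>2 \<le> c"
  shows "form x x \<le> c"
proof -
  have "form x x \<le> (\<Sum>j\<in>I. r j * c)"
    unfolding form_self using assms I(4) by (intro sum_mono mult_left_mono) auto
  then show ?thesis by (simp add: I(3) flip: sum_distrib_right)
qed

lemma form_ge_weighted:
  assumes "\<And>j. j \<in> I \<Longrightarrow> c \<le> (norm (Tt j x))\<^sup>2"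
  shows "c \<le> form x x"
proof -
  have "(\<Sum>j\<in>I. r j * c) \<le> form x x"
    unfolding form_self using assms I(4) by (intro sum_mono mult_left_mono) auto
  then show ?thesis by (simp add: I(3) flip: sum_distrib_right)
qed

lemma form_self_le: "form x x \<le> (norm x)\<^sup>2"
  using I(2) norm_Tt_le by (intro form_le_weighted power_mono) auto

lemma form_kernel_le:
  assumes k: "k \<in> K" "Tt k x = 0"
  shows "form x x \<le> \<epsilon>\<^sup>2 * (norm x)\<^sup>2"
proof (rule form_le_weighted)
  fix j assume "j \<in> I"
  then have j: "j \<in> K" using I(2) by auto
  let ?y = "Tt j x"
  \<comment> \<open>The subtracted vector lies in the range of \<open>T k\<close>, to which
    \<open>x\<close> is orthogonal because \<open>Tt k x = 0\<close>.\<close>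
  have "(norm ?y)\<^sup>2 = (T j ?y - T k (Om k j *v ?y)) \<bullet> x"
    by (simp add: power2_norm_eq_inner inner_diff_left adj j k)
  also have "\<dots> \<le> norm (T j ?y - T k (Om k j *v ?y)) * norm x" by (rule norm_cauchy_schwarz)
  also have "\<dots> \<le> \<epsilon> * norm ?y * norm x" using near[OF j k(1)] by (intro mult_right_mono) auto
  finally have "norm ?y \<le> \<epsilon> * norm x" using \<epsilon>(1) by (cases "norm ?y = 0") (auto simp: power2_eq_square)
  then show "(norm ?y)\<^sup>2 \<le> \<epsilon>\<^sup>2 * (norm x)\<^sup>2" by (metis norm_ge_zero power_mono power_mult_distrib)
qed

text \<open>For \<open>x = T k y\<close>, the number \<open>|x|^2 - |Tt j x|^2\<close> is the
  squared distance from \<open>x\<close> to the range of \<open>T j\<close>, so it is bounded by the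
  squared distance to the particular vector \<open>T j (Om j k *v y)\<close>.\<close>

lemma form_range_ge:
  assumes k: "k \<in> K"
  shows "(1 - \<epsilon>\<^sup>2) * (norm y)\<^sup>2 \<le> form (T k y) (T k y)"
proof (rule form_ge_weighted)
  fix j assume "j \<in> I"
  then have j: "j \<in> K" using I(2) by auto
  let ?x = "T k y" and ?z = "Om j k *v y"
  have "(norm (?x - T j ?z))\<^sup>2 = (norm ?x)\<^sup>2 - 2 * (?z \<bullet> Tt j ?x) + (norm ?z)\<^sup>2"
    using norm_T[OF j, of ?z] unfolding power2_norm_eq_inner
    by (simp add: inner_diff_left inner_diff_right adj[OF j] inner_commute[of ?x "T j ?z"] iso[OF j])
  also have "\<dots> = (norm ?x)\<^sup>2 - (norm (Tt j ?x))\<^sup>2 + (norm (?z - Tt j ?x))\<^sup>2"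
    by (simp add: power2_norm_eq_inner inner_diff_left inner_diff_right inner_commute)
  finally have "(norm ?x)\<^sup>2 - (norm (Tt j ?x))\<^sup>2 \<le> (norm (?x - T j ?z))\<^sup>2" by simp
  also have "\<dots> \<le> (\<epsilon> * norm y)\<^sup>2" using near[OF k j] by (intro power_mono) auto
  finally show "(1 - \<epsilon>\<^sup>2) * (norm y)\<^sup>2 \<le> (norm (Tt j ?x))\<^sup>2"
    by (simp add: norm_T[OF k] power_mult_distrib algebra_simps)
qed

subsection \<open>The top eigenvectors\<close>

text \<open>The conditions of \<open>is_top_projection\<close>, transcribed to the operator
  \<open>avg\<close>.\<close>

definition top_pair :: "'a \<Rightarrow> 'a \<Rightarrow> real \<Rightarrow> real \<Rightarrow> bool" where
  "top_pair v w \<mu> \<nu> \<longleftrightarrow> avg v = \<mu> *\<^sub>R v \<and> avg w = \<nu> *\<^sub>R w \<and> v \<bullet> v = 1 \<and> w \<bullet> w = 1 \<and> v \<bullet> w = 0 \<and> \<nu> \<le> \<mu> \<and>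
    (\<forall>u \<kappa>. u \<noteq> 0 \<and> avg u = \<kappa> *\<^sub>R u \<and> u \<bullet> v = 0 \<and> u \<bullet> w = 0 \<longrightarrow> \<kappa> < \<nu>)"

text \<open>Since \<open>avg\<close> is symmetric, the component \<open>z\<close> of
  \<open>u\<close> orthogonal to \<open>v\<close> and \<open>w\<close> satisfies the same eigenvalue
  equation. If nonzero, it would be an eigenvector in the orthogonal complement with eigenvalue at
  least \<open>\<nu>\<close>.\<close>

lemma top_pair_dichotomy:
  assumes top: "top_pair v w \<mu> \<nu>" and u: "avg u = \<kappa> *\<^sub>R u" "\<nu> \<le> \<kappa>"
  shows "span_proj v w u = u"
proof (rule ccontr)
  define z where "z = u - span_proj v w u"
  assume "span_proj v w u \<noteq> u"
  then have "z \<noteq> 0" by (simp add: z_def)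
  have av: "avg v = \<mu> *\<^sub>R v" "avg w = \<nu> *\<^sub>R w" and on: "v \<bullet> v = 1" "w \<bullet> w = 1" "v \<bullet> w = 0" "w \<bullet> v = 0"
    using top by (simp_all add: top_pair_def inner_commute)
  have "\<mu> * (v \<bullet> u) = \<kappa> * (v \<bullet> u)" "\<nu> * (w \<bullet> u) = \<kappa> * (w \<bullet> u)"
    using avg_inner[of v u] avg_inner[of u v] avg_inner[of w u] avg_inner[of u w] form_sym[of u v] form_sym[of u w]
    by (simp_all add: av u inner_commute)
  note eqs = this
  have "avg z = \<kappa> *\<^sub>R u - ((\<mu> * (v \<bullet> u)) *\<^sub>R v + (\<nu> * (w \<bullet> u)) *\<^sub>R w)"
    unfolding z_def span_proj_def
    by (simp add: linear_diff[OF linear_avg] linear_add[OF linear_avg] linear_scale[OF linear_avg] av u mult.commute)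
  also have "\<dots> = \<kappa> *\<^sub>R z"
    unfolding eqs z_def span_proj_def by (simp add: scaleR_diff_right scaleR_add_right)
  finally have "avg z = \<kappa> *\<^sub>R z" .
  moreover have "z \<bullet> v = 0" "z \<bullet> w = 0"
    by (simp_all add: z_def span_proj_def inner_diff_left inner_add_left on inner_commute[of u])
  ultimately have "\<kappa> < \<nu>" using top \<open>z \<noteq> 0\<close> unfolding top_pair_def by blast
  with u show False by simp
qed

lemma top_pair_unique:
  assumes "top_pair v w \<mu> \<nu>" "top_pair v' w' \<mu>' \<nu>'"
  shows "span_proj v w = span_proj v' w'"
proof -
  have le: "span_proj v w = span_proj v' w'"
    if t: "top_pair v w \<mu> \<nu>" "top_pair v' w' \<mu>' \<nu>'" and "\<nu> \<le> \<nu>'" for v w \<mu> \<nu> v' w' \<mu>' \<nu>'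
  proof (rule span_proj_unique)
    show "span_proj v w v' = v'" "span_proj v w w' = w'"
      using t that(3) by (auto intro!: top_pair_dichotomy[OF t(1)] simp: top_pair_def)
  qed (use t in \<open>auto simp: top_pair_def\<close>)
  show ?thesis using le[OF assms] le[OF assms(2,1)] by (cases "\<nu> \<le> \<nu>'") auto
qed

text \<open>At a maximum of the form on the unit sphere of \<open>S\<close> the first variation
  vanishes in every direction of \<open>S\<close> orthogonal to \<open>v\<close>. The eigenvector
  equation comes out tested against \<open>S\<close> only.\<close>

lemma max_form_eigen:
  assumes S: "subspace S" and v: "v \<in> S" "v \<bullet> v = 1" "form v v = \<mu>"
    and max: "\<And>x. x \<in> S \<Longrightarrow> form x x \<le> \<mu> * (norm x)\<^sup>2" and x: "x \<in> S"
  shows "form v x = \<mu> * (v \<bullet> x)"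
proof -
  define z where "z = x - (v \<bullet> x) *\<^sub>R v"
  have z: "z \<in> S" "v \<bullet> z = 0"
    using S v x by (auto simp: z_def subspace_diff subspace_scale inner_diff_right)
  have *: "2 * t * form v z \<le> t\<^sup>2 * (\<mu> * (norm z)\<^sup>2 - form z z)" for t
  proof -
    have "form (v + t *\<^sub>R z) (v + t *\<^sub>R z) \<le> \<mu> * (norm (v + t *\<^sub>R z))\<^sup>2"
      using S v z by (intro max) (auto simp: subspace_add subspace_scale)
    moreover have "(norm (v + t *\<^sub>R z))\<^sup>2 = 1 + t\<^sup>2 * (norm z)\<^sup>2"
      unfolding power2_norm_eq_inner
      by (simp add: inner_add_left inner_add_right v z inner_commute[of z v] power2_eq_square)
    moreover have "form (v + t *\<^sub>R z) (v + t *\<^sub>R z) = \<mu> + 2 * t * form v z + t\<^sup>2 * form z z"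
      by (simp add: form_add form_scaleR v form_sym[of z v] power2_eq_square algebra_simps)
    ultimately show ?thesis by (simp add: algebra_simps)
  qed
  have "form v z = 0"
  proof (rule ccontr)
    assume nz: "form v z \<noteq> 0"
    define c where "c = \<bar>\<mu> * (norm z)\<^sup>2 - form z z\<bar> + 1"
    define b where "b = form v z"
    have c: "c > 0" "\<mu> * (norm z)\<^sup>2 - form z z \<le> c" by (simp_all add: c_def)
    \<comment> \<open>The step length \<open>b / c\<close> is small enough for the linear term of
      the variation to exceed the quadratic one.\<close>
    have "2 * (b / c) * b \<le> (b / c)\<^sup>2 * c"
      using *[of "b / c"] mult_left_mono[OF c(2), of "(b / c)\<^sup>2"] unfolding b_def by simp
    then have "2 * (b\<^sup>2 / c) \<le> b\<^sup>2 / c" using c(1) by (simp add: power2_eq_square)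
    moreover have "b\<^sup>2 / c > 0" using nz c(1) by (simp add: b_def)
    ultimately show False by simp
  qed
  then have "form v x = (v \<bullet> x) * form v v" by (simp add: z_def form_diff form_scaleR)
  then show ?thesis by (simp add: v)
qed

lemma max_form_exists:
  assumes S: "subspace S" "compact (S \<inter> sphere 0 1)" and y: "y \<in> S" "y \<noteq> 0"
  obtains v \<mu> where "v \<in> S" "v \<bullet> v = 1" "form v v = \<mu>" "\<And>x. x \<in> S \<Longrightarrow> form x x \<le> \<mu> * (norm x)\<^sup>2"
proof -
  have cT: "continuous_on A (Tt j)" if "j \<in> I" for A j
  proof -
    have "j \<in> K" using that I(2) by auto
    then have "bounded_linear (Tt j)"
      using linear_add[OF linear_Tt] linear_scale[OF linear_Tt] norm_Tt_le by (intro bounded_linear_intro[where K=1]) auto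
    then show ?thesis by (rule linear_continuous_on)
  qed
  have cont: "continuous_on (S \<inter> sphere 0 1) (\<lambda>x. form x x)"
    unfolding form_def by (intro continuous_intros cT)
  have "(1 / norm y) *\<^sub>R y \<in> S \<inter> sphere 0 1" using S y by (simp add: subspace_scale)
  then have "S \<inter> sphere 0 1 \<noteq> {}" by blast
  then obtain v where v: "v \<in> S \<inter> sphere 0 1" "\<And>x. x \<in> S \<inter> sphere 0 1 \<Longrightarrow> form x x \<le> form v v"
    using continuous_attains_sup[OF S(2) _ cont] by blast
  show thesis
  proof (rule that[of v "form v v"])
    fix x assume x: "x \<in> S"
    show "form x x \<le> form v v * (norm x)\<^sup>2"
    proof (cases "x = 0")
      case False
      then have "form ((1 / norm x) *\<^sub>R x) ((1 / norm x) *\<^sub>R x) \<le> form v v"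
        using x S by (intro v) (auto simp: subspace_scale)
      then show ?thesis using False by (simp add: form_scaleR power2_eq_square field_simps)
    qed (simp add: form_def linear_0 I(2) linear_Tt subsetD[OF I(2)] sum.neutral form_self)
  qed (use v in \<open>auto simp: norm_eq_1\<close>)
qed

end

text \<open>In the basis \<open>v, w\<close>, the matrix \<open>C j\<close> below is the projection of the \<open>j\<close>-th frame to the top
  eigenplane.\<close>

locale eigen_frames = frames +
  fixes v w :: 'a and \<mu> \<nu> :: real
  assumes av: "avg v = \<mu> *\<^sub>R v" "avg w = \<nu> *\<^sub>R w"
    and on: "v \<bullet> v = 1" "w \<bullet> w = 1" "v \<bullet> w = 0"
    and high: "1 - \<epsilon>\<^sup>2 \<le> \<nu>" "\<nu> \<le> \<mu>"
begin

abbreviation "Q \<equiv> span_proj v w"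

definition C :: "nat \<Rightarrow> mat2" where
  "C j = (\<chi> a s. (if a = 1 then v else w) \<bullet> T j (axis s 1))"

lemma on': "w \<bullet> v = 0"
  using on by (simp add: inner_commute)

lemma form_eigen: "form v x = \<mu> * (v \<bullet> x)" "form w x = \<nu> * (w \<bullet> x)"
  by (simp_all add: av flip: avg_inner)

lemma K_nonempty: obtains k where "k \<in> K"
  using I by (metis all_not_in_conv subset_empty sum.empty zero_neq_one)

text \<open>A dimension count in the style of Courant-Fischer. The images of \<open>v\<close>,
  \<open>w\<close>, \<open>x\<close> under \<open>Tt k\<close> are three vectors of a plane, so some
  nontrivial combination \<open>z\<close> lies in the kernel of \<open>Tt k\<close>, where the form
  is at most \<open>\<epsilon>^2\<close>. The form has no cross terms on \<open>v\<close>,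
  \<open>w\<close>, \<open>x\<close> and exceeds \<open>\<epsilon>^2\<close> on \<open>v\<close> and
  \<open>w\<close>, so it cannot exceed it on \<open>x\<close> as well.\<close>

lemma form_orthogonal_le:
  assumes x: "x \<bullet> v = 0" "x \<bullet> w = 0"
  shows "form x x \<le> \<epsilon>\<^sup>2 * (norm x)\<^sup>2"
proof (rule ccontr)
  assume neg: "\<not> ?thesis"
  obtain k where k: "k \<in> K" by (rule K_nonempty)
  define p q s where "p = Tt k v" and "q = Tt k w" and "s = Tt k x"
  \<comment> \<open>The 2x2 minors are the coefficients of a linear relation between three vectors
    of the plane. If all of them vanish, \<open>p\<close> and \<open>q\<close> are already
    dependent.\<close>
  define \<alpha> \<beta> \<gamma> where "\<alpha> = q$1 * s$2 - q$2 * s$1" and "\<beta> = s$1 * p$2 - s$2 * p$1" and "\<gamma> = p$1 * q$2 - p$2 * q$1"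
  have three: "\<exists>\<alpha> \<beta> \<gamma>. (\<alpha>, \<beta>, \<gamma>) \<noteq> (0, 0, 0) \<and> \<alpha> *\<^sub>R p + \<beta> *\<^sub>R q + \<gamma> *\<^sub>R s = 0"
  proof (cases "(\<alpha>, \<beta>, \<gamma>) = (0, 0, 0)")
    case False
    moreover have "\<alpha> *\<^sub>R p + \<beta> *\<^sub>R q + \<gamma> *\<^sub>R s = 0"
      by (simp add: vec_eq_iff forall_2 \<alpha>_def \<beta>_def \<gamma>_def algebra_simps)
    ultimately show ?thesis by blast
  next
    case True
    then have "p$1 *\<^sub>R q = q$1 *\<^sub>R p" "p$2 *\<^sub>R q = q$2 *\<^sub>R p"
      by (simp_all add: vec_eq_iff forall_2 \<gamma>_def algebra_simps)
    then have e: "q$1 *\<^sub>R p + (- p$1) *\<^sub>R q + 0 *\<^sub>R s = 0" "q$2 *\<^sub>R p + (- p$2) *\<^sub>R q + 0 *\<^sub>R s = 0" by simp_all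
    show ?thesis
    proof (cases "p = 0")
      case True
      then have "1 *\<^sub>R p + 0 *\<^sub>R q + 0 *\<^sub>R s = 0" by simp
      then show ?thesis by (metis prod.inject zero_neq_one)
    next
      case False
      then have "p$1 \<noteq> 0 \<or> p$2 \<noteq> 0" by (auto simp: vec_eq_iff forall_2)
      with e show ?thesis by (metis neg_equal_0_iff_equal prod.inject)
    qed
  qed
  then obtain a b c where abc: "(a, b, c) \<noteq> (0, 0, 0)" "a *\<^sub>R p + b *\<^sub>R q + c *\<^sub>R s = 0" by blast
  define z where "z = a *\<^sub>R v + b *\<^sub>R w + c *\<^sub>R x"
  have x': "v \<bullet> x = 0" "w \<bullet> x = 0" using x by (simp_all add: inner_commute)
  have "Tt k z = 0"
    using abc(2) linear_Tt[OF k] by (simp add: z_def linear_add linear_scale p_def q_def s_def)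
  then have "form z z \<le> \<epsilon>\<^sup>2 * (norm z)\<^sup>2" by (rule form_kernel_le[OF k])
  moreover have "(norm z)\<^sup>2 = a\<^sup>2 + b\<^sup>2 + c\<^sup>2 * (norm x)\<^sup>2"
    unfolding z_def power2_norm_eq_inner
    by (simp add: inner_add_left inner_add_right on on' x x' power2_eq_square)
  moreover have "form z z = a\<^sup>2 * \<mu> + b\<^sup>2 * \<nu> + c\<^sup>2 * form x x"
    unfolding z_def
    by (simp add: form_add form_scaleR form_eigen form_sym[of x v] form_sym[of x w] on on' x x' power2_eq_square)
  ultimately have "a\<^sup>2 * (\<mu> - \<epsilon>\<^sup>2) + b\<^sup>2 * (\<nu> - \<epsilon>\<^sup>2) + c\<^sup>2 * (form x x - \<epsilon>\<^sup>2 * (norm x)\<^sup>2) \<le> 0"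
    by (simp add: algebra_simps)
  moreover have pos: "\<mu> - \<epsilon>\<^sup>2 > 0" "\<nu> - \<epsilon>\<^sup>2 > 0" "form x x - \<epsilon>\<^sup>2 * (norm x)\<^sup>2 > 0"
    using eps2 high neg by auto
  moreover from pos have "a\<^sup>2 * (\<mu> - \<epsilon>\<^sup>2) \<ge> 0" "b\<^sup>2 * (\<nu> - \<epsilon>\<^sup>2) \<ge> 0" "c\<^sup>2 * (form x x - \<epsilon>\<^sup>2 * (norm x)\<^sup>2) \<ge> 0"
    by simp_all
  ultimately have "a\<^sup>2 * (\<mu> - \<epsilon>\<^sup>2) = 0" "b\<^sup>2 * (\<nu> - \<epsilon>\<^sup>2) = 0" "c\<^sup>2 * (form x x - \<epsilon>\<^sup>2 * (norm x)\<^sup>2) = 0"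
    by linarith+
  with pos abc(1) show False by auto
qed

lemma top_pair: "top_pair v w \<mu> \<nu>"
  unfolding top_pair_def
proof (intro conjI allI impI)
  fix u \<kappa> assume u: "u \<noteq> 0 \<and> avg u = \<kappa> *\<^sub>R u \<and> u \<bullet> v = 0 \<and> u \<bullet> w = 0"
  then have "\<kappa> * (norm u)\<^sup>2 = form u u" by (simp add: power2_norm_eq_inner flip: avg_inner)
  also have "\<dots> \<le> \<epsilon>\<^sup>2 * (norm u)\<^sup>2" using u by (intro form_orthogonal_le) auto
  finally have "\<kappa> \<le> \<epsilon>\<^sup>2" using u by simp
  then show "\<kappa> < \<nu>" using high eps2 by linarith
qed (use av on high in auto)

lemma Q_orthogonal: "(x - Q x) \<bullet> v = 0" "(x - Q x) \<bullet> w = 0"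
  by (simp_all add: span_proj_def inner_diff_left inner_add_left on on' inner_commute[of x])

lemma Q_inner: "Q x \<bullet> y = (v \<bullet> x) * (v \<bullet> y) + (w \<bullet> x) * (w \<bullet> y)"
  by (simp add: span_proj_def inner_add_left)

lemma norm_Q: "(norm (Q x))\<^sup>2 = (v \<bullet> x)\<^sup>2 + (w \<bullet> x)\<^sup>2" "norm (Q x) \<le> norm x"
proof -
  show 1: "(norm (Q x))\<^sup>2 = (v \<bullet> x)\<^sup>2 + (w \<bullet> x)\<^sup>2"
    unfolding power2_norm_eq_inner
    by (simp add: span_proj_def inner_add_left inner_add_right on on' power2_eq_square)
  have "0 \<le> (norm (x - Q x))\<^sup>2" by simp
  also have "\<dots> = (norm x)\<^sup>2 - (norm (Q x))\<^sup>2"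
    unfolding 1 by (simp add: power2_norm_eq_inner inner_diff_left inner_diff_right Q_inner)
      (simp add: span_proj_def inner_add_left inner_add_right on on' inner_commute power2_eq_square)
  finally show "norm (Q x) \<le> norm x" by (simp add: abs_le_square_iff[symmetric])
qed

lemma C_mult: "(C j *v y) $ 1 = v \<bullet> T j y" "(C j *v y) $ 2 = w \<bullet> T j y" if "j \<in> K"
proof -
  have y: "T j y = y$1 *\<^sub>R T j (axis 1 1) + y$2 *\<^sub>R T j (axis 2 1)"
  proof -
    have "y = y$1 *\<^sub>R axis 1 1 + y$2 *\<^sub>R axis 2 1" by (simp add: vec_eq_iff forall_2 axis_def)
    then have "T j y = T j (y$1 *\<^sub>R axis 1 1 + y$2 *\<^sub>R axis 2 1)" by (rule arg_cong)
    then show ?thesis by (simp only: linear_add[OF lin[OF that]] linear_scale[OF lin[OF that]])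
  qed
  show "(C j *v y) $ 1 = v \<bullet> T j y" "(C j *v y) $ 2 = w \<bullet> T j y"
    by (simp_all add: y mat2_vec_nth C_def inner_add_right)
qed

text \<open>Split \<open>x = T j y\<close> into \<open>Q x\<close> and the rest \<open>c\<close>.
  For unit length the form is at least \<open>1 - \<epsilon>^2\<close> on \<open>x\<close>, at most
  1 on \<open>Q x\<close> and at most \<open>\<epsilon>^2\<close> on \<open>c\<close>. This gives
  the ratio \<open>(1 - 2 \<epsilon>^2) / (1 - \<epsilon>^2)\<close>, which at
  \<open>\<epsilon> = 1/9\<close> is 79/80.\<close>

lemma norm_C:
  assumes j: "j \<in> K"
  shows "norm (C j *v y) \<le> norm y" "79 / 80 * (norm y)\<^sup>2 \<le> (norm (C j *v y))\<^sup>2"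
proof -
  have eq: "(norm (C j *v y))\<^sup>2 = (norm (Q (T j y)))\<^sup>2"
    unfolding norm_Q power2_norm_vec2[of "C j *v y"] C_mult[OF j] ..
  then have "norm (C j *v y) = norm (Q (T j y))" by simp
  then show "norm (C j *v y) \<le> norm y" using norm_Q(2)[of "T j y"] norm_T[OF j] by simp
  define x c where "x = T j y" and "c = x - Q x"
  have cv: "c \<bullet> v = 0" "c \<bullet> w = 0" "v \<bullet> c = 0" "w \<bullet> c = 0"
    using Q_orthogonal by (simp_all add: c_def inner_commute)
  have xQ: "Q x + c = x" by (simp add: c_def)
  have Qc: "Q x \<bullet> c = 0" "form (Q x) c = 0" "form c (Q x) = 0"
    using cv form_eigen[of c] by (simp_all add: span_proj_def inner_add_left form_add form_scaleR form_sym[of c v] form_sym[of c w])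
  have cQ: "c \<bullet> Q x = 0" using Qc(1) by (simp only: inner_commute)
  have nx: "(norm x)\<^sup>2 = (norm (Q x))\<^sup>2 + (norm c)\<^sup>2"
  proof -
    have "(norm (Q x + c))\<^sup>2 = (norm (Q x))\<^sup>2 + (norm c)\<^sup>2"
      unfolding power2_norm_eq_inner by (simp add: inner_add_left inner_add_right Qc cQ)
    then show ?thesis by (simp only: xQ)
  qed
  have "(1 - \<epsilon>\<^sup>2) * (norm x)\<^sup>2 \<le> form x x" using form_range_ge[OF j, of y] by (simp add: x_def norm_T[OF j])
  also have "form x x = form (Q x) (Q x) + form c c"
  proof -
    have "form (Q x + c) (Q x + c) = form (Q x) (Q x) + form c c" by (simp add: form_add Qc)
    then show ?thesis by (simp only: xQ)
  qed
  also have "\<dots> \<le> (norm (Q x))\<^sup>2 + \<epsilon>\<^sup>2 * (norm c)\<^sup>2"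
    using cv by (intro add_mono form_self_le form_orthogonal_le)
  finally have "(1 - 2 * \<epsilon>\<^sup>2) * (norm x)\<^sup>2 \<le> (1 - \<epsilon>\<^sup>2) * (norm (Q x))\<^sup>2"
    using nx by (simp add: algebra_simps)
  \<comment> \<open>In this form \<open>\<epsilon>^2\<close> has a nonnegative factor and may be
    replaced by its bound 1/81.\<close>
  then have "0 \<le> (norm (Q x))\<^sup>2 - (norm x)\<^sup>2 + \<epsilon>\<^sup>2 * (2 * (norm x)\<^sup>2 - (norm (Q x))\<^sup>2)"
    by (simp add: algebra_simps)
  also have "\<dots> \<le> (norm (Q x))\<^sup>2 - (norm x)\<^sup>2 + 1 / 81 * (2 * (norm x)\<^sup>2 - (norm (Q x))\<^sup>2)"
    using eps2 nx by (intro add_left_mono mult_right_mono) (auto simp: algebra_simps)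
  finally have fin: "0 \<le> (norm (Q x))\<^sup>2 - (norm x)\<^sup>2 + 1 / 81 * (2 * (norm x)\<^sup>2 - (norm (Q x))\<^sup>2)" .
  have "79 / 80 * n \<le> q" if "0 \<le> q - n + 1 / 81 * (2 * n - q)" for n q :: real using that by (simp add: field_simps)
  from this[OF fin] have "79 / 80 * (norm x)\<^sup>2 \<le> (norm (Q x))\<^sup>2" .
  then show "79 / 80 * (norm y)\<^sup>2 \<le> (norm (C j *v y))\<^sup>2" unfolding eq x_def norm_T[OF j] .
qed

lemma C_invertible: "j \<in> K \<Longrightarrow> det (C j) \<noteq> 0"
  using psqrt_gram_lower_bound(1)[of "79/80" "C j"] norm_C by auto

lemma polar2_close:
  assumes j: "j \<in> K" and k: "k \<in> K" and \<epsilon>': "norm (T j ((Om j k) *v z) - T k z) \<le> \<epsilon> * norm z"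
  shows "\<bar>y \<bullet> ((transpose (polar2 (C j)) ** polar2 (C k)) *v z) - y \<bullet> (Om j k *v z)\<bar> \<le> 22 / 50 * norm y * norm z"
proof -
  \<comment> \<open>The isometry onto the eigenplane given by the polar factor in the basis
    \<open>v\<close>, \<open>w\<close>.\<close>
  define S where "S j y = ((polar2 (C j) *v y) $ 1) *\<^sub>R v + ((polar2 (C j) *v y) $ 2) *\<^sub>R w" for j y
  have S_inner: "S j y \<bullet> S k z = (polar2 (C j) *v y) \<bullet> (polar2 (C k) *v z)" for j y k z
    by (simp add: S_def inner_add_left inner_add_right on on' inner_vec2[of "polar2 _ *v _"])
  have S_norm: "norm (S j y) = norm y" if "j \<in> K" for j y
  proof -
    have "norm (S j y) = norm (polar2 (C j) *v y)" by (simp add: norm_eq_sqrt_inner S_inner)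
    also have "\<dots> = norm y"
      using polar2_orthogonal[OF C_invertible[OF that]]
      by (simp add: norm_eq_sqrt_inner orthogonal_matrix flip: inner_gram_mat2)
    finally show ?thesis .
  qed
  \<comment> \<open>For unit \<open>y\<close> the inner product of \<open>S j y\<close> and
    \<open>T j y\<close> is at least 79/80, so their squared distance is at most 2 - 79/40 = 1/40,
    and the square of 16/100 is slightly larger.\<close>
  have dist: "norm (S j y - T j y) \<le> 16 / 100 * norm y" if j: "j \<in> K" for j y
  proof (rule power2_le_imp_le)
    have "S j y \<bullet> T j y = (polar2 (C j) *v y) \<bullet> (C j *v y)"
      unfolding inner_vec2[of "polar2 _ *v _"] C_mult[OF j] by (simp add: S_def inner_add_left)
    also have "\<dots> = y \<bullet> (psqrt (transpose (C j) ** C j) *v y)"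
      by (simp add: transpose_polar2_mult[OF C_invertible[OF j]] flip: inner_gram_mat2)
    finally have "79 / 80 * (norm y)\<^sup>2 \<le> S j y \<bullet> T j y"
      using psqrt_gram_lower_bound(2)[of "79/80" "C j" y] norm_C[OF j] by auto
    moreover have "(norm (S j y - T j y))\<^sup>2 = (norm y)\<^sup>2 + (norm y)\<^sup>2 - 2 * (S j y \<bullet> T j y)"
      using S_norm[OF j, of y] norm_T[OF j, of y] dot_norm_neg[of "S j y" "T j y"] by (simp add: field_simps)
    ultimately have "(norm (S j y - T j y))\<^sup>2 \<le> 1 / 40 * (norm y)\<^sup>2" by simp
    also have "\<dots> \<le> (16 / 100)\<^sup>2 * (norm y)\<^sup>2" by (intro mult_right_mono) (simp_all add: power2_eq_square)
    finally show "(norm (S j y - T j y))\<^sup>2 \<le> (16 / 100 * norm y)\<^sup>2" unfolding power_mult_distrib .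
  qed simp
  \<comment> \<open>\<open>S\<close> is replaced by \<open>T\<close> on one side at a time; the
    errors 16/100, 16/100 and 1/9 sum to less than 22/50.\<close>
  have "y \<bullet> ((transpose (polar2 (C j)) ** polar2 (C k)) *v z) - y \<bullet> (Om j k *v z) =
    (S j y - T j y) \<bullet> S k z + T j y \<bullet> (S k z - T k z) + T j y \<bullet> (T k z - T j (Om j k *v z))"
    by (simp add: inner_gram_mat2 inner_diff_left inner_diff_right S_inner T_inner[OF j])
  also have "\<bar>\<dots>\<bar> \<le> \<bar>(S j y - T j y) \<bullet> S k z\<bar> + \<bar>T j y \<bullet> (S k z - T k z)\<bar> + \<bar>T j y \<bullet> (T k z - T j (Om j k *v z))\<bar>"
    by linarith
  also have "\<dots> \<le> (16 / 100 * norm y) * norm z + norm y * (16 / 100 * norm z) + norm y * (1 / 9 * norm z)"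
  proof (intro add_mono)
    show "\<bar>(S j y - T j y) \<bullet> S k z\<bar> \<le> (16 / 100 * norm y) * norm z"
      using Cauchy_Schwarz_ineq2[of "S j y - T j y" "S k z"] mult_right_mono[OF dist[OF j, of y], of "norm z"]
      by (simp add: S_norm[OF k])
    show "\<bar>T j y \<bullet> (S k z - T k z)\<bar> \<le> norm y * (16 / 100 * norm z)"
      using Cauchy_Schwarz_ineq2[of "T j y" "S k z - T k z"] mult_left_mono[OF dist[OF k, of z], of "norm y"]
      by (simp add: norm_T[OF j])
    have h: "norm (T k z - T j (Om j k *v z)) \<le> 1 / 9 * norm z"
      using \<epsilon>' mult_right_mono[of \<epsilon> "1/9" "norm z"] \<epsilon> by (simp add: norm_minus_commute)
    show "\<bar>T j y \<bullet> (T k z - T j (Om j k *v z))\<bar> \<le> norm y * (1 / 9 * norm z)"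
      using Cauchy_Schwarz_ineq2[of "T j y" "T k z - T j (Om j k *v z)"] mult_left_mono[OF h norm_ge_zero[of y]]
      unfolding norm_T[OF j] by linarith
  qed
  also have "\<dots> = (16 / 100 + 16 / 100 + 1 / 9) * (norm y * norm z)" by (simp add: algebra_simps)
  also have "\<dots> \<le> 22 / 50 * (norm y * norm z)" by (intro mult_right_mono) auto
  finally show ?thesis by simp
qed

text \<open>Tested on basis vectors, the previous estimate bounds each of the four entries by 22/50,
  and \<open>4 * (22 / 50)^2 < 1\<close>.\<close>

lemma polar2_norm_close:
  assumes "j \<in> K" "k \<in> K"
  shows "norm (transpose (polar2 (C j)) ** polar2 (C k) - Om j k) < 1"
proof -
  define D where "D = transpose (polar2 (C j)) ** polar2 (C k) - Om j k"
  have "\<bar>D $ s $ t\<bar> \<le> 22 / 50" for s t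
  proof -
    have "norm (T j (Om j k *v axis t 1) - T k (axis t 1)) \<le> \<epsilon> * norm (axis t (1::real))"
      using near[OF assms(2,1), of "axis t 1"] by (simp add: norm_minus_commute)
    from polar2_close[OF assms this, of "axis s 1"] show ?thesis
      unfolding inner_axis_mat2 by (simp add: D_def)
  qed
  then have "(D $ s $ t)\<^sup>2 \<le> (22 / 50)\<^sup>2" for s t
    by (metis abs_le_square_iff abs_numeral abs_divide)
  then have "(norm D)\<^sup>2 \<le> 4 * (22 / 50)\<^sup>2"
    unfolding power2_norm_mat2 by (smt (verit))
  also have "\<dots> < 1\<^sup>2" by (simp add: power2_eq_square)
  finally show ?thesis unfolding D_def by (rule power_less_imp_less_base) simp
qed

text \<open>The Gram matrices depend on the projection \<open>Q\<close> only and not on the basis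
  \<open>v\<close>, \<open>w\<close>; this is why continuity is proved for them.\<close>

lemma gram_C: "(transpose (C j) ** C k) $ s $ t = Q (T j (axis s 1)) \<bullet> T k (axis t 1)"
  by (simp add: mat2_mult_nth transpose_def C_def Q_inner)

end

text \<open>The form is maximised on the unit sphere of \<open>S\<close>, then on its part
  orthogonal to \<open>v\<close>. The second maximum is still at least
  \<open>1 - \<epsilon>^2\<close>, because the plane of the \<open>k\<close>-th frame contains a
  nonzero vector orthogonal to \<open>v\<close>.\<close>

lemma (in frames) eigen_frames_exists:
  assumes S: "subspace S" "compact (S \<inter> sphere 0 1)" and T_S: "\<And>j y. j \<in> K \<Longrightarrow> T j y \<in> S"
  obtains v w \<mu> \<nu> where "eigen_frames I K r T Tt Om \<epsilon> v w \<mu> \<nu>"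
proof -
  have "K \<noteq> {}" using I by auto
  then obtain k where k: "k \<in> K" by auto
  have avg_S: "avg x \<in> S" for x
    unfolding avg_def using I(2) T_S by (intro subspace_sum[OF S(1)] subspace_scale[OF S(1)]) auto
  \<comment> \<open>\<open>avg\<close> takes its values in \<open>S\<close>, so the residual lies in
    \<open>S\<close> and can be tested against itself.\<close>
  have avg_eq: "avg x = c *\<^sub>R x" if x: "x \<in> S" and e: "\<And>y. y \<in> S \<Longrightarrow> form x y = c * (x \<bullet> y)" for x c
  proof -
    define z where "z = avg x - c *\<^sub>R x"
    have "z \<in> S" unfolding z_def using S x avg_S by (intro subspace_diff subspace_scale) auto
    then have "z \<bullet> z = 0" unfolding z_def inner_diff_left avg_inner using e[of z] by (simp add: z_def)
    then show ?thesis by (simp add: z_def)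
  qed
  have T_ne: "T k y \<noteq> 0" if "y \<noteq> 0" for y using norm_T[OF k, of y] that by auto
  obtain v \<mu> where v: "v \<in> S" "v \<bullet> v = 1" "form v v = \<mu>" "\<And>x. x \<in> S \<Longrightarrow> form x x \<le> \<mu> * (norm x)\<^sup>2"
    by (rule max_form_exists[OF S T_S[OF k] T_ne[of "axis 1 1"]]) auto
  have ev: "form v x = \<mu> * (v \<bullet> x)" if "x \<in> S" for x by (rule max_form_eigen[OF S(1) v that])
  define S' where "S' = S \<inter> {x. v \<bullet> x = 0}"
  have S': "subspace S'" "compact (S' \<inter> sphere 0 1)"
  proof -
    show "subspace S'" unfolding S'_def by (intro subspace_inter S subspace_hyperplane)
    have "S' \<inter> sphere 0 1 = (S \<inter> sphere 0 1) \<inter> {x. v \<bullet> x = 0}" by (auto simp: S'_def)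
    then show "compact (S' \<inter> sphere 0 1)" using compact_Int_closed[OF S(2) closed_hyperplane] by simp
  qed
  define p where "p = Tt k v"
  \<comment> \<open>The quarter turn of \<open>Tt k v\<close>, or any nonzero vector if that is
    zero; then \<open>T k y\<close> is orthogonal to \<open>v\<close>.\<close>
  define y :: "real^2" where "y = (if p = 0 then axis 1 1 else vector [- p$2, p$1])"
  have y: "y \<noteq> 0" "y \<bullet> p = 0" by (auto simp: y_def vec_eq_iff forall_2 inner_vec2)
  have Ty: "T k y \<in> S'" using T_S[OF k] y(2) adj[OF k, of y v] by (simp add: S'_def p_def inner_commute)
  obtain w \<nu> where w: "w \<in> S'" "w \<bullet> w = 1" "form w w = \<nu>" "\<And>x. x \<in> S' \<Longrightarrow> form x x \<le> \<nu> * (norm x)\<^sup>2"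
    using max_form_exists[OF S' Ty T_ne[OF y(1)]] by blast
  have ew: "form w x = \<nu> * (w \<bullet> x)" if "x \<in> S" for x
  proof -
    define z where "z = x - (v \<bullet> x) *\<^sub>R v"
    have z: "z \<in> S'" using S v that by (auto simp: z_def S'_def subspace_diff subspace_scale inner_diff_right)
    have "form w z = \<nu> * (w \<bullet> z)" by (rule max_form_eigen[OF S'(1) w z])
    moreover have "w \<bullet> v = 0" "form w v = 0"
      using w(1) ev[of w] form_sym[of w v] by (auto simp: S'_def inner_commute)
    ultimately show ?thesis by (simp add: z_def form_diff form_scaleR inner_diff_right)
  qed
  show thesis
  proof (rule that, unfold_locales)
    show "avg v = \<mu> *\<^sub>R v" by (rule avg_eq[OF v(1) ev])
    show "avg w = \<nu> *\<^sub>R w" using w(1) by (intro avg_eq ew) (auto simp: S'_def)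
    show "v \<bullet> v = 1" "w \<bullet> w = 1" "v \<bullet> w = 0" using v w by (auto simp: S'_def)
    have "(1 - \<epsilon>\<^sup>2) * (norm y)\<^sup>2 \<le> \<nu> * (norm y)\<^sup>2"
      using form_range_ge[OF k, of y] w(4)[OF Ty] by (simp add: norm_T[OF k])
    then show "1 - \<epsilon>\<^sup>2 \<le> \<nu>" using y(1) by simp
    show "\<nu> \<le> \<mu>" using v(4)[of w] w by (simp add: S'_def power2_norm_eq_inner)
  qed
qed

text \<open>A Davis-Kahan argument: for a unit eigenvector \<open>u\<close> of the first average
  with eigenvalue \<open>\<kappa>\<close>, the part \<open>c\<close> of \<open>u\<close> off the
  second eigenplane satisfies \<open>(\<kappa> - \<epsilon>^2) |c|^2 \<le> \<eta> |c|\<close>, and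
  the gap is at least 1/2. The two basis vectors together give the factor 4.\<close>

lemma eigen_frames_residual_le:
  assumes E: "eigen_frames I K r T Tt Om \<epsilon> v w \<mu> \<nu>" and E': "eigen_frames I' K' r' T' Tt' Om' \<epsilon> v' w' \<mu>' \<nu>'"
    and \<eta>: "\<And>x y. \<bar>frames.form I r Tt x y - frames.form I' r' Tt' x y\<bar> \<le> \<eta> * norm x * norm y"
  shows "norm (span_proj v w x - span_proj v' w' (span_proj v w x)) \<le> 4 * \<eta> * norm x"
proof -
  interpret A: eigen_frames I K r T Tt Om \<epsilon> v w \<mu> \<nu> by (rule E)
  interpret B: eigen_frames I' K' r' T' Tt' Om' \<epsilon> v' w' \<mu>' \<nu>' by (rule E')
  have one: "norm (u - span_proj v' w' u) \<le> 2 * \<eta>"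
    if u: "u \<bullet> u = 1" "\<And>x. A.form u x = \<kappa> * (u \<bullet> x)" "1 - \<epsilon>\<^sup>2 \<le> \<kappa>" for u \<kappa>
  proof -
    define c where "c = u - span_proj v' w' u"
    have cv: "c \<bullet> v' = 0" "c \<bullet> w' = 0" "v' \<bullet> c = 0" "w' \<bullet> c = 0"
      using B.Q_orthogonal by (simp_all add: c_def inner_commute)
    have uc: "span_proj v' w' u + c = u" by (simp add: c_def)
    have "B.form (span_proj v' w' u) c = 0" "span_proj v' w' u \<bullet> c = 0"
      using cv by (simp_all add: span_proj_def B.form_add B.form_scaleR B.form_eigen inner_add_left)
    then have "B.form (span_proj v' w' u + c) c = B.form c c" "(span_proj v' w' u + c) \<bullet> c = (norm c)\<^sup>2"
      by (simp_all add: B.form_add inner_add_left power2_norm_eq_inner)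
    then have "B.form u c = B.form c c" "u \<bullet> c = (norm c)\<^sup>2" by (simp_all only: uc)
    moreover have "B.form c c \<le> \<epsilon>\<^sup>2 * (norm c)\<^sup>2" using cv by (intro B.form_orthogonal_le)
    moreover have "norm u = 1" using u(1) by (simp add: norm_eq_1)
    ultimately have "\<kappa> * (norm c)\<^sup>2 - \<epsilon>\<^sup>2 * (norm c)\<^sup>2 \<le> \<eta> * norm c"
      using \<eta>[of u c] u(2)[of c] by simp
    moreover have "1 / 2 * (norm c)\<^sup>2 \<le> (\<kappa> - \<epsilon>\<^sup>2) * (norm c)\<^sup>2"
      using u(3) A.eps2 by (intro mult_right_mono) auto
    ultimately have "norm c * norm c \<le> 2 * \<eta> * norm c" by (simp add: power2_eq_square algebra_simps)
    moreover have "0 \<le> \<eta>" using \<eta>[of u u] \<open>norm u = 1\<close> by simp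
    ultimately show ?thesis unfolding c_def[symmetric] by (cases "norm c = 0") auto
  qed
  have nv: "norm (v - span_proj v' w' v) \<le> 2 * \<eta>" "norm (w - span_proj v' w' w) \<le> 2 * \<eta>"
    using A.on A.form_eigen A.high by (auto intro!: one)
  have "0 \<le> \<eta>" using order_trans[OF norm_ge_zero nv(1)] by simp
  have "span_proj v w x - span_proj v' w' (span_proj v w x) =
    (v \<bullet> x) *\<^sub>R (v - span_proj v' w' v) + (w \<bullet> x) *\<^sub>R (w - span_proj v' w' w)"
    by (simp add: span_proj_def inner_add_right algebra_simps)
  also have "norm \<dots> \<le> \<bar>v \<bullet> x\<bar> * (2 * \<eta>) + \<bar>w \<bullet> x\<bar> * (2 * \<eta>)"
    using nv by (intro norm_triangle_mono) (auto intro!: mult_left_mono)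
  also have "\<dots> \<le> norm x * (2 * \<eta>) + norm x * (2 * \<eta>)"
  proof (intro add_mono mult_right_mono)
    show "\<bar>v \<bullet> x\<bar> \<le> norm x" "\<bar>w \<bullet> x\<bar> \<le> norm x"
      using Cauchy_Schwarz_ineq2[of v x] Cauchy_Schwarz_ineq2[of w x] A.on by (simp_all add: norm_eq_sqrt_inner)
  qed (use \<open>0 \<le> \<eta>\<close> in auto)
  finally show ?thesis by (simp add: algebra_simps)
qed

text \<open>The difference of the projections is \<open>(1 - Q') Q - Q' (1 - Q)\<close>. The first
  part is a residual, the second the adjoint of the residual with the two planes exchanged, hence
  twice the one-sided bound.\<close>

lemma eigen_frames_proj_close:
  assumes E: "eigen_frames I K r T Tt Om \<epsilon> v w \<mu> \<nu>" and E': "eigen_frames I' K' r' T' Tt' Om' \<epsilon> v' w' \<mu>' \<nu>'"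
    and \<eta>: "\<And>x y. \<bar>frames.form I r Tt x y - frames.form I' r' Tt' x y\<bar> \<le> \<eta> * norm x * norm y"
  shows "\<bar>span_proj v w x \<bullet> y - span_proj v' w' x \<bullet> y\<bar> \<le> 8 * \<eta> * norm x * norm y"
proof -
  let ?Q = "span_proj v w" and ?Q' = "span_proj v' w'"
  have sym: "span_proj a b x \<bullet> y = x \<bullet> span_proj a b y" for a b x y :: 'a
    by (simp add: span_proj_def inner_add_left inner_add_right inner_commute)
  have "?Q x \<bullet> y - ?Q' x \<bullet> y = (?Q x - ?Q' (?Q x)) \<bullet> y - x \<bullet> (?Q' y - ?Q (?Q' y))"
    by (simp add: inner_diff_left inner_diff_right sym)
  also have "\<bar>\<dots>\<bar> \<le> \<bar>(?Q x - ?Q' (?Q x)) \<bullet> y\<bar> + \<bar>x \<bullet> (?Q' y - ?Q (?Q' y))\<bar>" by linarith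
  also have "\<dots> \<le> 4 * \<eta> * norm x * norm y + norm x * (4 * \<eta> * norm y)"
  proof (intro add_mono)
    have "norm (?Q x - ?Q' (?Q x)) \<le> 4 * \<eta> * norm x" by (rule eigen_frames_residual_le[OF E E' \<eta>])
    then show "\<bar>(?Q x - ?Q' (?Q x)) \<bullet> y\<bar> \<le> 4 * \<eta> * norm x * norm y"
      using Cauchy_Schwarz_ineq2 by (meson mult_right_mono norm_ge_zero order_trans)
    have "norm (?Q' y - ?Q (?Q' y)) \<le> 4 * \<eta> * norm y"
      by (rule eigen_frames_residual_le[OF E' E]) (use \<eta> in \<open>simp add: abs_minus_commute\<close>)
    then show "\<bar>x \<bullet> (?Q' y - ?Q (?Q' y))\<bar> \<le> norm x * (4 * \<eta> * norm y)"
      using Cauchy_Schwarz_ineq2 by (meson mult_left_mono norm_ge_zero order_trans)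
  qed
  finally show ?thesis by (simp add: algebra_simps)
qed

section \<open>The inner product space of finitely supported sequences\<close>

text \<open>As a type, the sequences can carry the class \<open>real_inner\<close>, so that the
  estimates for abstract frames apply. The space is infinite-dimensional, so compactness holds only
  over a fixed finite support.\<close>

typedef fsv = "{v :: rinf. fin_supp v}"
  morphisms fsv_nth Fsv
  by (rule exI[of _ "\<lambda>_. 0"]) (simp add: fin_supp_def)

lemma fsv_eq_iff: "x = y \<longleftrightarrow> (\<forall>i. fsv_nth x i = fsv_nth y i)"
  by (metis ext fsv_nth_inject)

lemma finite_supp_fsv: "finite {i. fsv_nth x i \<noteq> 0}"
  using fsv_nth[of x] by (simp add: fin_supp_def)

lemma fin_supp_fsv_nth: "fin_supp (fsv_nth x)"
  using fsv_nth[of x] by simp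

lemma fsv_nth_Fsv: "fin_supp v \<Longrightarrow> fsv_nth (Fsv v) = v"
  by (simp add: Fsv_inverse)

lemma fin_supp_subset: "finite F \<Longrightarrow> (\<And>i. i \<notin> F \<Longrightarrow> v i = 0) \<Longrightarrow> fin_supp v"
  unfolding fin_supp_def by (rule finite_subset[of _ F]) auto

instantiation fsv :: real_vector
begin

definition zero_fsv :: fsv where "zero_fsv = Fsv (\<lambda>_. 0)"
definition plus_fsv :: "fsv \<Rightarrow> fsv \<Rightarrow> fsv" where "plus_fsv x y = Fsv (\<lambda>i. fsv_nth x i + fsv_nth y i)"
definition minus_fsv :: "fsv \<Rightarrow> fsv \<Rightarrow> fsv" where "minus_fsv x y = Fsv (\<lambda>i. fsv_nth x i - fsv_nth y i)"
definition uminus_fsv :: "fsv \<Rightarrow> fsv" where "uminus_fsv x = Fsv (\<lambda>i. - fsv_nth x i)"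
definition scaleR_fsv :: "real \<Rightarrow> fsv \<Rightarrow> fsv" where "scaleR_fsv c x = Fsv (\<lambda>i. c *\<^sub>R fsv_nth x i)"

lemma fsv_nth_simps [simp]:
  "fsv_nth 0 i = 0" "fsv_nth (x + y) i = fsv_nth x i + fsv_nth y i"
  "fsv_nth (x - y) i = fsv_nth x i - fsv_nth y i" "fsv_nth (- x) i = - fsv_nth x i"
  "fsv_nth (c *\<^sub>R x) i = c *\<^sub>R fsv_nth x i"
proof -
  note F = finite_UnI[OF finite_supp_fsv[of x] finite_supp_fsv[of y]]
  show "fsv_nth 0 i = 0" by (simp add: zero_fsv_def fsv_nth_Fsv fin_supp_def)
  show "fsv_nth (x + y) i = fsv_nth x i + fsv_nth y i"
    unfolding plus_fsv_def by (subst fsv_nth_Fsv) (auto intro: fin_supp_subset[OF F])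
  show "fsv_nth (x - y) i = fsv_nth x i - fsv_nth y i"
    unfolding minus_fsv_def by (subst fsv_nth_Fsv) (auto intro: fin_supp_subset[OF F])
  show "fsv_nth (- x) i = - fsv_nth x i"
    unfolding uminus_fsv_def by (subst fsv_nth_Fsv) (auto intro: fin_supp_subset[OF F])
  show "fsv_nth (c *\<^sub>R x) i = c *\<^sub>R fsv_nth x i"
    unfolding scaleR_fsv_def by (subst fsv_nth_Fsv) (auto intro: fin_supp_subset[OF F])
qed

instance
  by standard (simp_all add: fsv_eq_iff algebra_simps)

end

instantiation fsv :: real_inner
begin

definition inner_fsv :: "fsv \<Rightarrow> fsv \<Rightarrow> real" where "inner_fsv x y = inf_inner (fsv_nth x) (fsv_nth y)"
definition norm_fsv :: "fsv \<Rightarrow> real" where "norm_fsv x = sqrt (x \<bullet> x)"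
definition sgn_fsv :: "fsv \<Rightarrow> fsv" where "sgn_fsv x = x /\<^sub>R norm x"
definition dist_fsv :: "fsv \<Rightarrow> fsv \<Rightarrow> real" where "dist_fsv x y = norm (x - y)"
definition uniformity_fsv :: "(fsv \<times> fsv) filter" where
  "uniformity_fsv = (INF e\<in>{0<..}. principal {(x, y). dist x y < e})"
definition open_fsv :: "fsv set \<Rightarrow> bool" where
  "open_fsv U = (\<forall>x\<in>U. eventually (\<lambda>(x', y). x' = x \<longrightarrow> y \<in> U) uniformity)"

lemma inner_fsv_sum:
  assumes "finite F" "\<And>i. i \<notin> F \<Longrightarrow> fsv_nth x i \<bullet> fsv_nth y i = 0"
  shows "x \<bullet> y = (\<Sum>i\<in>F. fsv_nth x i \<bullet> fsv_nth y i)"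
  unfolding inner_fsv_def inf_inner_def by (rule Sum_any.expand_superset) (use assms in auto)

instance
proof
  fix x y z :: fsv and r :: real
  define F where "F = {i. fsv_nth x i \<noteq> 0} \<union> {i. fsv_nth y i \<noteq> 0}"
  have F: "finite F" "\<And>i. i \<notin> F \<Longrightarrow> fsv_nth x i = 0 \<and> fsv_nth y i = 0"
    by (auto simp: F_def finite_supp_fsv)
  show "x \<bullet> y = y \<bullet> x" unfolding inner_fsv_def inf_inner_def by (simp add: inner_commute)
  have "x \<bullet> z = (\<Sum>i\<in>F. fsv_nth x i \<bullet> fsv_nth z i)" "y \<bullet> z = (\<Sum>i\<in>F. fsv_nth y i \<bullet> fsv_nth z i)"
    "(x + y) \<bullet> z = (\<Sum>i\<in>F. fsv_nth (x + y) i \<bullet> fsv_nth z i)" "(r *\<^sub>R x) \<bullet> z = (\<Sum>i\<in>F. fsv_nth (r *\<^sub>R x) i \<bullet> fsv_nth z i)"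
    by (rule inner_fsv_sum[OF F(1)]; simp add: F(2))+
  then show "(x + y) \<bullet> z = x \<bullet> z + y \<bullet> z" "(r *\<^sub>R x) \<bullet> z = r * (x \<bullet> z)"
    by (simp_all add: inner_add_left sum.distrib sum_distrib_left)
  have xx: "x \<bullet> x = (\<Sum>i\<in>F. fsv_nth x i \<bullet> fsv_nth x i)" by (rule inner_fsv_sum[OF F(1)]) (simp add: F(2))
  show "0 \<le> x \<bullet> x" unfolding xx by (simp add: sum_nonneg)
  show "x \<bullet> x = 0 \<longleftrightarrow> x = 0"
  proof
    assume "x \<bullet> x = 0"
    then have "\<forall>i\<in>F. fsv_nth x i = 0" unfolding xx using F(1) by (subst (asm) sum_nonneg_eq_0_iff) auto
    then show "x = 0" using F(2) unfolding fsv_eq_iff by auto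
  next
    assume "x = 0"
    then show "x \<bullet> x = 0" unfolding xx by simp
  qed
qed (simp_all add: norm_fsv_def sgn_fsv_def dist_fsv_def uniformity_fsv_def open_fsv_def)

end

lemma norm_fsv_nth_le: "norm (fsv_nth x i) \<le> norm x"
proof -
  have "x \<bullet> x = (\<Sum>k\<in>insert i {k. fsv_nth x k \<noteq> 0}. fsv_nth x k \<bullet> fsv_nth x k)"
    by (rule inner_fsv_sum) (auto simp: finite_supp_fsv)
  also have "\<dots> \<ge> fsv_nth x i \<bullet> fsv_nth x i"
    by (rule member_le_sum) (auto simp: finite_supp_fsv)
  finally show ?thesis by (simp add: norm_eq_sqrt_inner)
qed

definition fsv_single :: "nat \<Rightarrow> real^2 \<Rightarrow> fsv" where
  "fsv_single i y = Fsv (\<lambda>k. if k = i then y else 0)"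

lemma fsv_nth_single [simp]: "fsv_nth (fsv_single i y) k = (if k = i then y else 0)"
  unfolding fsv_single_def by (subst fsv_nth_Fsv, rule fin_supp_subset[of "{i}"]) auto

lemma inner_fsv_single: "fsv_single i y \<bullet> x = y \<bullet> fsv_nth x i"
  by (subst inner_fsv_sum[of "{i}"]) auto

lemma norm_fsv_single: "norm (fsv_single i y) = norm y"
  by (simp add: norm_eq_sqrt_inner inner_fsv_single)

definition fsv_supp :: "nat set \<Rightarrow> fsv set" where
  "fsv_supp F = {x. \<forall>i. i \<notin> F \<longrightarrow> fsv_nth x i = 0}"

lemma subspace_fsv_supp: "subspace (fsv_supp F)"
  by (auto simp: subspace_def fsv_supp_def)

text \<open>Vectors over \<open>insert i F\<close> with coordinates in the unit disc are sums of a
  disc in coordinate \<open>i\<close> and such vectors over \<open>F\<close>, so compactness is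
  built up one coordinate at a time. The sphere is a closed part of the result.\<close>

lemma compact_fsv_supp_sphere:
  assumes "finite F"
  shows "compact (fsv_supp F \<inter> sphere 0 1)"
proof -
  define box where "box F = {x \<in> fsv_supp F. \<forall>i\<in>F. norm (fsv_nth x i) \<le> 1}" for F
  have "compact (box F)" using assms
  proof (induction F)
    case empty
    have "box {} = {0}" by (auto simp: box_def fsv_supp_def fsv_eq_iff)
    then show ?case by simp
  next
    case (insert i F)
    have "linear (fsv_single i)" by (rule linearI) (auto simp: fsv_eq_iff)
    then have "bounded_linear (fsv_single i)"
      by (intro bounded_linear_intro[where K=1]) (auto simp: linear_add linear_scale norm_fsv_single)
    then have c: "continuous_on A (fsv_single i)" for A by (rule linear_continuous_on)
    have "compact ((\<lambda>(y, x). fsv_single i y + x) ` (cball 0 1 \<times> box F))"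
    proof (rule compact_continuous_image)
      show "continuous_on (cball 0 1 \<times> box F) (\<lambda>(y, x). fsv_single i y + x)"
        unfolding case_prod_unfold
        by (intro continuous_on_add continuous_on_snd continuous_on_compose2[OF c continuous_on_fst] continuous_on_id) auto
    qed (use insert in \<open>auto intro: compact_Times\<close>)
    moreover have "(\<lambda>(y, x). fsv_single i y + x) ` (cball 0 1 \<times> box F) = box (insert i F)"
    proof (intro equalityI subsetI)
      fix z assume "z \<in> (\<lambda>(y, x). fsv_single i y + x) ` (cball 0 1 \<times> box F)"
      then obtain y x where "norm y \<le> 1" "x \<in> box F" "z = fsv_single i y + x" by auto
      then show "z \<in> box (insert i F)" using insert.hyps(2) by (auto simp: box_def fsv_supp_def)
    next
      fix z assume z: "z \<in> box (insert i F)"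
      define x where "x = z - fsv_single i (fsv_nth z i)"
      have "x \<in> box F" using z by (auto simp: x_def box_def fsv_supp_def)
      moreover have "z = fsv_single i (fsv_nth z i) + x" by (simp add: x_def)
      moreover have "norm (fsv_nth z i) \<le> 1" using z by (simp add: box_def)
      ultimately show "z \<in> (\<lambda>(y, x). fsv_single i y + x) ` (cball 0 1 \<times> box F)" by (auto intro!: image_eqI)
    qed
    ultimately show ?case by simp
  qed
  moreover have "fsv_supp F \<inter> sphere 0 1 = box F \<inter> sphere 0 1"
  proof -
    have "norm (fsv_nth x i) \<le> 1" if "norm x = 1" for x i using norm_fsv_nth_le[of x i] that by simp
    then show ?thesis by (auto simp: box_def)
  qed
  moreover have "closed (sphere (0::fsv) 1)"
    unfolding sphere_def by (intro closed_Collect_eq continuous_intros)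
  ultimately show ?thesis by (simp add: compact_Int_closed)
qed

subsection \<open>Matrices with two columns\<close>

definition emb :: "rinf2 \<Rightarrow> real^2 \<Rightarrow> fsv" where
  "emb A y = Fsv (\<lambda>i. A i *v y)"

text \<open>The product of the transpose of \<open>A\<close> with \<open>x\<close>, as the adjoint
  of \<open>emb A\<close>.\<close>

definition coemb :: "rinf2 \<Rightarrow> fsv \<Rightarrow> real^2" where
  "coemb A x = (\<chi> s. emb A (axis s 1) \<bullet> x)"

lemma fsv_nth_emb:
  assumes "fin_supp A"
  shows "fsv_nth (emb A y) i = A i *v y"
proof -
  have "fin_supp (\<lambda>i. A i *v y)"
    using assms by (intro fin_supp_subset[of "{i. A i \<noteq> 0}"]) (auto simp: fin_supp_def)
  then show ?thesis by (simp add: emb_def fsv_nth_Fsv)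
qed

lemma linear_emb: "fin_supp A \<Longrightarrow> linear (emb A)"
  by (rule linearI) (auto simp: fsv_eq_iff fsv_nth_emb matrix_vector_right_distrib matrix_vector_mult_scaleR)

lemma vec2_decompose: "y = y$1 *\<^sub>R axis 1 1 + y$2 *\<^sub>R axis 2 1" for y :: "real^2"
  by (simp add: vec_eq_iff forall_2 axis_def)

lemma emb_inner:
  assumes "fin_supp A"
  shows "emb A y \<bullet> x = y \<bullet> coemb A x"
proof -
  have "emb A y = y$1 *\<^sub>R emb A (axis 1 1) + y$2 *\<^sub>R emb A (axis 2 1)"
    using arg_cong[OF vec2_decompose[of y], of "emb A"]
    by (simp only: linear_add[OF linear_emb[OF assms]] linear_scale[OF linear_emb[OF assms]])
  then show ?thesis by (simp add: inner_add_left inner_vec2 coemb_def)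
qed

lemma transpose_mult_sum:
  assumes "finite F" "\<And>i. i \<notin> F \<Longrightarrow> A i = 0 \<or> B i = 0"
  shows "transpose_mult A B = (\<Sum>i\<in>F. transpose (A i) ** B i)"
  unfolding transpose_mult_def
proof (rule Sum_any.expand_superset[OF assms(1)])
  have "transpose (A i) ** B i = 0" if "i \<notin> F" for i
    using assms(2)[OF that] by (auto simp: mat2_eq_iff mat2_mult_nth transpose_def)
  then show "{i. transpose (A i) ** B i \<noteq> 0} \<subseteq> F" by auto
qed

lemma transpose_mult_nth:
  assumes "fin_supp A" "fin_supp B"
  shows "transpose_mult A B $ s $ t = emb A (axis s 1) \<bullet> emb B (axis t 1)"
proof -
  define F where "F = {i. A i \<noteq> 0}"
  have F: "finite F" "\<And>i. i \<notin> F \<Longrightarrow> A i = 0" using assms by (auto simp: F_def fin_supp_def)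
  have "transpose_mult A B = (\<Sum>i\<in>F. transpose (A i) ** B i)" by (rule transpose_mult_sum) (use F in auto)
  then have "transpose_mult A B $ s $ t = (\<Sum>i\<in>F. (A i *v axis s 1) \<bullet> (B i *v axis t 1))"
    by (simp add: inner_axis_mat2 flip: inner_gram_mat2)
  also have "\<dots> = emb A (axis s 1) \<bullet> emb B (axis t 1)"
    by (subst inner_fsv_sum[OF F(1)]) (auto simp: fsv_nth_emb assms F(2))
  finally show ?thesis .
qed

lemma transpose_mult_mult:
  assumes "fin_supp A" "fin_supp B"
  shows "transpose_mult (\<lambda>i. A i ** X) (\<lambda>i. B i ** Y) = transpose X ** transpose_mult A B ** Y"
proof -
  define F where "F = {i. A i \<noteq> 0}"
  have F: "finite F" "\<And>i. i \<notin> F \<Longrightarrow> A i = 0" using assms by (auto simp: F_def fin_supp_def)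
  have 1: "transpose_mult A B = (\<Sum>i\<in>F. transpose (A i) ** B i)" by (rule transpose_mult_sum) (use F in auto)
  have 2: "transpose_mult (\<lambda>i. A i ** X) (\<lambda>i. B i ** Y) = (\<Sum>i\<in>F. transpose (A i ** X) ** (B i ** Y))"
    by (rule transpose_mult_sum) (use F in \<open>auto simp: mat2_eq_iff mat2_mult_nth\<close>)
  have "(\<Sum>i\<in>F. transpose X ** M i ** Y) = transpose X ** (\<Sum>i\<in>F. M i) ** Y" for M :: "nat \<Rightarrow> mat2"
    using F(1) by induction (auto simp: mat2_eq_iff mat2_mult_nth algebra_simps)
  from this[of "\<lambda>i. transpose (A i) ** B i"] show ?thesis
    unfolding 1 2 by (simp add: matrix_transpose_mul matrix_mul_assoc)
qed

lemma zero_mult_mat2: "0 ** X = 0" "X ** 0 = 0" for X :: mat2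
  by (simp_all add: mat2_eq_iff mat2_mult_nth)

lemma fin_supp_mult: "fin_supp W \<Longrightarrow> fin_supp (\<lambda>i. W i ** X)" for W :: rinf2
  by (rule fin_supp_subset[of "{i. W i \<noteq> 0}"]) (auto simp: fin_supp_def zero_mult_mat2)

text \<open>As \<open>W\<close> is isometric, any admissible factorisation \<open>V ** H\<close> has
  \<open>H ** H = C^T C\<close>, so \<open>H\<close> is the unique positive root; it is invertible
  and determines \<open>V\<close>. The polar factor of an infinite matrix thus reduces to the 2x2
  case.\<close>

lemma polar_factor_eq:
  assumes W: "W \<in> V2" and C: "det C \<noteq> 0"
  shows "polar_factor (\<lambda>i. W i ** C) = (\<lambda>i. W i ** polar2 C)"
  unfolding polar_factor_def
proof (rule the_equality)
  have Wf: "fin_supp W" "transpose_mult W W = mat 1" using W by (simp_all add: V2_def)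
  let ?G = "transpose C ** C"
  have fs: "fin_supp (\<lambda>i. W i ** X)" for X
    by (rule fin_supp_mult[OF Wf(1)])
  show "(\<lambda>i. W i ** polar2 C) \<in> V2 \<and> (\<exists>H :: mat2. transpose H = H \<and> (\<forall>x. 0 \<le> x \<bullet> (H *v x)) \<and> (\<forall>i. W i ** C = W i ** polar2 C ** H))"
  proof (intro conjI exI[of _ "psqrt ?G"] allI)
    show "(\<lambda>i. W i ** polar2 C) \<in> V2"
      using polar2_orthogonal[OF C] by (simp add: V2_def fs transpose_mult_mult Wf orthogonal_matrix)
    show "transpose (psqrt ?G) = psqrt ?G" by (rule psqrt_sym[OF C refl refl refl])
    show "0 \<le> x \<bullet> (psqrt ?G *v x)" for x by (rule psqrt_psd[OF C refl refl refl])
    show "W i ** C = W i ** polar2 C ** psqrt ?G" for i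
      using polar2_mult_psqrt[OF C] by (simp flip: matrix_mul_assoc)
  qed
  fix V assume "V \<in> V2 \<and> (\<exists>H :: mat2. transpose H = H \<and> (\<forall>x. 0 \<le> x \<bullet> (H *v x)) \<and> (\<forall>i. W i ** C = V i ** H))"
  then obtain H :: mat2 where V: "fin_supp V" "transpose_mult V V = mat 1"
    and H: "transpose H = H" "\<And>x. 0 \<le> x \<bullet> (H *v x)" and eq: "\<And>i. W i ** C = V i ** H"
    by (auto simp: V2_def)
  have "?G = transpose_mult (\<lambda>i. W i ** C) (\<lambda>i. W i ** C)" by (simp add: transpose_mult_mult Wf)
  also have "\<dots> = H ** H" unfolding eq by (simp add: transpose_mult_mult V H)
  finally have "H = psqrt ?G" using psqrt_unique[OF C refl refl refl H] by simp
  then have "V i = W i ** C ** psqrt_inv ?G" for i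
    unfolding eq using psqrt_mult_inv(1)[OF C refl refl refl] by (simp flip: matrix_mul_assoc)
  then show "V = (\<lambda>i. W i ** polar2 C)" by (auto simp: polar2_def matrix_mul_assoc)
qed

section \<open>The exact cocycle near an approximate one\<close>

lemma coemb_sum:
  assumes "finite F" "\<And>i. i \<notin> F \<Longrightarrow> A i = 0"
  shows "coemb A x = (\<Sum>k\<in>F. transpose (A k) *v fsv_nth x k)"
proof -
  have A: "fin_supp A" using assms by (rule fin_supp_subset)
  have "emb A (axis s 1) \<bullet> x = (\<Sum>k\<in>F. (A k *v axis s 1) \<bullet> fsv_nth x k)" for s
    by (subst inner_fsv_sum[OF assms(1)]) (auto simp: fsv_nth_emb[OF A] assms(2))
  also have "(\<Sum>k\<in>F. (A k *v axis s 1) \<bullet> fsv_nth x k) = (\<Sum>k\<in>F. transpose (A k) *v fsv_nth x k) $ s" for s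
    by (simp add: inner_mat2_transpose[of "axis s 1" "transpose _", simplified, symmetric] inner_axis')
  finally show ?thesis by (simp add: coemb_def vec_eq_iff)
qed

definition col_mat :: "fsv \<Rightarrow> fsv \<Rightarrow> rinf2" where
  "col_mat v w i = (\<chi> s a. (if a = 1 then fsv_nth v i else fsv_nth w i) $ s)"

definition proj_mat :: "fsv \<Rightarrow> fsv \<Rightarrow> rinfinf" where
  "proj_mat v w = (\<lambda>i k. \<chi> s t. fsv_nth v i $ s * fsv_nth v k $ t + fsv_nth w i $ s * fsv_nth w k $ t)"

text \<open>The entries are coordinates of projected basis vectors, so the matrix depends on the
  plane alone.\<close>

lemma proj_mat_span_proj: "proj_mat v w i k $ s $ t = fsv_nth (span_proj v w (fsv_single k (axis t 1))) i $ s"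
  by (simp add: proj_mat_def span_proj_def inner_commute[of v] inner_commute[of w] inner_fsv_single inner_axis' mult.commute)

lemma fin_supp_col_mat: "fin_supp (col_mat v w)"
  by (rule fin_supp_subset[of "{i. fsv_nth v i \<noteq> 0} \<union> {i. fsv_nth w i \<noteq> 0}"])
    (simp_all add: finite_supp_fsv, simp add: col_mat_def vec_eq_iff)

lemma emb_col_mat: "emb (col_mat v w) (axis s 1) = (if s = 1 then v else w)"
  by (auto simp: fsv_eq_iff fsv_nth_emb[OF fin_supp_col_mat] matrix_vector_mult_basis column_def col_mat_def vec_eq_iff)

lemma col_mat_in_V2:
  assumes "v \<bullet> v = 1" "w \<bullet> w = 1" "v \<bullet> w = 0"
  shows "col_mat v w \<in> V2"
proof -
  have "transpose_mult (col_mat v w) (col_mat v w) = mat 1"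
    using assms by (simp add: mat2_eq_iff transpose_mult_nth fin_supp_col_mat emb_col_mat inner_commute)
  then show ?thesis by (simp add: V2_def fin_supp_col_mat)
qed

text \<open>With \<open>W\<close> the matrix of columns \<open>v\<close>, \<open>w\<close>, the
  projection is \<open>W W^T\<close>, and \<open>W^T A\<close> is the 2x2 factor on the
  right.\<close>

lemma inf_mult_proj_mat:
  assumes "fin_supp A"
  shows "inf_mult (proj_mat v w) A = (\<lambda>i. col_mat v w i ** (\<chi> a s. (if a = 1 then v else w) \<bullet> emb A (axis s 1)))"
proof
  fix i
  define F where "F = {k. A k \<noteq> 0}"
  have F: "finite F" "\<And>k. k \<notin> F \<Longrightarrow> A k = 0" using assms by (auto simp: F_def fin_supp_def)
  have u: "u \<bullet> emb A (axis s 1) = (\<Sum>k\<in>F. fsv_nth u k $ 1 * A k $ 1 $ s + fsv_nth u k $ 2 * A k $ 2 $ s)" for u s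
    by (subst inner_fsv_sum[OF F(1)])
      (auto simp: fsv_nth_emb[OF assms] F(2) inner_vec2 matrix_vector_mult_basis column_def)
  have "inf_mult (proj_mat v w) A i = (\<Sum>k\<in>F. proj_mat v w i k ** A k)"
    unfolding inf_mult_def by (rule Sum_any.expand_superset[OF F(1)]) (auto simp: F_def zero_mult_mat2)
  moreover have "(\<Sum>k\<in>F. M k) $ s $ t = (\<Sum>k\<in>F. M k $ s $ t)" for M :: "nat \<Rightarrow> mat2" and s t by simp
  ultimately have eq: "inf_mult (proj_mat v w) A i $ s $ t =
     fsv_nth v i $ s * (v \<bullet> emb A (axis t 1)) + fsv_nth w i $ s * (w \<bullet> emb A (axis t 1))" for s t
    unfolding u sum_distrib_left sum.distrib[symmetric]
    by (simp add: mat2_mult_nth proj_mat_def algebra_simps)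
  show "inf_mult (proj_mat v w) A i = col_mat v w i ** (\<chi> a s. (if a = 1 then v else w) \<bullet> emb A (axis s 1))"
    unfolding mat2_eq_iff mat2_mult_nth eq by (simp add: col_mat_def)
qed

lemma continuous_on_open_tendsto:
  assumes "open S"
  shows "continuous_on S f \<longleftrightarrow> (\<forall>x\<in>S. (f \<longlongrightarrow> f x) (at x))"
  unfolding continuous_on_def by (simp add: at_within_open[OF _ assms])

locale approx_cocycle =
  fixes J :: "nat set" and U :: "nat \<Rightarrow> 'a::topological_space set" and \<rho> :: "nat \<Rightarrow> 'a \<Rightarrow> real"
    and \<Omega> :: "'a O2_cochain" and \<epsilon> :: real
  assumes \<Omega>: "\<Omega> \<in> pointwise_Z1 J U \<epsilon>" and eps: "0 \<le> \<epsilon>" "\<epsilon> < 1 / 9"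
    and U: "\<And>j. j \<in> J \<Longrightarrow> open (U j)"
    and lf: "\<And>x. \<exists>V. open V \<and> x \<in> V \<and> finite {j\<in>J. U j \<inter> V \<noteq> {}}"
    and pou: "partition_of_unity J U \<rho>"
begin

definition I :: "'a \<Rightarrow> nat set" where "I b = {j\<in>J. \<rho> j b \<noteq> 0}"

text \<open>Larger than \<open>I b\<close>: frames of weight zero at \<open>b\<close> are also
  compared with the average, since \<open>Pi_Z\<close> is evaluated on all of
  \<open>U j\<close>.\<close>

definition K :: "'a \<Rightarrow> nat set" where "K b = {j\<in>J. b \<in> U j}"

abbreviation "\<Psi> \<equiv> Psi J \<rho> \<Omega>"

abbreviation "cl \<equiv> cl_map J \<rho> \<Omega>"

abbreviation "eigen_data b \<equiv>
  eigen_frames (I b) (K b) (\<lambda>j. \<rho> j b) (\<lambda>j. emb (\<Psi> j b)) (\<lambda>j. coemb (\<Psi> j b)) (\<lambda>j k. \<Omega> j k b) \<epsilon>"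

abbreviation "avg_at b \<equiv> frames.avg (I b) (\<lambda>j. \<rho> j b) (\<lambda>j. emb (\<Psi> j b)) (\<lambda>j. coemb (\<Psi> j b))"

abbreviation "form_at b \<equiv> frames.form (I b) (\<lambda>j. \<rho> j b) (\<lambda>j. coemb (\<Psi> j b))"

lemma rho:
  "j \<in> J \<Longrightarrow> continuous_on A (\<rho> j)" "j \<in> J \<Longrightarrow> 0 \<le> \<rho> j b" "j \<in> J \<Longrightarrow> \<rho> j b \<noteq> 0 \<Longrightarrow> b \<in> U j"
  "j \<in> J \<Longrightarrow> closure {b. \<rho> j b \<noteq> 0} \<subseteq> U j" "finite (I b)" "(\<Sum>j\<in>I b. \<rho> j b) = 1"
proof -
  show c: "j \<in> J \<Longrightarrow> closure {b. \<rho> j b \<noteq> 0} \<subseteq> U j" using pou by (simp add: partition_of_unity_def)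
  then show "j \<in> J \<Longrightarrow> \<rho> j b \<noteq> 0 \<Longrightarrow> b \<in> U j" using closure_subset by fastforce
  show "j \<in> J \<Longrightarrow> continuous_on A (\<rho> j)"
    using pou continuous_on_subset[of UNIV "\<rho> j" A] by (simp add: partition_of_unity_def)
qed (use pou in \<open>auto simp: partition_of_unity_def I_def\<close>)

lemma I_subset_K: "I b \<subseteq> K b"
  using rho(3) by (auto simp: I_def K_def)

lemma Psi_zero: "i \<notin> I b \<Longrightarrow> \<Psi> j b i = 0"
  by (auto simp: Psi_def I_def)

lemma Psi_eq: "i \<in> J \<Longrightarrow> \<Psi> j b i = sqrt (\<rho> i b) *\<^sub>R \<Omega> i j b"
  by (simp add: Psi_def)

lemma fin_supp_Psi: "fin_supp (\<Psi> j b)"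
  by (rule fin_supp_subset[OF rho(5)]) (rule Psi_zero)

lemma orth: "j \<in> K b \<Longrightarrow> k \<in> K b \<Longrightarrow> orthogonal_matrix (\<Omega> j k b)"
  by (rule C1_O2D(2)[OF pointwise_Z1D(1)[OF \<Omega>]]) (auto simp: K_def)

lemma orth_inner:
  assumes "j \<in> K b" "k \<in> K b"
  shows "(\<Omega> j k b *v x) \<bullet> (\<Omega> j k b *v y) = x \<bullet> y"
  using orth[OF assms] by (simp add: orthogonal_matrix flip: inner_gram_mat2)

lemma emb_Psi_inner:
  "emb (\<Psi> j b) x \<bullet> y = (\<Sum>i\<in>I b. (\<Psi> j b i *v x) \<bullet> fsv_nth y i)"
  by (subst inner_fsv_sum[OF rho(5)]) (auto simp: fsv_nth_emb[OF fin_supp_Psi] Psi_zero)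

lemma emb_Psi_isometry:
  assumes "j \<in> K b"
  shows "emb (\<Psi> j b) x \<bullet> emb (\<Psi> j b) y = x \<bullet> y"
proof -
  have "(\<Psi> j b i *v x) \<bullet> (\<Psi> j b i *v y) = \<rho> i b * (x \<bullet> y)" if i: "i \<in> I b" for i
  proof -
    have "i \<in> J" "i \<in> K b" using i I_subset_K by (auto simp: I_def)
    have "(\<Psi> j b i *v x) \<bullet> (\<Psi> j b i *v y) = (sqrt (\<rho> i b) * sqrt (\<rho> i b)) * ((\<Omega> i j b *v x) \<bullet> (\<Omega> i j b *v y))"
      by (simp add: Psi_eq[OF \<open>i \<in> J\<close>] flip: scaleR_matrix_vector_assoc)
    then show ?thesis using rho(2)[OF \<open>i \<in> J\<close>, of b] by (simp add: orth_inner[OF \<open>i \<in> K b\<close> assms])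
  qed
  then have "emb (\<Psi> j b) x \<bullet> emb (\<Psi> j b) y = (\<Sum>i\<in>I b. \<rho> i b * (x \<bullet> y))"
    unfolding emb_Psi_inner by (simp add: fsv_nth_emb[OF fin_supp_Psi])
  then show ?thesis by (simp add: rho(6) flip: sum_distrib_right)
qed

text \<open>The \<open>i\<close>-th block of the difference of two frames is
  \<open>sqrt (\<rho> i b)\<close> times the cocycle defect at \<open>i\<close>, \<open>k\<close>,
  \<open>j\<close>. The weights sum to 1, so the bound on the defect passes to the frames.\<close>

lemma frames_at: "frames (I b) (K b) (\<lambda>j. \<rho> j b) (\<lambda>j. emb (\<Psi> j b)) (\<lambda>j. coemb (\<Psi> j b)) (\<lambda>j k. \<Omega> j k b) \<epsilon>"
proof (rule frames.intro)
  show "coemb (\<Psi> j b) (emb (\<Psi> j b) y) = y" if "j \<in> K b" for j y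
  proof -
    have "z \<bullet> coemb (\<Psi> j b) (emb (\<Psi> j b) y) = z \<bullet> y" for z
      using emb_Psi_isometry[OF that] by (simp flip: emb_inner[OF fin_supp_Psi])
    then show ?thesis using vector_eq_ldot[of "coemb (\<Psi> j b) (emb (\<Psi> j b) y)" y] by blast
  qed
  show "norm (emb (\<Psi> j b) y - emb (\<Psi> k b) (\<Omega> k j b *v y)) \<le> \<epsilon> * norm y" if jk: "j \<in> K b" "k \<in> K b" for j k y
  proof (rule power2_le_imp_le)
    define z where "z = emb (\<Psi> j b) y - emb (\<Psi> k b) (\<Omega> k j b *v y)"
    have zi: "fsv_nth z i = \<Psi> j b i *v y - \<Psi> k b i *v (\<Omega> k j b *v y)" for i
      by (simp add: z_def fsv_nth_emb[OF fin_supp_Psi])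
    have "(norm z)\<^sup>2 = (\<Sum>i\<in>I b. (norm (fsv_nth z i))\<^sup>2)"
      unfolding power2_norm_eq_inner by (rule inner_fsv_sum[OF rho(5)]) (simp add: zi Psi_zero)
    also have "\<dots> \<le> (\<Sum>i\<in>I b. \<rho> i b * (\<epsilon> * norm y)\<^sup>2)"
    proof (rule sum_mono)
      fix i assume "i \<in> I b"
      then have i: "i \<in> J" "b \<in> U i" using I_subset_K by (auto simp: I_def K_def)
      have "fsv_nth z i = sqrt (\<rho> i b) *\<^sub>R ((\<Omega> i j b - \<Omega> i k b ** \<Omega> k j b) *v y)"
        unfolding zi Psi_eq[OF i(1)] scaleR_matrix_vector_assoc[symmetric] matrix_vector_mult_diff_rdistrib
          matrix_vector_mul_assoc[symmetric] scaleR_diff_right ..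
      then have "(norm (fsv_nth z i))\<^sup>2 = \<rho> i b * (norm ((\<Omega> i j b - \<Omega> i k b ** \<Omega> k j b) *v y))\<^sup>2"
        using rho(2)[OF i(1), of b] by (simp add: power_mult_distrib)
      moreover have "norm ((\<Omega> i j b - \<Omega> i k b ** \<Omega> k j b) *v y) \<le> \<epsilon> * norm y"
      proof (rule order_trans[OF norm_mat2_vec_le mult_right_mono])
        show "norm (\<Omega> i j b - \<Omega> i k b ** \<Omega> k j b) \<le> \<epsilon>"
          using pointwise_Z1D(2)[OF \<Omega> i(1), of k j b] jk i(2) by (auto simp: K_def norm_minus_commute)
      qed simp
      ultimately show "(norm (fsv_nth z i))\<^sup>2 \<le> \<rho> i b * (\<epsilon> * norm y)\<^sup>2"
        using rho(2)[OF i(1), of b] by (simp add: mult_left_mono power_mono)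
    qed
    also have "\<dots> = (\<epsilon> * norm y)\<^sup>2" by (simp add: rho(6) flip: sum_distrib_right)
    finally show "(norm (emb (\<Psi> j b) y - emb (\<Psi> k b) (\<Omega> k j b *v y)))\<^sup>2 \<le> (\<epsilon> * norm y)\<^sup>2" by (simp add: z_def)
  qed (use eps in simp)
qed (use rho I_subset_K linear_emb[OF fin_supp_Psi] emb_inner[OF fin_supp_Psi] orth eps in \<open>auto simp: I_def\<close>)

text \<open>Identifies the abstract average with multiplication by the block matrix
  \<open>cl\<close>, whose eigenvectors define \<open>f_map\<close>.\<close>

lemma frames_avg_nth:
  "fsv_nth (avg_at b x) i = (\<Sum>k\<in>I b. cl b i k *v fsv_nth x k)"
proof -
  interpret frames "I b" "K b" "\<lambda>j. \<rho> j b" "\<lambda>j. emb (\<Psi> j b)" "\<lambda>j. coemb (\<Psi> j b)" "\<lambda>j k. \<Omega> j k b" \<epsilon>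
    by (rule frames_at)
  have s: "fsv_nth (sum f A) i = (\<Sum>j\<in>A. fsv_nth (f j) i)" for f :: "nat \<Rightarrow> fsv" and A
    by (induction A rule: infinite_finite_induct) auto
  have m: "(\<Sum>j\<in>A. M j) *v x = (\<Sum>j\<in>A. M j *v x)" for M :: "nat \<Rightarrow> mat2" and A x
    by (induction A rule: infinite_finite_induct) (auto simp: matrix_vector_mult_add_rdistrib)
  have m': "M *v (\<Sum>j\<in>A. f j) = (\<Sum>j\<in>A. M *v f j)" for M :: mat2 and A and f :: "nat \<Rightarrow> real^2"
    by (induction A rule: infinite_finite_induct) (auto simp: matrix_vector_right_distrib)
  have "fsv_nth (avg x) i = (\<Sum>j\<in>I b. \<Sum>k\<in>I b. \<rho> j b *\<^sub>R (\<Psi> j b i *v (transpose (\<Psi> j b k) *v fsv_nth x k)))"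
    unfolding avg_def s
    by (simp add: fsv_nth_emb[OF fin_supp_Psi] coemb_sum[OF rho(5) Psi_zero] m' scaleR_sum_right del: transpose_matrix_vector)
  also have "\<dots> = (\<Sum>k\<in>I b. \<Sum>j\<in>I b. \<rho> j b *\<^sub>R (\<Psi> j b i *v (transpose (\<Psi> j b k) *v fsv_nth x k)))"
    by (rule sum.swap)
  also have "\<dots> = (\<Sum>k\<in>I b. cl b i k *v fsv_nth x k)"
    unfolding cl_map_def m I_def[symmetric] by (simp add: matrix_vector_mul_assoc flip: scaleR_matrix_vector_assoc del: transpose_matrix_vector)
  finally show ?thesis .
qed

lemma cl_zero: "i \<notin> I b \<or> k \<notin> I b \<Longrightarrow> cl b i k = 0"
  unfolding cl_map_def by (intro sum.neutral) (auto simp: Psi_zero zero_mult_mat2 transpose_def mat2_eq_iff mat2_mult_nth)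

lemma sym_part_cl: "sym_part (cl b) = cl b"
proof (intro ext)
  fix i k
  have t: "transpose (\<Sum>j\<in>A. M j) = (\<Sum>j\<in>A. transpose (M j))" for M :: "nat \<Rightarrow> mat2" and A
    by (induction A rule: infinite_finite_induct) (auto simp: transpose_def vec_eq_iff)
  have t': "transpose (c *\<^sub>R M) = c *\<^sub>R transpose M" for c and M :: mat2 by (simp add: transpose_def vec_eq_iff)
  have "transpose (cl b k i) = cl b i k"
    unfolding cl_map_def t t' by (simp add: matrix_transpose_mul)
  then show "sym_part (cl b) i k = cl b i k" by (simp add: sym_part_def flip: scaleR_2)
qed

section \<open>The top eigenplane of the averaged projections\<close>

lemma is_eigenvector_cl:
  "is_eigenvector (sym_part (cl b)) (fsv_nth x) \<mu> \<longleftrightarrow>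
    x \<noteq> 0 \<and> avg_at b x = \<mu> *\<^sub>R x"
proof -
  have "inf_mult_vec (cl b) (fsv_nth x) i = (\<Sum>k\<in>I b. cl b i k *v fsv_nth x k)" for i
    unfolding inf_mult_vec_def by (rule Sum_any.expand_superset[OF rho(5)]) (rule subsetI, rule ccontr, simp add: cl_zero)
  moreover have "fsv_nth x \<noteq> (\<lambda>i. 0) \<longleftrightarrow> x \<noteq> 0" by (auto simp: fsv_eq_iff fun_eq_iff)
  ultimately show ?thesis
    unfolding is_eigenvector_def sym_part_cl by (simp add: fin_supp_fsv_nth fsv_eq_iff[of "avg_at _ _"] frames_avg_nth)
qed

definition eigen_at :: "'a \<Rightarrow> fsv \<Rightarrow> fsv \<Rightarrow> bool" where
  "eigen_at b v w \<longleftrightarrow> (\<exists>\<mu> \<nu>. eigen_data b v w \<mu> \<nu>)"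

lemma eigen_at_exists: "\<exists>v w. eigen_at b v w"
proof -
  interpret frames "I b" "K b" "\<lambda>j. \<rho> j b" "\<lambda>j. emb (\<Psi> j b)" "\<lambda>j. coemb (\<Psi> j b)" "\<lambda>j k. \<Omega> j k b" \<epsilon>
    by (rule frames_at)
  have supp: "emb (\<Psi> j b) y \<in> fsv_supp (I b)" for j y
    by (simp add: fsv_supp_def fsv_nth_emb[OF fin_supp_Psi] Psi_zero)
  show ?thesis
    by (rule eigen_frames_exists[OF subspace_fsv_supp compact_fsv_supp_sphere[OF rho(5)] supp])
      (unfold eigen_at_def, rule exI, rule exI, rule exI, rule exI, assumption)
qed

lemma is_top_projection_cl:
  "is_top_projection (cl b) P \<longleftrightarrow>
    (\<exists>v w \<mu> \<nu>. frames.top_pair (I b) (\<lambda>j. \<rho> j b) (\<lambda>j. emb (\<Psi> j b)) (\<lambda>j. coemb (\<Psi> j b)) v w \<mu> \<nu> \<and> P = proj_mat v w)"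
proof -
  interpret frames "I b" "K b" "\<lambda>j. \<rho> j b" "\<lambda>j. emb (\<Psi> j b)" "\<lambda>j. coemb (\<Psi> j b)" "\<lambda>j k. \<Omega> j k b" \<epsilon>
    by (rule frames_at)
  \<comment> \<open>Eigenvectors are finitely supported by definition, so quantifying over
    \<open>fsv\<close> loses none.\<close>
  have ex: "(\<exists>v. is_eigenvector M v \<mu> \<and> R v) \<longleftrightarrow> (\<exists>x. is_eigenvector M (fsv_nth x) \<mu> \<and> R (fsv_nth x))" for M R \<mu>
    unfolding is_eigenvector_def by (metis fsv_nth_Fsv)
  have all: "(\<forall>u \<kappa>. is_eigenvector M u \<kappa> \<and> R u \<longrightarrow> S \<kappa>) \<longleftrightarrow> (\<forall>x \<kappa>. is_eigenvector M (fsv_nth x) \<kappa> \<and> R (fsv_nth x) \<longrightarrow> S \<kappa>)" for M R S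
    unfolding is_eigenvector_def by (metis fsv_nth_Fsv)
  show ?thesis
  proof
    assume "is_top_projection (cl b) P"
    then obtain v w \<mu> \<nu> where t: "is_eigenvector (sym_part (cl b)) v \<mu>" "is_eigenvector (sym_part (cl b)) w \<nu>"
      "inf_inner v v = 1" "inf_inner w w = 1" "inf_inner v w = 0" "\<nu> \<le> \<mu>"
      "\<And>u \<kappa>. is_eigenvector (sym_part (cl b)) u \<kappa> \<and> inf_inner u v = 0 \<and> inf_inner u w = 0 \<Longrightarrow> \<kappa> < \<nu>"
      "P = (\<lambda>i k. \<chi> s t. v i $ s * v k $ t + w i $ s * w k $ t)"
      unfolding is_top_projection_def by blast
    define x y where "x = Fsv v" and "y = Fsv w"
    have xy: "v = fsv_nth x" "w = fsv_nth y"
      using t(1,2) by (simp_all add: x_def y_def is_eigenvector_def fsv_nth_Fsv)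
    have "top_pair x y \<mu> \<nu>"
      using t(1-6) t(7)[of "fsv_nth _"] unfolding xy top_pair_def is_eigenvector_cl inner_fsv_def by blast
    moreover have "P = proj_mat x y" unfolding t(8) xy proj_mat_def ..
    ultimately show "\<exists>v w \<mu> \<nu>. top_pair v w \<mu> \<nu> \<and> P = proj_mat v w" by blast
  next
    assume "\<exists>v w \<mu> \<nu>. top_pair v w \<mu> \<nu> \<and> P = proj_mat v w"
    then obtain v w \<mu> \<nu> where t: "top_pair v w \<mu> \<nu>" "P = proj_mat v w" by blast
    have "v \<noteq> 0" "w \<noteq> 0" using t(1) by (auto simp: top_pair_def)
    show "is_top_projection (cl b) P"
      unfolding is_top_projection_def
    proof (rule exI[of _ "fsv_nth v"], rule exI[of _ "fsv_nth w"], rule exI[of _ \<mu>], rule exI[of _ \<nu>],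
        intro conjI allI impI)
      fix u \<kappa> assume u: "is_eigenvector (sym_part (cl b)) u \<kappa> \<and> inf_inner u (fsv_nth v) = 0 \<and> inf_inner u (fsv_nth w) = 0"
      define x where "x = Fsv u"
      have x: "u = fsv_nth x" using u by (simp add: x_def is_eigenvector_def fsv_nth_Fsv)
      show "\<kappa> < \<nu>" using u t(1) unfolding x top_pair_def is_eigenvector_cl inner_fsv_def by blast
    qed (use t \<open>v \<noteq> 0\<close> \<open>w \<noteq> 0\<close> in \<open>auto simp: is_eigenvector_cl top_pair_def proj_mat_def inner_fsv_def\<close>)
  qed
qed

lemma f_map_eq:
  assumes "eigen_at b v w"
  shows "f_map J \<rho> \<Omega> b = proj_mat v w"
proof -
  obtain \<mu> \<nu> where "eigen_data b v w \<mu> \<nu>"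
    using assms unfolding eigen_at_def by blast
  then interpret eigen_frames "I b" "K b" "\<lambda>j. \<rho> j b" "\<lambda>j. emb (\<Psi> j b)" "\<lambda>j. coemb (\<Psi> j b)" "\<lambda>j k. \<Omega> j k b" \<epsilon> v w \<mu> \<nu> .
  show ?thesis unfolding f_map_def top_projection_def is_top_projection_cl
  proof (rule the_equality)
    show "\<exists>v' w' \<mu> \<nu>. top_pair v' w' \<mu> \<nu> \<and> proj_mat v w = proj_mat v' w'" using top_pair by blast
    fix P assume "\<exists>v w \<mu> \<nu>. top_pair v w \<mu> \<nu> \<and> P = proj_mat v w"
    then obtain v' w' \<mu>' \<nu>' where t: "top_pair v' w' \<mu>' \<nu>'" "P = proj_mat v' w'" by blast
    have "span_proj v' w' = span_proj v w" by (rule top_pair_unique[OF t(1) top_pair])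
    then show "P = proj_mat v w" unfolding t(2) by (intro ext) (simp add: vec_eq_iff proj_mat_span_proj)
  qed
qed

text \<open>The matrix of the projected frame with \<open>v\<close> and \<open>w\<close> as
  arguments, because they vary with the point in the continuity proof.\<close>

definition Cmat :: "fsv \<Rightarrow> fsv \<Rightarrow> nat \<Rightarrow> 'a \<Rightarrow> mat2" where
  "Cmat v w j b = (\<chi> a s. (if a = 1 then v else w) \<bullet> emb (\<Psi> j b) (axis s 1))"

lemma eigen_at_Pi_Z:
  assumes e: "eigen_at b v w" and jk: "j \<in> K b" "k \<in> K b"
  shows "det (Cmat v w j b) \<noteq> 0"
    "Pi_Z J \<rho> \<Omega> j k b = transpose (polar2 (Cmat v w j b)) ** polar2 (Cmat v w k b)"
    "norm (Pi_Z J \<rho> \<Omega> j k b - \<Omega> j k b) < 1"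
    "(transpose (Cmat v w j b) ** Cmat v w k b) $ s $ t = span_proj v w (emb (\<Psi> j b) (axis s 1)) \<bullet> emb (\<Psi> k b) (axis t 1)"
proof -
  obtain \<mu> \<nu> where "eigen_data b v w \<mu> \<nu>"
    using e unfolding eigen_at_def by blast
  then interpret eigen_frames "I b" "K b" "\<lambda>j. \<rho> j b" "\<lambda>j. emb (\<Psi> j b)" "\<lambda>j. coemb (\<Psi> j b)" "\<lambda>j k. \<Omega> j k b" \<epsilon> v w \<mu> \<nu> .
  have C: "Cmat v w j b = C j" for j unfolding Cmat_def C_def ..
  have W: "col_mat v w \<in> V2" by (rule col_mat_in_V2[OF on])
  have pt: "Psi_tilde J \<rho> \<Omega> j b = (\<lambda>i. col_mat v w i ** polar2 (C j))" if "j \<in> K b" for j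
    unfolding Psi_tilde_def f_map_eq[OF e] inf_mult_proj_mat[OF fin_supp_Psi] Cmat_def[symmetric] C
    by (rule polar_factor_eq[OF W C_invertible[OF that]])
  show "det (Cmat v w j b) \<noteq> 0" unfolding C by (rule C_invertible[OF jk(1)])
  show P: "Pi_Z J \<rho> \<Omega> j k b = transpose (polar2 (Cmat v w j b)) ** polar2 (Cmat v w k b)"
    unfolding Pi_Z_def pt[OF jk(1)] pt[OF jk(2)] C using W by (simp add: transpose_mult_mult V2_def)
  show "norm (Pi_Z J \<rho> \<Omega> j k b - \<Omega> j k b) < 1"
    unfolding P unfolding C by (rule polar2_norm_close[OF jk])
  show "(transpose (Cmat v w j b) ** Cmat v w k b) $ s $ t = span_proj v w (emb (\<Psi> j b) (axis s 1)) \<bullet> emb (\<Psi> k b) (axis t 1)"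
    unfolding C by (rule gram_C)
qed

subsection \<open>Continuity\<close>

text \<open>\<open>\<Omega> i j\<close> is controlled only on \<open>U i \<inter> U j\<close>, but
  \<open>\<rho> i\<close> vanishes outside a closed set inside \<open>U i\<close>; continuity is
  pasted from the open sets \<open>U j \<inter> U i\<close> and
  \<open>U j \<inter> N\<close>.\<close>

lemma continuous_on_Psi:
  assumes j: "j \<in> J"
  shows "continuous_on (U j) (\<lambda>b. \<Psi> j b i)"
proof (cases "i \<in> J")
  case False
  then show ?thesis by (simp add: Psi_def)
next
  case i: True
  define N where "N = - closure {b. \<rho> i b \<noteq> 0}"
  have N: "open N" "\<And>b. b \<in> N \<Longrightarrow> \<rho> i b = 0" "- N \<subseteq> U i"
    using closure_subset[of "{b. \<rho> i b \<noteq> 0}"] rho(4)[OF i] by (auto simp: N_def)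
  have "continuous_on ((U j \<inter> U i) \<union> (U j \<inter> N)) (\<lambda>b. \<Psi> j b i)"
  proof (rule continuous_on_open_Un)
    have "continuous_on (U i \<inter> U j) (\<lambda>b. sqrt (\<rho> i b) *\<^sub>R \<Omega> i j b)"
      by (intro continuous_intros rho(1)[OF i] C1_O2D(1)[OF pointwise_Z1D(1)[OF \<Omega>] i j])
    then show "continuous_on (U j \<inter> U i) (\<lambda>b. \<Psi> j b i)" by (simp add: Psi_eq[OF i] Int_commute)
    have "continuous_on (U j \<inter> N) (\<lambda>b. 0 :: mat2)" by simp
    then show "continuous_on (U j \<inter> N) (\<lambda>b. \<Psi> j b i)"
      by (rule continuous_on_eq) (use N in \<open>simp add: Psi_def\<close>)
  qed (use U i j N in auto)
  moreover have "(U j \<inter> U i) \<union> (U j \<inter> N) = U j" using N by auto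
  ultimately show ?thesis by simp
qed

text \<open>The same pasting along the support of \<open>\<rho> j\<close> makes the term continuous
  on the whole space.\<close>

lemma continuous_on_cl_term:
  assumes j: "j \<in> J"
  shows "continuous_on UNIV (\<lambda>b. \<rho> j b *\<^sub>R (\<Psi> j b i ** transpose (\<Psi> j b k)))"
proof -
  define N where "N = - closure {b. \<rho> j b \<noteq> 0}"
  have N: "open N" "\<And>b. b \<in> N \<Longrightarrow> \<rho> j b = 0" "- N \<subseteq> U j"
    using closure_subset[of "{b. \<rho> j b \<noteq> 0}"] rho(4)[OF j] by (auto simp: N_def)
  have "continuous_on (U j \<union> N) (\<lambda>b. \<rho> j b *\<^sub>R (\<Psi> j b i ** transpose (\<Psi> j b k)))"
  proof (rule continuous_on_open_Un)
    show "continuous_on (U j) (\<lambda>b. \<rho> j b *\<^sub>R (\<Psi> j b i ** transpose (\<Psi> j b k)))"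
      by (intro continuous_intros rho(1)[OF j] continuous_on_Psi[OF j])
    have "continuous_on N (\<lambda>b. 0 :: mat2)" by simp
    then show "continuous_on N (\<lambda>b. \<rho> j b *\<^sub>R (\<Psi> j b i ** transpose (\<Psi> j b k)))"
      by (rule continuous_on_eq) (use N in simp)
  qed (use U j N in auto)
  moreover have "U j \<union> N = UNIV" using N by auto
  ultimately show ?thesis by simp
qed

lemma locally_finite_at:
  obtains V F where "open V" "b \<in> V" "finite F" "F \<subseteq> J" "\<And>x. x \<in> V \<Longrightarrow> I x \<subseteq> F"
proof -
  obtain V where V: "open V" "b \<in> V" "finite {j\<in>J. U j \<inter> V \<noteq> {}}" using lf by blast
  have "I x \<subseteq> {j\<in>J. U j \<inter> V \<noteq> {}}" if "x \<in> V" for x using rho(3) that by (fastforce simp: I_def)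
  then show thesis using that[OF V] by blast
qed

lemma tendsto_emb_Psi:
  assumes j: "j \<in> J" and b: "b \<in> U j"
  shows "((\<lambda>x. emb (\<Psi> j x) y) \<longlongrightarrow> emb (\<Psi> j b) y) (at b)"
proof -
  obtain V F where V: "open V" "b \<in> V" "finite F" "F \<subseteq> J" "\<And>x. x \<in> V \<Longrightarrow> I x \<subseteq> F" using locally_finite_at[of b] by blast
  have t: "((\<lambda>x. \<Psi> j x i) \<longlongrightarrow> \<Psi> j b i) (at b)" for i
    using continuous_on_Psi[OF j, of i] U[OF j] b by (simp add: continuous_on_open_tendsto)
  \<comment> \<open>Near \<open>b\<close> only the blocks over the finite set \<open>F\<close> are
    nonzero, so blockwise convergence gives convergence in norm.\<close>
  have lim: "((\<lambda>x. \<Sum>i\<in>F. fsv_single i (\<Psi> j x i *v y)) \<longlongrightarrow> (\<Sum>i\<in>F. fsv_single i (\<Psi> j b i *v y))) (at b)"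
  proof (rule tendsto_sum)
    fix i
    have 1: "norm (fsv_single i (\<Psi> j x i *v y) - fsv_single i (\<Psi> j b i *v y)) \<le> norm (\<Psi> j x i - \<Psi> j b i) * norm y" for x
    proof -
      have "fsv_single i (\<Psi> j x i *v y) - fsv_single i (\<Psi> j b i *v y) = fsv_single i ((\<Psi> j x i - \<Psi> j b i) *v y)"
        by (simp add: fsv_eq_iff matrix_vector_mult_diff_rdistrib)
      then show ?thesis by (simp add: norm_fsv_single norm_mat2_vec_le)
    qed
    have "((\<lambda>x. norm (\<Psi> j x i - \<Psi> j b i) * norm y) \<longlongrightarrow> norm (\<Psi> j b i - \<Psi> j b i) * norm y) (at b)"
      by (intro tendsto_intros t)
    then have "((\<lambda>x. fsv_single i (\<Psi> j x i *v y) - fsv_single i (\<Psi> j b i *v y)) \<longlongrightarrow> 0) (at b)"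
      by (intro Lim_null_comparison[OF always_eventually[OF allI[OF 1]]]) simp
    then show "((\<lambda>x. fsv_single i (\<Psi> j x i *v y)) \<longlongrightarrow> fsv_single i (\<Psi> j b i *v y)) (at b)"
      by (simp add: LIM_zero_iff)
  qed
  have eq: "(\<Sum>i\<in>F. fsv_single i (\<Psi> j x i *v y)) = emb (\<Psi> j x) y" if "x \<in> V" for x
  proof -
    have s: "fsv_nth (sum f A) k = (\<Sum>j\<in>A. fsv_nth (f j) k)" for f :: "nat \<Rightarrow> fsv" and A k
      by (induction A rule: infinite_finite_induct) auto
    have "(\<Sum>i\<in>F. if k = i then \<Psi> j x i *v y else 0) = \<Psi> j x k *v y" for k
    proof (cases "k \<in> F")
      case False
      then have "\<Psi> j x k = 0" using V(5)[OF that] by (intro Psi_zero) auto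
      with False V(3) show ?thesis by (simp add: sum.delta)
    qed (use V(3) in \<open>simp add: sum.delta\<close>)
    then show ?thesis by (simp add: fsv_eq_iff s fsv_nth_emb[OF fin_supp_Psi])
  qed
  have "eventually (\<lambda>x. (\<Sum>i\<in>F. fsv_single i (\<Psi> j x i *v y)) = emb (\<Psi> j x) y) (at b)"
    unfolding eventually_at_topological using V(1,2) eq by blast
  from Lim_transform_eventually[OF lim this] show ?thesis unfolding eq[OF V(2)] .
qed

text \<open>Supplies the \<open>\<eta>\<close> of the perturbation estimate; it tends to 0 by
  continuity of the finitely many blocks of \<open>cl\<close>.\<close>

lemma form_diff_le:
  fixes b c :: 'a
  assumes F: "finite F" "I b \<subseteq> F" "I c \<subseteq> F"
  shows "\<bar>form_at b x y - form_at c x y\<bar>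
    \<le> (\<Sum>i\<in>F. \<Sum>k\<in>F. norm (cl b i k - cl c i k)) * norm x * norm y"
proof -
  have form: "form_at b x y = (\<Sum>i\<in>F. \<Sum>k\<in>F. (cl b i k *v fsv_nth x k) \<bullet> fsv_nth y i)"
    if "I b \<subseteq> F" for b
  proof -
    interpret frames "I b" "K b" "\<lambda>j. \<rho> j b" "\<lambda>j. emb (\<Psi> j b)" "\<lambda>j. coemb (\<Psi> j b)" "\<lambda>j k. \<Omega> j k b" \<epsilon>
      by (rule frames_at)
    have e: "(\<Sum>k\<in>I b. cl b i k *v fsv_nth x k) = (\<Sum>k\<in>F. cl b i k *v fsv_nth x k)" for i
      using F(1) that by (intro sum.mono_neutral_left) (auto simp: cl_zero)
    have "form x y = (\<Sum>i\<in>F. fsv_nth (avg x) i \<bullet> fsv_nth y i)"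
      unfolding avg_inner[symmetric]
    proof (rule inner_fsv_sum[OF F(1)])
      fix i assume "i \<notin> F"
      then have "cl b i k = 0" for k using that by (intro cl_zero) auto
      then show "fsv_nth (avg x) i \<bullet> fsv_nth y i = 0" unfolding frames_avg_nth by simp
    qed
    then show ?thesis unfolding frames_avg_nth e by (simp add: inner_sum_left)
  qed
  have "form_at b x y - form_at c x y
    = (\<Sum>i\<in>F. \<Sum>k\<in>F. ((cl b i k - cl c i k) *v fsv_nth x k) \<bullet> fsv_nth y i)"
    unfolding form[OF F(2)] form[OF F(3)] by (simp add: matrix_vector_mult_diff_rdistrib inner_diff_left sum_subtractf)
  also have "\<bar>\<dots>\<bar> \<le> (\<Sum>i\<in>F. \<Sum>k\<in>F. \<bar>((cl b i k - cl c i k) *v fsv_nth x k) \<bullet> fsv_nth y i\<bar>)"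
    by (rule order_trans[OF sum_abs]) (intro sum_mono sum_abs)
  also have "\<dots> \<le> (\<Sum>i\<in>F. \<Sum>k\<in>F. norm (cl b i k - cl c i k) * norm x * norm y)"
  proof (intro sum_mono)
    fix i k
    have "\<bar>((cl b i k - cl c i k) *v fsv_nth x k) \<bullet> fsv_nth y i\<bar> \<le> norm ((cl b i k - cl c i k) *v fsv_nth x k) * norm (fsv_nth y i)"
      by (rule Cauchy_Schwarz_ineq2)
    also have "\<dots> \<le> (norm (cl b i k - cl c i k) * norm (fsv_nth x k)) * norm (fsv_nth y i)"
      by (intro mult_right_mono norm_mat2_vec_le) auto
    also have "\<dots> \<le> (norm (cl b i k - cl c i k) * norm x) * norm y"
      by (intro mult_mono norm_fsv_nth_le mult_left_mono) auto
    finally show "\<bar>((cl b i k - cl c i k) *v fsv_nth x k) \<bullet> fsv_nth y i\<bar> \<le> norm (cl b i k - cl c i k) * norm x * norm y" .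
  qed
  also have "\<dots> = (\<Sum>i\<in>F. \<Sum>k\<in>F. norm (cl b i k - cl c i k)) * norm x * norm y"
    by (simp add: sum_distrib_right)
  finally show ?thesis .
qed

lemma tendsto_cl:
  assumes V: "open V" "b \<in> V" "finite F" "F \<subseteq> J" "\<And>x. x \<in> V \<Longrightarrow> I x \<subseteq> F"
  shows "((\<lambda>x. cl x i k) \<longlongrightarrow> cl b i k) (at b)"
proof -
  have eq: "(\<Sum>j\<in>F. \<rho> j x *\<^sub>R (\<Psi> j x i ** transpose (\<Psi> j x k))) = cl x i k" if "x \<in> V" for x
    unfolding cl_map_def I_def[symmetric] using V(3,4) V(5)[OF that]
    by (intro sum.mono_neutral_right) (auto simp: I_def)
  have "continuous_on UNIV (\<lambda>x. \<Sum>j\<in>F. \<rho> j x *\<^sub>R (\<Psi> j x i ** transpose (\<Psi> j x k)))"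
    using V(4) by (intro continuous_on_sum continuous_on_cl_term) auto
  from continuous_on_eq[OF continuous_on_subset[OF this subset_UNIV] eq]
  have "continuous_on V (\<lambda>x. cl x i k)" .
  then show ?thesis using V(1,2) by (simp add: continuous_on_open_tendsto)
qed

text \<open>The bases \<open>v x\<close>, \<open>w x\<close> are chosen pointwise, but the Gram
  entry involves only their projection. Comparison with \<open>h\<close>, where the projection is
  frozen at \<open>b\<close>, leaves an error of at most \<open>8 * \<eta> x\<close>, and
  \<open>h\<close> converges because the frames do.\<close>

lemma tendsto_gram:
  assumes e: "\<And>x. eigen_at x (v x) (w x)" and b: "j \<in> K b" "k \<in> K b"
  shows "((\<lambda>x. (transpose (Cmat (v x) (w x) j x) ** Cmat (v x) (w x) k x) $ s $ t) \<longlongrightarrow>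
    (transpose (Cmat (v b) (w b) j b) ** Cmat (v b) (w b) k b) $ s $ t) (at b)"
proof -
  have J: "j \<in> J" "k \<in> J" "b \<in> U j" "b \<in> U k" using b by (auto simp: K_def)
  define p q where "p x = emb (\<Psi> j x) (axis s 1)" and "q x = emb (\<Psi> k x) (axis t 1)" for x
  define G where "G x = span_proj (v x) (w x) (p x) \<bullet> q x" for x
  define h where "h x = span_proj (v b) (w b) (p x) \<bullet> q x" for x
  obtain V F where V: "open V" "b \<in> V" "finite F" "F \<subseteq> J" "\<And>x. x \<in> V \<Longrightarrow> I x \<subseteq> F" using locally_finite_at[of b] by blast
  define \<eta> where "\<eta> x = (\<Sum>i\<in>F. \<Sum>k\<in>F. norm (cl x i k - cl b i k))" for x
  define V' where "V' = V \<inter> U j \<inter> U k"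
  have V': "open V'" unfolding V'_def by (intro open_Int V(1) U J)
  have bV': "b \<in> V'" using V(2) J by (simp add: V'_def)
  have close: "\<bar>G x - h x\<bar> \<le> 8 * \<eta> x" if x: "x \<in> V'" for x
  proof -
    have K: "j \<in> K x" "k \<in> K x" using x J by (auto simp: V'_def K_def)
    obtain \<mu> \<nu> where 1: "eigen_data x (v x) (w x) \<mu> \<nu>"
      using e[of x] unfolding eigen_at_def by blast
    obtain \<mu>' \<nu>' where 2: "eigen_data b (v b) (w b) \<mu>' \<nu>'"
      using e[of b] unfolding eigen_at_def by blast
    have "norm (p x) = 1" "norm (q x) = 1"
      using emb_Psi_isometry[OF K(1)] emb_Psi_isometry[OF K(2)] by (simp_all add: p_def q_def norm_eq_sqrt_inner)
    moreover have "I x \<subseteq> F" "I b \<subseteq> F" using V(5) V(2) x by (auto simp: V'_def)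
    then have "\<bar>G x - h x\<bar> \<le> 8 * \<eta> x * norm (p x) * norm (q x)"
      unfolding G_def h_def \<eta>_def
      by (intro eigen_frames_proj_close[OF 1 2] form_diff_le V(3))
    ultimately show ?thesis by simp
  qed
  have "(\<eta> \<longlongrightarrow> (\<Sum>i\<in>F. \<Sum>k\<in>F. norm (cl b i k - cl b i k))) (at b)"
    unfolding \<eta>_def by (intro tendsto_intros tendsto_cl[OF V])
  then have "((\<lambda>x. 8 * \<eta> x) \<longlongrightarrow> 0) (at b)" using tendsto_mult_left[of \<eta> 0 "at b" 8] by simp
  moreover have "eventually (\<lambda>x. norm (G x - h x) \<le> 8 * \<eta> x) (at b)"
    unfolding eventually_at_topological real_norm_def using V' bV' close by blast
  ultimately have "((\<lambda>x. G x - h x) \<longlongrightarrow> 0) (at b)" by (rule Lim_null_comparison[rotated])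
  moreover have "(h \<longlongrightarrow> h b) (at b)"
    unfolding h_def span_proj_def p_def q_def using J by (intro tendsto_intros tendsto_emb_Psi)
  ultimately have "((\<lambda>x. (G x - h x) + h x) \<longlongrightarrow> 0 + h b) (at b)" by (rule tendsto_add)
  then have lim: "(G \<longlongrightarrow> G b) (at b)" by (simp add: G_def[abs_def] h_def)
  have GC: "(transpose (Cmat (v x) (w x) j x) ** Cmat (v x) (w x) k x) $ s $ t = G x" if "x \<in> V'" for x
    unfolding G_def p_def q_def using that J by (intro eigen_at_Pi_Z(4)[OF e]) (auto simp: V'_def K_def)
  have "eventually (\<lambda>x. G x = (transpose (Cmat (v x) (w x) j x) ** Cmat (v x) (w x) k x) $ s $ t) (at b)"
    unfolding eventually_at_topological using V' bV' GC[symmetric] by blast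
  from Lim_transform_eventually[OF lim this] show ?thesis unfolding GC[OF bV'] .
qed

lemma continuous_on_psqrt_inv:
  assumes "continuous_on S G" "\<And>x. x \<in> S \<Longrightarrow> 0 < det (G x)" "\<And>x. x \<in> S \<Longrightarrow> 0 < trace (G x) + 2 * sqrt (det (G x))"
  shows "continuous_on S (\<lambda>x. psqrt_inv (G x))"
proof -
  have t: "continuous_on S (\<lambda>x. trace (G x))"
    using assms(1) by (auto simp: trace_2 continuous_on_mat2_iff intro!: continuous_intros)
  have m: "continuous_on S (\<lambda>x. mat (f x) :: mat2)" if "continuous_on S f" for f
    using that unfolding continuous_on_mat2_iff forall_2 by (simp add: mat_nth2)
  have "det (G x) \<noteq> 0" "trace (G x) + 2 * sqrt (det (G x)) \<noteq> 0" if "x \<in> S" for x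
    using assms(2,3)[OF that] by auto
  then show ?thesis unfolding psqrt_inv_def psqrt_def
    by (intro continuous_intros m t assms(1)) auto
qed

text \<open>The polar factors need not be continuous, but \<open>Pi_Z\<close> is
  \<open>psqrt_inv (G j j) ** G j k ** psqrt_inv (G k k)\<close>, a continuous expression in Gram
  matrices. Exactness is the cancellation of the middle orthogonal factor.\<close>

lemma Pi_Z_in_Z1_exact: "Pi_Z J \<rho> \<Omega> \<in> Z1_exact J U"
proof -
  obtain v w where e: "\<And>x. eigen_at x (v x) (w x)" using eigen_at_exists by metis
  define C where "C j x = Cmat (v x) (w x) j x" for j x
  define G where "G j k x = transpose (C j x) ** C k x" for j k x
  have P: "Pi_Z J \<rho> \<Omega> j k x = transpose (polar2 (C j x)) ** polar2 (C k x)" and O: "orthogonal_matrix (polar2 (C j x))"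
    and nz: "det (C j x) \<noteq> 0" if "j \<in> K x" "k \<in> K x" for j k x
    using eigen_at_Pi_Z(1,2)[OF e that] by (auto simp: C_def intro: polar2_orthogonal)
  have "continuous_on (U j \<inter> U k) (Pi_Z J \<rho> \<Omega> j k)" if jk: "j \<in> J" "k \<in> J" for j k
  proof -
    have K: "j \<in> K x" "k \<in> K x" if "x \<in> U j \<inter> U k" for x using that jk by (auto simp: K_def)
    have cG: "continuous_on (U j \<inter> U k) (G p q)" if "p \<in> {j, k}" "q \<in> {j, k}" for p q
      unfolding continuous_on_mat2_iff
    proof (intro allI)
      fix s t
      have "open (U j \<inter> U k)" using U jk by auto
      moreover have "((\<lambda>b. G p q b $ s $ t) \<longlongrightarrow> G p q x $ s $ t) (at x)" if x: "x \<in> U j \<inter> U k" for x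
        unfolding G_def C_def using \<open>p \<in> _\<close> \<open>q \<in> _\<close> K[OF x] by (intro tendsto_gram e) auto
      ultimately show "continuous_on (U j \<inter> U k) (\<lambda>b. G p q b $ s $ t)" by (simp add: continuous_on_open_tendsto)
    qed
    have "continuous_on (U j \<inter> U k) (\<lambda>x. psqrt_inv (G p p x))" if p: "p \<in> {j, k}" for p
    proof (rule continuous_on_psqrt_inv[OF cG[OF p p]])
      fix x assume "x \<in> U j \<inter> U k"
      then have "det (C p x) \<noteq> 0" using nz K p by blast
      from gram_det(1)[OF this refl refl refl] gram_trace(1)[OF this refl refl refl]
      show "0 < det (G p p x)" "0 < trace (G p p x) + 2 * sqrt (det (G p p x))" unfolding G_def by simp_all
    qed
    then have "continuous_on (U j \<inter> U k) (\<lambda>x. psqrt_inv (G j j x) ** G j k x ** psqrt_inv (G k k x))"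
      by (intro continuous_on_mat2_mult cG) auto
    then show ?thesis
    proof (rule continuous_on_eq)
      fix x assume x: "x \<in> U j \<inter> U k"
      have "psqrt_inv (G j j x) = transpose (psqrt_inv (G j j x))"
        using psqrt_inv_sym[OF nz[OF K[OF x]] refl refl refl] by (simp add: G_def)
      then have "psqrt_inv (G j j x) ** G j k x ** psqrt_inv (G k k x) =
        transpose (psqrt_inv (G j j x)) ** transpose (C j x) ** (C k x ** psqrt_inv (G k k x))"
        by (simp add: G_def matrix_mul_assoc)
      also have "\<dots> = Pi_Z J \<rho> \<Omega> j k x"
        unfolding P[OF K[OF x]] polar2_def G_def by (simp add: matrix_transpose_mul)
      finally show "psqrt_inv (G j j x) ** G j k x ** psqrt_inv (G k k x) = Pi_Z J \<rho> \<Omega> j k x" .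
    qed
  qed
  moreover have "orthogonal_matrix (Pi_Z J \<rho> \<Omega> j k x)" if "j \<in> J" "k \<in> J" "x \<in> U j \<inter> U k" for j k x
  proof -
    have "j \<in> K x" "k \<in> K x" using that by (auto simp: K_def)
    then show ?thesis using O by (simp add: P orthogonal_matrix_mul orthogonal_matrix_transpose_iff)
  qed
  moreover have "Pi_Z J \<rho> \<Omega> j k x ** Pi_Z J \<rho> \<Omega> k l x = Pi_Z J \<rho> \<Omega> j l x"
    if "j \<in> J" "k \<in> J" "l \<in> J" "x \<in> U j \<inter> U k \<inter> U l" for j k l x
  proof -
    have K: "j \<in> K x" "k \<in> K x" "l \<in> K x" using that by (auto simp: K_def)
    have "polar2 (C k x) ** transpose (polar2 (C k x)) = mat 1" using O[OF K(2,2)] by (simp add: orthogonal_matrix_def)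
    then have "transpose (polar2 (C j x)) ** (polar2 (C k x) ** transpose (polar2 (C k x))) ** polar2 (C l x) =
      transpose (polar2 (C j x)) ** polar2 (C l x)" by simp
    then show ?thesis using K by (simp add: P matrix_mul_assoc)
  qed
  ultimately show ?thesis unfolding Z1_exact_def C1_O2_def by blast
qed

lemma Pi_Z_close:
  assumes "j \<in> J" "k \<in> J" "b \<in> U j" "b \<in> U k"
  shows "norm (\<Omega> j k b - Pi_Z J \<rho> \<Omega> j k b) < 1"
proof -
  obtain v w where "eigen_at b v w" using eigen_at_exists by blast
  from eigen_at_Pi_Z(3)[OF this] assms show ?thesis by (simp add: K_def norm_minus_commute)
qed

end

theorem corollary4p3:
  fixes J :: "nat set" and U :: "nat \<Rightarrow> 'a::topological_space set" and \<epsilon> :: real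
  assumes paracompact: "paracompact_space (euclidean :: 'a topology)"
    and open_cover: "\<forall>j\<in>J. open (U j)" "(\<Union>j\<in>J. U j) = UNIV"
    and locally_finite: "\<forall>x. \<exists>V. open V \<and> x \<in> V \<and> finite {j\<in>J. U j \<inter> V \<noteq> {}}"
    and good1: "\<forall>j\<in>J. locally path_connected (U j) \<and> simply_connected (U j)"
    and good2: "\<forall>j\<in>J. \<forall>k\<in>J. U j \<inter> U k \<noteq> {} \<longrightarrow>
                  locally path_connected (U j \<inter> U k) \<and> simply_connected (U j \<inter> U k)"
    and eps: "\<epsilon> \<le> 1"
  shows "\<exists>Cl \<in> H1_approx J U \<epsilon> \<rightarrow> twisted_coproduct J U.
    (\<forall>\<Omega>\<in>Z1_approx J U \<epsilon>.
       det_cochain \<Omega> \<in> Z1_sign J U \<and>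
       (\<exists>!c. is_Delta J U (det_cochain \<Omega>) (abs_cochain \<Omega>) c) \<and>
       Delta J U (det_cochain \<Omega>) (abs_cochain \<Omega>) \<in> H2_twisted J U (det_cochain \<Omega>) \<and>
       Cl (orbit J U \<epsilon> \<Omega>) =
         coproduct_elem J U (det_cochain \<Omega>) (Delta J U (det_cochain \<Omega>) (abs_cochain \<Omega>))) \<and>
    (\<forall>x\<in>H1_approx J U \<epsilon>. \<forall>y\<in>H1_approx J U \<epsilon>. dH J U x y < 1 \<longrightarrow> Cl x = Cl y) \<and>
    (\<epsilon> < 1 / 9 \<longrightarrow>
      (\<forall>\<rho>. partition_of_unity J U \<rho> \<longrightarrow>
        (\<forall>\<Omega>\<in>Z1_approx J U \<epsilon>.
           Pi_Z J \<rho> \<Omega> \<in> Z1_exact J U \<and>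
           (\<exists>!c. is_euler_class J U (Pi_Z J \<rho> \<Omega>) c) \<and>
           euler_class J U (Pi_Z J \<rho> \<Omega>) \<in> H2_twisted J U (det_cochain (Pi_Z J \<rho> \<Omega>)) \<and>
           fst ` Cl (orbit J U \<epsilon> \<Omega>) = SW1 J U (Pi_Z J \<rho> \<Omega>) \<and>
           Cl (orbit J U \<epsilon> \<Omega>) =
             coproduct_elem J U (det_cochain (Pi_Z J \<rho> \<Omega>)) (euler_class J U (Pi_Z J \<rho> \<Omega>)))))"
proof -
  \<comment> \<open>The empty set has both properties, so they hold for every pair of
    indices.\<close>
  have good: "\<forall>j\<in>J. \<forall>k\<in>J. simply_connected (U j \<inter> U k) \<and> locally path_connected (U j \<inter> U k)"
  proof (intro ballI)
    fix j k assume "j \<in> J" "k \<in> J"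
    then show "simply_connected (U j \<inter> U k) \<and> locally path_connected (U j \<inter> U k)"
      using good2 by (cases "U j \<inter> U k = {}") (auto simp: locally_def)
  qed
  note orbit_in = orbit_in[where J=J and U=U and \<epsilon>=\<epsilon>] and Cl_map_eq = Cl_map_eq[where J=J and U=U, OF good eps]
    and is_Delta_ex1 = is_Delta_ex1[where J=J and U=U, OF good]
  have P: "\<Omega> \<in> pointwise_Z1 J U 1" if "\<Omega> \<in> Z1_approx J U \<epsilon>" for \<Omega>
    using that Z1_approx_subset_pointwise[of J U \<epsilon>] pointwise_Z1_mono[OF eps, of J U] by blast
  have Cl_orbit: "Cl_map J U (orbit J U \<epsilon> \<Omega>) = Cl_elem J U \<Omega>" if "\<Omega> \<in> Z1_approx J U \<epsilon>" for \<Omega>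
    by (rule Cl_map_eq(1)[OF orbit_in[OF that]])
  show ?thesis
  proof (intro bexI[of _ "Cl_map J U"] conjI ballI allI impI funcsetI)
    fix x assume x: "x \<in> H1_approx J U \<epsilon>"
    obtain \<Omega> where \<Omega>: "\<Omega> \<in> x" using H1_approx_nonempty[OF x] by blast
    have "\<Omega> \<in> pointwise_Z1 J U 1" by (rule Cl_map_eq(2)[OF x \<Omega>])
    then have "Cl_elem J U \<Omega> \<in> twisted_coproduct J U"
      unfolding Cl_elem_def by (intro coproduct_elem_in det_cochain_in_Z1_sign is_Delta_ex1(2))
    moreover have "Cl_map J U x = Cl_elem J U \<Omega>" by (rule Cl_map_eq(1)[OF x \<Omega>])
    ultimately show "Cl_map J U x \<in> twisted_coproduct J U" by simp
  next
    fix x y assume "x \<in> H1_approx J U \<epsilon>" "y \<in> H1_approx J U \<epsilon>" "dH J U x y < 1"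
    with Cl_map_stable[where J=J and U=U, OF good eps] show "Cl_map J U x = Cl_map J U y" by blast
  next
    fix \<Omega> assume \<Omega>: "\<Omega> \<in> Z1_approx J U \<epsilon>"
    show "det_cochain \<Omega> \<in> Z1_sign J U" by (rule det_cochain_in_Z1_sign[OF P[OF \<Omega>]])
    show "\<exists>!c. is_Delta J U (det_cochain \<Omega>) (abs_cochain \<Omega>) c"
      "Delta J U (det_cochain \<Omega>) (abs_cochain \<Omega>) \<in> H2_twisted J U (det_cochain \<Omega>)"
      by (rule is_Delta_ex1[OF P[OF \<Omega>]])+
    show "Cl_map J U (orbit J U \<epsilon> \<Omega>) =
      coproduct_elem J U (det_cochain \<Omega>) (Delta J U (det_cochain \<Omega>) (abs_cochain \<Omega>))"
      using Cl_orbit[OF \<Omega>] by (simp add: Cl_elem_def)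
  next
    fix \<rho> \<Omega> assume \<epsilon>: "\<epsilon> < 1 / 9" and \<rho>: "partition_of_unity J U \<rho>" and Z: "\<Omega> \<in> Z1_approx J U \<epsilon>"
    have \<Omega>\<epsilon>: "\<Omega> \<in> pointwise_Z1 J U \<epsilon>" using Z Z1_approx_subset_pointwise by blast
    \<comment> \<open>An arbitrary point lies in some \<open>U j\<close>; a norm below
      \<open>\<epsilon>\<close> there gives \<open>0 \<le> \<epsilon>\<close>, which the locale asks
      for.\<close>
    obtain j where "j \<in> J" "undefined \<in> U j" using open_cover(2) by blast
    with pointwise_Z1D(2)[OF \<Omega>\<epsilon>, of j j j undefined] have "0 \<le> \<epsilon>" using order_le_less_trans[OF norm_ge_zero] by fastforce
    then interpret approx_cocycle J U \<rho> \<Omega> \<epsilon>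
      using \<Omega>\<epsilon> \<epsilon> \<rho> open_cover(1) locally_finite by unfold_locales auto
    let ?P = "Pi_Z J \<rho> \<Omega>"
    show exact: "?P \<in> Z1_exact J U" by (rule Pi_Z_in_Z1_exact)
    then have P1: "?P \<in> pointwise_Z1 J U 1" using Z1_exact_subset_pointwise[of 1 J U] by auto
    have D: "\<exists>!c. is_Delta J U (det_cochain ?P) (abs_cochain ?P) c"
      "Delta J U (det_cochain ?P) (abs_cochain ?P) \<in> H2_twisted J U (det_cochain ?P)"
      by (rule is_Delta_ex1[OF P1])+
    show "\<exists>!c. is_euler_class J U ?P c" using D(1) unfolding is_euler_class_iff_is_Delta[OF exact] .
    show H2: "euler_class J U ?P \<in> H2_twisted J U (det_cochain ?P)" unfolding euler_class_eq_Delta[OF exact] by (rule D(2))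
    have "Cl_elem J U \<Omega> = Cl_elem J U ?P"
      by (rule Cl_elem_close[where J=J and U=U, OF good P[OF Z] P1 Pi_Z_close])
    then show Cl: "Cl_map J U (orbit J U \<epsilon> \<Omega>) = coproduct_elem J U (det_cochain ?P) (euler_class J U ?P)"
      unfolding Cl_orbit[OF Z] Cl_elem_def euler_class_eq_Delta[OF exact] .
    show "fst ` Cl_map J U (orbit J U \<epsilon> \<Omega>) = SW1 J U ?P"
      unfolding Cl SW1_def by (rule fst_coproduct_elem[OF det_cochain_in_Z1_sign[OF P1] H2])
  qed
qed

end
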